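(* Assume the Riemann hypothesis. Let $T>0$ be a real number which is not the ordinate of any nontrivial zero of $\zeta$, and let $\delta>0$ be the distance from $T$ to the nearest ordinate of a nontrivial zero of $\zeta$. Then for $X\ge 2$, $$\pi S(T)=-\sum_{n<X}\frac{\Lambda(n)\sin(T\log n)}{\sqrt{n}\,\log n}+\frac{\Delta(X)\sin(T\log X)}{\sqrt{X}\,\log X}+\operatorname{Im}\Big(\int_{2}^{\frac{1}{2}+iT}\frac{X^{1-s}}{1-s}\,ds\Big)+O\Big(\frac{T^3}{\delta^{2}\log X}\Big),$$ and consequently $$\pi S(T)=-\lim_{X\rightarrow \infty}\Big[\sum_{n<X}\frac{\Lambda(n)\sin(T\log n)}{\sqrt{n}\,\log n}-\frac{\Delta(X)\sin(T\log X)}{\sqrt{X}\,\log X}-\operatorname{Im}\Big(\int_{2}^{\frac{1}{2}+iT}\frac{X^{1-s}}{1-s}\,ds\Big)\Big].$$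
   Context: $\Lambda$ is the von Mangoldt function, $\psi(x)=\sum_{n<x}\Lambda(n)$ and $\Delta(x)=\psi(x)-x$. The integral $\int_2^{1/2+iT}$ is taken along the path consisting of the segment from $2$ to $2+iT$ followed by the segment from $2+iT$ to $\frac12+iT$. $S(T)=\frac{1}{\pi}\arg\zeta(\frac12+iT)$, where the argument is defined by continuous variation along the same path starting from $\arg\zeta(2)=0$ (equivalently $\pi S(T)=\operatorname{Im}\log\zeta(\frac12+iT)$ with this branch).
   Formalization: The O-constant is uniform in X and in T ≥ T₀ for each T₀ > 0 but may depend on T₀; an absolute constant for all T > 0 is impossible, since at X = 2 the error is about 1.27·T as T → 0+, while T³/(δ² log X) is O(T³). *)

theory Defs
  imports "HOL-Complex_Analysis.Complex_Analysis" "HOL-Number_Theory.Prime_Powers"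
begin

text \<open>
  The Riemann zeta function as the analytic continuation of its Dirichlet series to the
  punctured plane. The clause at the pole \<open>1\<close> only pins down the junk value there, so that the
  described function is unique.
\<close>
definition zeta :: "complex \<Rightarrow> complex" where
  "zeta = (THE f. f holomorphic_on (- {1}) \<and>
                  (\<forall>s. Re s > 1 \<longrightarrow> (\<lambda>n. 1 / of_nat (Suc n) powr s) sums f s) \<and>
                  f 1 = 0)"

definition nontrivial_zeta_zeros :: "complex set" where
  "nontrivial_zeta_zeros =
     {\<rho>. \<rho> \<noteq> 1 \<and> zeta \<rho> = 0 \<and> (\<nexists>n::nat. n \<ge> 1 \<and> \<rho> = - 2 * of_nat n)}"

definition zeta_ordinates :: "real set" where
  "zeta_ordinates = Im ` nontrivial_zeta_zeros"

definition riemann_hypothesis :: bool where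
  "riemann_hypothesis \<longleftrightarrow> (\<forall>\<rho>\<in>nontrivial_zeta_zeros. Re \<rho> = 1 / 2)"

text \<open>The summation condition is the strict inequality \<open>n < x\<close>.\<close>
definition chebyshev_psi :: "real \<Rightarrow> real" where
  "chebyshev_psi x = (\<Sum>n | real n < x. mangoldt n)"

definition psi_error :: "real \<Rightarrow> real" where
  "psi_error x = chebyshev_psi x - x"

definition L_path :: "real \<Rightarrow> real \<Rightarrow> complex" where
  "L_path T = linepath 2 (Complex 2 T) +++ linepath (Complex 2 T) (Complex (1 / 2) T)"

text \<open>
  The value at the end of the path \<open>g\<close> of the argument of \<open>f\<close>, obtained by continuous variation
  along \<open>g\<close> from the value \<open>\<theta>\<^sub>0\<close> at its start. It is meaningful when \<open>f\<close> is continuous and has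
  no zero on \<open>g\<close> and \<open>\<theta>\<^sub>0\<close> is an argument of \<open>f\<close> at the start.
\<close>
definition arg_along :: "(complex \<Rightarrow> complex) \<Rightarrow> (real \<Rightarrow> complex) \<Rightarrow> real \<Rightarrow> real" where
  "arg_along f g \<theta>\<^sub>0 =
     (THE \<theta>. \<exists>a. continuous_on {0..1} a \<and> a 0 = \<theta>\<^sub>0 \<and> a 1 = \<theta> \<and>
                 (\<forall>t\<in>{0..1}. f (g t) = rcis (cmod (f (g t))) (a t)))"

definition zeta_S :: "real \<Rightarrow> real" where
  "zeta_S T = arg_along zeta (L_path T) 0 / pi"

text \<open>
  In the sum below the terms \<open>n = 0\<close> and \<open>n = 1\<close> vanish because \<open>mangoldt\<close> does.
\<close>
definition weighted_sum :: "real \<Rightarrow> real \<Rightarrow> real" where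
  "weighted_sum T X =
     (\<Sum>n | real n < X. mangoldt n * sin (T * ln (real n)) / (sqrt (real n) * ln (real n)))"

definition smoothing_term :: "real \<Rightarrow> real \<Rightarrow> real" where
  "smoothing_term T X = psi_error X * sin (T * ln X) / (sqrt X * ln X)"

definition pole_term :: "real \<Rightarrow> real \<Rightarrow> real" where
  "pole_term T X =
     Im (contour_integral (L_path T) (\<lambda>s. of_real X powr (1 - s) / (1 - s)))"

end

theory Submission
  imports Defs
begin

text \<open>
  Integrating the truncated explicit formula for \<open>\<zeta>'/\<zeta>\<close> along the horizontal segment gives the claim.
  That formula reads, with \<open>\<rho>\<close> ranging over all zeros counted with multiplicity,
  \<open>\<Sum>n<X. \<Lambda>(n) n^-s = - \<zeta>'/\<zeta>(s) + \<Delta>(X) X^-s + X^(1-s)/(1-s) + const * X^-s - s \<Sum>\<rho>. X^(\<rho>-s)/(\<rho>(\<rho>-s))\<close>.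
  On the segment \<open>|\<rho>| / |\<rho>-s| = O(T/\<delta>)\<close>, so the last sum is \<open>O(T X^(1/2-\<sigma>)/\<delta>)\<close> once \<open>\<Sum>\<rho>. 1/|\<rho>|^2\<close> converges,
  and the integral of \<open>X^(1/2-\<sigma>)\<close> over \<open>\<sigma>\<close> supplies the factor \<open>1 / log X\<close>.

  No contour is shifted to obtain the formula. Since \<open>(s-1)\<zeta>(s)\<close> is entire of order less than two, its
  logarithmic derivative has a partial fraction expansion over the zeros. Dividing by \<open>s(s+1)\<close> exhibits the Mellin transform
  of \<open>\<psi>\<^sub>1(x) = \<Sum>n<x. \<Lambda>(n)(x-n)\<close> as that of an explicit absolutely convergent series, and a continuous function
  on \<open>[0,1]\<close> with vanishing moments is zero; so \<open>\<psi>\<^sub>1\<close> equals that series. Partial summation then gives the formula above.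
  The expansion of \<open>\<psi>\<^sub>1\<close> also shows that nontrivial zeros exist: without them \<open>\<psi>\<^sub>1\<close> would be asymptotically a parabola, but it is
  affine between consecutive integers.
\<close>

section \<open>Entire functions of order less than two\<close>

text \<open>\<open>Zeros\<close> holds all zeros of \<open>zeta_entire\<close>, trivial ones
  included; under the hypothesis each has real part at most 1/2. The only information about their
  density is that the sum of 1/|\<rho>|^2 converges. This explains the detour through
  \<open>psi1\<close>: its zero sum has weights 1/(\<rho> (\<rho> + 1)), while the analogous sum for
  psi converges only conditionally. The exponent 3/2 in the growth bounds is a choice strictly
  between 1, the true order of the function (growth like exp (r log r)), and 2, the limit for that
  convergence. Continuation and growth have one source, the Mellin integral of 1/(exp x - 1) cut at
  1: a Bernoulli series below, an entire tail above. The error has to be uniform in T, so the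
  distance to singularities is measured by \<open>gap\<close>, which also accounts for the pole and
  the trivial zeros, all of ordinate 0. The two terms that accompany the sum are the parts of the
  explicit formula that are not small: \<Delta>(X) X^-s integrates to the smoothing term, and
  X^(1-s)/(1-s) stays as an integral.\<close>

definition zero_mult :: "(complex \<Rightarrow> complex) \<Rightarrow> complex \<Rightarrow> nat" where
  "zero_mult f \<rho> = nat (zorder f \<rho>)"

text \<open>The factors equal 1 at 0, so the quotient keeps the value \<open>f 0\<close>, from which
  both the zero count and the logarithm start. A point of \<open>A\<close> that is not a zero has
  order 0 and contributes the factor 1.\<close>

lemma divide_out_zeros:
  fixes f :: "complex \<Rightarrow> complex"
  assumes hol: "f holomorphic_on UNIV" and nz: "f 0 \<noteq> 0" and "finite A" "0 \<notin> A"
  shows "\<exists>h. h holomorphic_on UNIV \<and> (\<forall>z. f z = h z * (\<Prod>\<rho>\<in>A. (1 - z / \<rho>) ^ zero_mult f \<rho>)) \<and>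
             (\<forall>\<rho>\<in>A. h \<rho> \<noteq> 0)"
  using assms(3,4)
proof (induction rule: finite_induct)
  case empty
  show ?case using hol by (intro exI[of _ f]) auto
next
  case (insert a A)
  then obtain h where h: "h holomorphic_on UNIV"
    "\<And>z. f z = h z * (\<Prod>\<rho>\<in>A. (1 - z / \<rho>) ^ zero_mult f \<rho>)" "\<And>\<rho>. \<rho> \<in> A \<Longrightarrow> h \<rho> \<noteq> 0"
    by auto
  have a: "a \<noteq> 0" using insert by auto
  let ?k = "zero_mult f a"
  let ?P = "\<lambda>z. \<Prod>\<rho>\<in>A. (1 - z / \<rho>) ^ zero_mult f \<rho>"
  obtain r where r: "r > 0" "zor_poly f a holomorphic_on cball a r"
    "\<And>w. w \<in> cball a r \<Longrightarrow> f w = zor_poly f a w * (w - a) ^ ?k \<and> zor_poly f a w \<noteq> 0"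
    using conjunct2[OF zorder_exist_zero[OF hol open_UNIV connected_UNIV UNIV_I, of a]] bexI[of "\<lambda>w. f w \<noteq> 0" 0 UNIV] nz
    unfolding zero_mult_def by blast
  define g where "g = zor_poly f a"
  \<comment> \<open>The value at \<open>a\<close> is forced: near \<open>a\<close>, dividing f = g
    (z - a)^k by the remaining factors continues h / (1 - z/a)^k across \<open>a\<close>, and the
    continuation does not vanish there.\<close>
  define H where "H = (\<lambda>z. if z = a then g a * (-a) ^ ?k / ?P a else h z / (1 - z / a) ^ ?k)"
  have Pz: "?P z \<noteq> 0" if "z \<notin> A" for z
    using that insert by (auto simp: prod_zero_iff field_simps)
  have pw: "(z - a) ^ ?k = (-a) ^ ?k * (1 - z / a) ^ ?k" for z
  proof -
    have "z - a = (-a) * (1 - z / a)" using a by (simp add: field_simps)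
    then show ?thesis by (metis power_mult_distrib)
  qed
  have Heq: "H z = g z * (-a) ^ ?k / ?P z" if z: "z \<in> ball a r - A" for z
  proof (cases "z = a")
    case False
    have "h z * ?P z = g z * ((-a) ^ ?k * (1 - z / a) ^ ?k)"
      using r(3)[of z] z h(2)[of z] pw[of z] by (auto simp: g_def)
    then show ?thesis
      using False Pz[of z] z a by (simp add: H_def field_simps)
  qed (simp add: H_def)
  have "H holomorphic_on ball a r - A"
  proof (rule holomorphic_transform)
    show "(\<lambda>z. g z * (-a) ^ ?k / ?P z) holomorphic_on ball a r - A"
      using Pz insert.prems by (intro holomorphic_intros holomorphic_on_subset[OF r(2)[folded g_def]]) auto
  qed (use Heq in auto)
  moreover have "H holomorphic_on - {a}"
  proof (rule holomorphic_transform)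
    show "(\<lambda>z. h z / (1 - z / a) ^ ?k) holomorphic_on - {a}"
      using a by (intro holomorphic_intros holomorphic_on_subset[OF h(1)]) auto
  qed (auto simp: H_def)
  moreover have "open (ball a r - A)"
    using insert.hyps(1) by (intro open_Diff finite_imp_closed) auto
  ultimately have "H holomorphic_on (ball a r - A) \<union> - {a}"
    by (intro holomorphic_on_Un) auto
  moreover have "(ball a r - A) \<union> - {a} = UNIV" using r(1) insert by auto
  ultimately have "H holomorphic_on UNIV" by simp
  moreover have "f z = H z * (\<Prod>\<rho>\<in>insert a A. (1 - z / \<rho>) ^ zero_mult f \<rho>)" for z
  proof (cases "z = a")
    case True
    have "f a = g a * (a - a) ^ ?k" using r(3)[of a] r(1) by (auto simp: g_def)
    moreover have "(1 - a / a) ^ ?k = (0::complex) ^ ?k" using a by simp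
    ultimately show ?thesis using True insert.hyps Pz[of a]
      by (cases "?k = 0") (simp_all add: H_def)
  next
    case False
    then show ?thesis using insert.hyps h(2)[of z] a by (simp add: H_def)
  qed
  moreover have "\<forall>\<rho>\<in>insert a A. H \<rho> \<noteq> 0"
  proof
    fix \<rho> assume "\<rho> \<in> insert a A"
    then show "H \<rho> \<noteq> 0"
      using h(3)[of \<rho>] insert.hyps r(3)[of a] r(1) Pz[of a] a
      by (cases "\<rho> = a") (auto simp: H_def g_def)
  qed
  ultimately show ?case by blast
qed

text \<open>The map w / (2 M - w) sends the half-plane Re w < M into the unit disc and fixes 0, so
  Schwarz's lemma bounds the composite by 1/2 on the half disc. Solving 2 |L| \<le> 2 M + |L| gives
  the constant.\<close>

lemma borel_caratheodory_half:
  assumes hol: "L holomorphic_on ball 0 R" and "R > 0" "L 0 = 0" and "M > 0"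
    and Re: "\<And>z. z \<in> ball 0 R \<Longrightarrow> Re (L z) < M" and z: "norm z \<le> R / 2"
  shows "norm (L z) \<le> 2 * M"
proof -
  define \<phi> where "\<phi> = (\<lambda>w. L (of_real R * w) / (2 * of_real M - L (of_real R * w)))"
  have inb: "of_real R * w \<in> ball 0 R" if "norm w < 1" for w :: complex
    using that \<open>R > 0\<close> by (simp add: norm_mult)
  have lt: "norm (L x) < norm (2 * of_real M - L x)" if "x \<in> ball 0 R" for x
  proof -
    have "(Re (L x))\<^sup>2 < (2 * M - Re (L x))\<^sup>2"
      using mult_strict_left_mono[OF Re[OF that] \<open>M > 0\<close>] by (simp add: power2_eq_square algebra_simps)
    then have "(norm (L x))\<^sup>2 < (norm (2 * of_real M - L x))\<^sup>2"
      by (simp add: cmod_power2)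
    then show ?thesis by (simp add: power2_less_imp_less)
  qed
  have nz: "2 * of_real M - L x \<noteq> 0" if "x \<in> ball 0 R" for x
    using lt[OF that] by force
  have "norm (\<phi> (z / R)) \<le> norm (z / R)"
  proof (rule Schwarz_Lemma(1))
    have "(\<lambda>w. L (of_real R * w)) holomorphic_on ball 0 1"
      by (rule holomorphic_on_compose_gen[of "\<lambda>w. of_real R * w" _ L "ball 0 R", unfolded o_def])
         (use inb hol in \<open>auto intro!: holomorphic_intros\<close>)
    then show "\<phi> holomorphic_on ball 0 1"
      unfolding \<phi>_def using nz inb by (intro holomorphic_intros) (auto simp: dist_norm)
    show "\<phi> 0 = 0" using assms by (simp add: \<phi>_def)
    show "norm (\<phi> w) < 1" if "norm w < 1" for w
      using lt[OF inb[OF that]] nz[OF inb[OF that]] by (simp add: \<phi>_def norm_divide)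
    show "norm (z / complex_of_real R) < 1" using z \<open>R > 0\<close> by (simp add: norm_divide)
  qed
  also have "norm (z / R) \<le> 1 / 2" using z \<open>R > 0\<close> by (simp add: norm_divide field_simps)
  finally have le: "norm (\<phi> (z / R)) \<le> 1 / 2" .
  have zb: "z \<in> ball 0 R" using z \<open>R > 0\<close> by simp
  have "2 * norm (L z) \<le> norm (2 * of_real M - L z)"
    using le nz[OF zb] \<open>R > 0\<close> by (simp add: \<phi>_def norm_divide field_simps)
  also have "\<dots> \<le> 2 * M + norm (L z)"
    using norm_triangle_ineq4[of "2 * complex_of_real M" "L z"] \<open>M > 0\<close> by (simp add: norm_mult)
  finally show ?thesis by simp
qed

text \<open>Subtracting the derivative at 0 leaves only the second derivative to estimate, which
  gains a factor R^-2. When M = O(R^\<alpha>) and R grows, this is where an order below 2 pays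
  off.\<close>

lemma deriv_variation_bound:
  assumes hol: "L holomorphic_on ball 0 R" and "R > 0" "L 0 = 0" and "M > 0"
    and Re: "\<And>z. z \<in> ball 0 R \<Longrightarrow> Re (L z) < M" and z: "norm z < R / 4"
  shows "norm (deriv L z - deriv L 0) \<le> 96 * M / R\<^sup>2 * norm z"
proof -
  have "norm (deriv L z - deriv L 0) \<le> 96 * M / R\<^sup>2 * norm (z - 0)"
  proof (rule field_differentiable_bound[of "ball 0 (R/4)" "deriv L" "deriv (deriv L)"])
    fix w :: complex assume w: "w \<in> ball 0 (R / 4)"
    have "deriv L holomorphic_on ball 0 R" using hol by (intro holomorphic_deriv) auto
    then have "(deriv L has_field_derivative deriv (deriv L) w) (at w)"
      by (rule holomorphic_derivI) (use w \<open>R > 0\<close> in auto)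
    then show "(deriv L has_field_derivative deriv (deriv L) w) (at w within ball 0 (R / 4))"
      by (rule has_field_derivative_at_within)
    have sub: "cball w (R / 4) \<subseteq> cball 0 (R / 2)"
    proof
      fix x assume "x \<in> cball w (R / 4)"
      then show "x \<in> cball 0 (R / 2)" using w norm_triangle_ineq[of w "x - w"]
        by (auto simp: dist_norm norm_minus_commute)
    qed
    have sub2: "cball 0 (R / 2) \<subseteq> ball 0 R" using \<open>R > 0\<close> by auto
    \<comment> \<open>The Cauchy estimate asks for an open target ball, hence 3 M instead of 2 M;
      then 2! * 3 M / (R/4)^2 is the stated 96 M / R^2.\<close>
    have "norm ((deriv ^^ 2) L w) \<le> fact 2 * (3 * M) / (R / 4) ^ 2"
    proof (rule Cauchy_higher_deriv_bound)
      show "L holomorphic_on ball w (R / 4)"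
        using sub sub2 ball_subset_cball by (intro holomorphic_on_subset[OF hol]) blast
      show "continuous_on (cball w (R / 4)) L"
        using sub sub2 by (intro continuous_on_subset[OF holomorphic_on_imp_continuous_on[OF hol]]) blast
      show "L x \<in> ball 0 (3 * M)" if "x \<in> ball w (R / 4)" for x
      proof -
        have "x \<in> cball 0 (R / 2)" using that sub ball_subset_cball by blast
        then have "norm (L x) \<le> 2 * M" using borel_caratheodory_half[OF assms(1-5), of x] by simp
        then show ?thesis using \<open>M > 0\<close> by simp
      qed
    qed (use \<open>R > 0\<close> in auto)
    then show "norm (deriv (deriv L) w) \<le> 96 * M / R\<^sup>2"
      by (simp add: eval_nat_numeral field_simps)
  qed (use z \<open>R > 0\<close> in auto)
  then show ?thesis by simp
qed

lemma has_field_derivative_zero_prod: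
  fixes k :: "complex \<Rightarrow> nat"
  assumes "finite A" "0 \<notin> A" "z \<notin> A"
  shows "((\<lambda>z. \<Prod>\<rho>\<in>A. (1 - z / \<rho>) ^ k \<rho>) has_field_derivative
           (\<Prod>\<rho>\<in>A. (1 - z / \<rho>) ^ k \<rho>) * (\<Sum>\<rho>\<in>A. of_nat (k \<rho>) / (z - \<rho>))) (at z)"
  using assms
proof (induction rule: finite_induct)
  case (insert a A)
  have a: "a \<noteq> 0" "z \<noteq> a" using insert by auto
  then have ne: "1 - z / a \<noteq> 0" by (auto simp: field_simps)
  have "((\<lambda>z. (1 - z / a) ^ k a) has_field_derivative of_nat (k a) * (1 - z / a) ^ (k a - 1) * (- 1 / a)) (at z)"
    using a by (auto intro!: derivative_eq_intros)
  moreover have "of_nat (k a) * (1 - z / a) ^ (k a - 1) * (- 1 / a) = (1 - z / a) ^ k a * (of_nat (k a) / (z - a))"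
  proof (cases "k a")
    case (Suc n)
    have e: "(1 - z / a) / (z - a) = - 1 / a" using a by (simp add: divide_simps)
    have "(1 - z / a) ^ k a * (of_nat (k a) / (z - a)) = of_nat (k a) * (1 - z / a) ^ n * ((1 - z / a) / (z - a))"
      using Suc by simp
    then show ?thesis using e Suc by simp
  qed simp
  ultimately have 1: "((\<lambda>z. (1 - z / a) ^ k a) has_field_derivative (1 - z / a) ^ k a * (of_nat (k a) / (z - a))) (at z)"
    by simp
  have 2: "((\<lambda>z. \<Prod>\<rho>\<in>A. (1 - z / \<rho>) ^ k \<rho>) has_field_derivative
           (\<Prod>\<rho>\<in>A. (1 - z / \<rho>) ^ k \<rho>) * (\<Sum>\<rho>\<in>A. of_nat (k \<rho>) / (z - \<rho>))) (at z)"
    using insert by simp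
  show ?case
    using DERIV_mult[OF 1 2] insert.hyps by (simp add: algebra_simps)
qed simp

text \<open>The shift by 2 keeps the base of the power above 1, so the bound also dominates
  constants and needs no exception near 0.\<close>

locale entire_finite_order =
  fixes f :: "complex \<Rightarrow> complex" and \<alpha> C :: real
  assumes entire: "f holomorphic_on UNIV" and f0: "f 0 \<noteq> 0"
    and growth: "norm (f z) \<le> exp (C * (norm z + 2) powr \<alpha>)"
    and order: "0 < \<alpha>" "\<alpha> < 2" and C_nonneg: "C \<ge> 0"
begin

definition Zeros :: "complex set" where "Zeros = {z. f z = 0}"

definition zmult :: "complex \<Rightarrow> real" where "zmult \<rho> = real (zero_mult f \<rho>)"

lemma zmult_nonneg [simp]: "zmult \<rho> \<ge> 0"
  by (simp add: zmult_def)

lemma zero_notin_Zeros [simp]: "0 \<notin> Zeros"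
  using f0 by (simp add: Zeros_def)

lemma finite_Zeros_cball: "finite (Zeros \<inter> cball 0 r)"
proof -
  have "finite {z \<in> cball 0 r. f z = 0}"
  proof (cases "f constant_on UNIV")
    case True
    then have "{z \<in> cball 0 r. f z = 0} = {}" using f0 by (auto simp: constant_on_def)
    then show ?thesis by (metis finite.emptyI)
  next
    case False
    then show ?thesis
      by (intro holomorphic_compact_finite_zeros[of f UNIV]) (use entire in auto)
  qed
  then show ?thesis by (rule rev_finite_subset) (auto simp: Zeros_def)
qed

text \<open>On the circle of radius r each factor has modulus at least |w/\<rho>| - 1 \<ge> q, so
  there \<open>h\<close> is smaller than \<open>f\<close> by q to the number of zeros; the maximum
  principle carries this inside. Taking q = 3 counts zeros, taking q = 1 bounds the
  quotient.\<close>

lemma norm_quotient_le: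
  assumes A: "A \<subseteq> Zeros" "finite A" and h: "h holomorphic_on UNIV"
    "\<And>z. f z = h z * (\<Prod>\<rho>\<in>A. (1 - z / \<rho>) ^ zero_mult f \<rho>)"
    and q: "q \<ge> 1" "r > 0" and far: "\<And>\<rho>. \<rho> \<in> A \<Longrightarrow> (q + 1) * norm \<rho> \<le> r" and z: "norm z \<le> r"
  shows "norm (h z) * q ^ (\<Sum>\<rho>\<in>A. zero_mult f \<rho>) \<le> exp (C * (r + 2) powr \<alpha>)"
proof -
  let ?n = "\<Sum>\<rho>\<in>A. zero_mult f \<rho>"
  have "norm (h z * of_real (q ^ ?n)) \<le> exp (C * (r + 2) powr \<alpha>)"
  proof (rule maximum_modulus_frontier[of "\<lambda>z. h z * of_real (q ^ ?n)" "cball 0 r"])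
    fix w :: complex assume "w \<in> frontier (cball 0 r)"
    then have w: "norm w = r" using q by (simp add: frontier_cball)
    have "q ^ ?n = (\<Prod>\<rho>\<in>A. q ^ zero_mult f \<rho>)" by (simp add: power_sum)
    also have "\<dots> \<le> (\<Prod>\<rho>\<in>A. norm (1 - w / \<rho>) ^ zero_mult f \<rho>)"
    proof (intro prod_mono conjI power_mono)
      fix \<rho> assume \<rho>: "\<rho> \<in> A"
      then have "\<rho> \<noteq> 0" using A by auto
      then have "q + 1 \<le> norm (w / \<rho>)" using far[OF \<rho>] w by (simp add: norm_divide field_simps)
      then show "q \<le> norm (1 - w / \<rho>)" using norm_triangle_ineq2[of "w / \<rho>" 1] by (simp add: norm_minus_commute)
    qed (use q in auto)
    also have "\<dots> = norm (\<Prod>\<rho>\<in>A. (1 - w / \<rho>) ^ zero_mult f \<rho>)"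
      by (simp add: prod_norm[symmetric] norm_power)
    finally have "norm (h w) * q ^ ?n \<le> norm (f w)"
      unfolding h(2)[of w] norm_mult by (intro mult_left_mono) auto
    also have "\<dots> \<le> exp (C * (r + 2) powr \<alpha>)" using growth[of w] w by simp
    finally show "norm (h w * of_real (q ^ ?n)) \<le> exp (C * (r + 2) powr \<alpha>)"
      using q by (simp add: norm_mult norm_power)
  next
    have "(\<lambda>z. h z * of_real (q ^ ?n)) holomorphic_on UNIV"
      by (intro holomorphic_intros h(1))
    then show "(\<lambda>z. h z * of_real (q ^ ?n)) holomorphic_on interior (cball 0 r)"
      and "continuous_on (closure (cball 0 r)) (\<lambda>z. h z * of_real (q ^ ?n))"
      by (meson holomorphic_on_subset holomorphic_on_imp_continuous_on subset_UNIV)+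
  qed (use z in auto)
  then show ?thesis using q by (simp add: norm_mult norm_power)
qed

text \<open>Takes the part of Jensen's formula: \<open>norm_quotient_le\<close> at the point 0, with
  q = 3 and radius 4 r, turns the growth bound into a bound on 3 to the number of zeros.\<close>

lemma zero_count_bound:
  obtains K where "K \<ge> 0"
    "\<And>r A. r \<ge> 1 \<Longrightarrow> finite A \<Longrightarrow> A \<subseteq> Zeros \<inter> cball 0 r \<Longrightarrow> (\<Sum>\<rho>\<in>A. zmult \<rho>) \<le> K * r powr \<alpha>"
proof
  show "C * 6 powr \<alpha> + \<bar>ln (norm (f 0))\<bar> \<ge> 0" using C_nonneg by auto
  fix r :: real and A assume r: "r \<ge> 1" and fin: "finite A" and A: "A \<subseteq> Zeros \<inter> cball 0 r"
  obtain h where h: "h holomorphic_on UNIV"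
    "\<And>z. f z = h z * (\<Prod>\<rho>\<in>A. (1 - z / \<rho>) ^ zero_mult f \<rho>)"
    using divide_out_zeros[OF entire f0 fin] A zero_notin_Zeros by blast
  let ?n = "\<Sum>\<rho>\<in>A. zero_mult f \<rho>"
  have h0: "h 0 = f 0" using h(2)[of 0] by simp
  have "norm (h 0) * 3 ^ ?n \<le> exp (C * (4 * r + 2) powr \<alpha>)"
    by (rule norm_quotient_le[OF _ fin h]) (use A r in auto)
  also have "\<dots> \<le> exp (C * (6 * r) powr \<alpha>)"
    using r order C_nonneg by (auto intro!: mult_left_mono powr_mono2)
  finally have le: "norm (f 0) * 3 ^ ?n \<le> exp (C * (6 * r) powr \<alpha>)" by (simp add: h0)
  have "ln (norm (f 0) * 3 ^ ?n) \<le> C * (6 * r) powr \<alpha>"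
    using le f0 ln_mono[OF le] by simp
  then have 1: "ln (norm (f 0)) + ?n * ln 3 \<le> C * 6 powr \<alpha> * r powr \<alpha>"
    using f0 r by (simp add: ln_mult ln_realpow powr_mult)
  have "ln 3 \<ge> (1::real)" using exp_le by (simp add: ln_ge_iff)
  then have "real ?n * 1 \<le> ?n * ln 3" by (rule mult_left_mono) (rule of_nat_0_le_iff)
  moreover have "\<bar>ln (norm (f 0))\<bar> * 1 \<le> \<bar>ln (norm (f 0))\<bar> * r powr \<alpha>"
    using r order by (intro mult_left_mono ge_one_powr_ge_zero) auto
  ultimately show "(\<Sum>\<rho>\<in>A. zmult \<rho>) \<le> (C * 6 powr \<alpha> + \<bar>ln (norm (f 0))\<bar>) * r powr \<alpha>"
    using 1 by (simp add: zmult_def algebra_simps)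
qed

text \<open>The zeros with 2^(k-1) < |\<rho>| \<le> 2^k number O(2^(k \<alpha>)) and weigh at most 4
  * 4^-k each, which gives a geometric series of ratio 2^(\<alpha> - 2). Level 0 is the whole unit
  disc, where this weight bound fails; its finitely many zeros are summed as
  \<open>S0\<close>.\<close>

lemma summable_zmult: "(\<lambda>\<rho>. zmult \<rho> / (norm \<rho>)\<^sup>2) summable_on Zeros"
proof -
  obtain K where K: "K \<ge> 0"
    "\<And>r A. r \<ge> 1 \<Longrightarrow> finite A \<Longrightarrow> A \<subseteq> Zeros \<inter> cball 0 r \<Longrightarrow> (\<Sum>\<rho>\<in>A. zmult \<rho>) \<le> K * r powr \<alpha>"
    using zero_count_bound by metis
  define S0 where "S0 = (\<Sum>\<rho>\<in>Zeros \<inter> cball 0 1. zmult \<rho> / (norm \<rho>)\<^sup>2)"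
  define q where "q = 2 powr (\<alpha> - 2)"
  have q: "0 < q" "q < 1" using order by (auto simp: q_def powr_less_one)
  define lev where "lev = (\<lambda>\<rho>::complex. LEAST k::nat. norm \<rho> \<le> 2 ^ k)"
  have lev1: "norm \<rho> \<le> 2 ^ lev \<rho>" for \<rho>
    unfolding lev_def by (rule LeastI_ex) (use real_arch_pow[of 2 "norm \<rho>"] in \<open>auto intro: less_imp_le\<close>)
  have lev2: "norm \<rho> > 2 ^ k" if "lev \<rho> = Suc k" for \<rho> k
    using not_less_Least[of k "\<lambda>k. norm \<rho> \<le> 2 ^ k"] that unfolding lev_def by auto
  show ?thesis
  proof (rule nonneg_bdd_above_summable_on)
    show "bdd_above (sum (\<lambda>\<rho>. zmult \<rho> / (norm \<rho>)\<^sup>2) ` {F. F \<subseteq> Zeros \<and> finite F})"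
    proof (rule bdd_aboveI2)
      fix F assume "F \<in> {F. F \<subseteq> Zeros \<and> finite F}"
      then have F: "F \<subseteq> Zeros" "finite F" by auto
      define N where "N = Suc (Max (insert 0 (lev ` F)))"
      have N: "lev ` F \<subseteq> {..<N}" using F by (auto simp: N_def less_Suc_eq_le)
      have "(\<Sum>\<rho>\<in>F. zmult \<rho> / (norm \<rho>)\<^sup>2) = (\<Sum>k<N. \<Sum>\<rho>\<in>{\<rho>\<in>F. lev \<rho> = k}. zmult \<rho> / (norm \<rho>)\<^sup>2)"
        by (rule sum.group[symmetric]) (use F N in auto)
      also have "\<dots> \<le> (\<Sum>k<N. (if k = 0 then S0 else 0) + 4 * K * q ^ k)"
      proof (rule sum_mono)
        fix k
        show "(\<Sum>\<rho>\<in>{\<rho>\<in>F. lev \<rho> = k}. zmult \<rho> / (norm \<rho>)\<^sup>2) \<le> (if k = 0 then S0 else 0) + 4 * K * q ^ k"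
        proof (cases k)
          case 0
          have "(\<Sum>\<rho>\<in>{\<rho>\<in>F. lev \<rho> = k}. zmult \<rho> / (norm \<rho>)\<^sup>2) \<le> S0"
            unfolding S0_def
          proof (rule sum_mono2[OF finite_Zeros_cball])
            show "{\<rho> \<in> F. lev \<rho> = k} \<subseteq> Zeros \<inter> cball 0 1"
            proof
              fix x assume "x \<in> {\<rho> \<in> F. lev \<rho> = k}"
              then show "x \<in> Zeros \<inter> cball 0 1" using lev1[of x] 0 F by auto
            qed
          qed auto
          then show ?thesis using 0 K q by (simp add: add_increasing2)
        next
          case (Suc j)
          have "(\<Sum>\<rho>\<in>{\<rho>\<in>F. lev \<rho> = k}. zmult \<rho> / (norm \<rho>)\<^sup>2) \<le> (\<Sum>\<rho>\<in>{\<rho>\<in>F. lev \<rho> = k}. zmult \<rho> / (2 ^ j)\<^sup>2)"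
          proof (intro sum_mono divide_left_mono power_mono)
            fix \<rho> assume "\<rho> \<in> {\<rho> \<in> F. lev \<rho> = k}"
            then have l: "lev \<rho> = Suc j" using Suc by simp
            then show "2 ^ j \<le> norm \<rho>" using lev2[OF l] by simp
            show "0 < (norm \<rho>)\<^sup>2 * (2 ^ j)\<^sup>2"
              using lev2[OF l] less_trans[of 0 "2 ^ j" "norm \<rho>"] by (auto intro!: mult_pos_pos)
          qed auto
          also have "\<dots> = (\<Sum>\<rho>\<in>{\<rho>\<in>F. lev \<rho> = k}. zmult \<rho>) / (2 ^ j)\<^sup>2"
            by (simp add: sum_divide_distrib)
          also have "\<dots> \<le> K * (2 ^ k) powr \<alpha> / (2 ^ j)\<^sup>2"
          proof (intro divide_right_mono K)
            show "{\<rho> \<in> F. lev \<rho> = k} \<subseteq> Zeros \<inter> cball 0 (2 ^ k)" using F lev1 by auto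
          qed (use F in auto)
          finally have le: "(\<Sum>\<rho>\<in>{\<rho>\<in>F. lev \<rho> = k}. zmult \<rho> / (norm \<rho>)\<^sup>2) \<le> K * (2 ^ k) powr \<alpha> / (2 ^ j)\<^sup>2" .
          have eq: "(2 ^ k) powr \<alpha> / (2 ^ j)\<^sup>2 = 4 * q ^ k"
          proof -
            have "(2 ^ k) powr \<alpha> = 2 powr (\<alpha> * k)"
              by (simp add: powr_powr powr_realpow[symmetric] mult.commute)
            moreover have "(2 ^ j)\<^sup>2 = (2::real) powr (2 * real k - 2)"
            proof -
              have "2 * real k - 2 = real (j * 2)" using Suc by simp
              then show ?thesis by (simp only: powr_realpow[of 2] power_mult zero_less_numeral)
            qed
            moreover have "q ^ k = 2 powr ((\<alpha> - 2) * k)"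
              using q(1) unfolding q_def by (simp add: powr_realpow[symmetric] powr_powr)
            moreover have "2 powr (\<alpha> * k) / 2 powr (2 * real k - 2) = (2::real) powr 2 * 2 powr ((\<alpha> - 2) * k)"
              unfolding powr_diff[symmetric] powr_add[symmetric] by (rule arg_cong[of _ _ "(powr) 2"]) (simp add: algebra_simps)
            ultimately show ?thesis by simp
          qed
          have "K * (2 ^ k) powr \<alpha> / (2 ^ j)\<^sup>2 = 4 * K * q ^ k"
            unfolding times_divide_eq_right[symmetric] eq by simp
          with le show ?thesis using Suc by simp
        qed
      qed
      also have "\<dots> \<le> S0 + 4 * K * (1 / (1 - q))"
      proof -
        have "(\<Sum>k<N. q ^ k) \<le> (\<Sum>k. q ^ k)" using q by (intro sum_le_suminf summable_geometric) auto
        then have "(\<Sum>k<N. q ^ k) \<le> 1 / (1 - q)" using q by (simp add: suminf_geometric)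
        then have "4 * K * (\<Sum>k<N. q ^ k) \<le> 4 * K * (1 / (1 - q))" using K by (intro mult_left_mono) auto
        moreover have "(\<Sum>k<N. if k = 0 then S0 else 0) = S0" by (simp add: sum.delta N_def)
        ultimately show ?thesis by (simp add: sum.distrib sum_distrib_left)
      qed
      finally show "(\<Sum>\<rho>\<in>F. zmult \<rho> / (norm \<rho>)\<^sup>2) \<le> S0 + 4 * K * (1 / (1 - q))" .
    qed
  qed auto
qed


text \<open>Dividing out the zeros in \<open>cball 0 r\<close> leaves a function with a logarithm \<open>L0\<close> of real part \<open>O(r powr \<alpha>)\<close>;
  its second derivative is then \<open>O(r powr (\<alpha> - 2))\<close>.\<close>

lemma logderiv_approx:
  obtains K where "\<And>r s. r \<ge> 1 \<Longrightarrow> norm s < r / 4 \<Longrightarrow> f s \<noteq> 0 \<Longrightarrow>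
    norm (deriv f s / f s - deriv f 0 / f 0 - (\<Sum>\<rho>\<in>Zeros \<inter> cball 0 r. of_real (zmult \<rho>) * s / (\<rho> * (s - \<rho>))))
      \<le> K * r powr (\<alpha> - 2) * norm s"
proof
  fix r :: real and s :: complex
  assume r: "r \<ge> 1" and s: "norm s < r / 4" and fs: "f s \<noteq> 0"
  define A where "A = Zeros \<inter> cball 0 r"
  have fin: "finite A" and A0: "0 \<notin> A" using finite_Zeros_cball by (auto simp: A_def)
  obtain h where h: "h holomorphic_on UNIV"
    "\<And>z. f z = h z * (\<Prod>\<rho>\<in>A. (1 - z / \<rho>) ^ zero_mult f \<rho>)" "\<And>\<rho>. \<rho> \<in> A \<Longrightarrow> h \<rho> \<noteq> 0"
    using divide_out_zeros[OF entire f0 fin A0] by blast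
  have h0: "h 0 = f 0" using h(2)[of 0] by simp
  have hnz: "h z \<noteq> 0" if "z \<in> ball 0 r" for z
    using h(2)[of z] h(3)[of z] that by (auto simp: A_def Zeros_def)
  have hb: "norm (h z) \<le> exp (C * 4 powr \<alpha> * r powr \<alpha>)" if "norm z \<le> r" for z
  proof -
    have "norm (h z) * 1 ^ (\<Sum>\<rho>\<in>A. zero_mult f \<rho>) \<le> exp (C * (2 * r + 2) powr \<alpha>)"
      by (rule norm_quotient_le[OF _ fin h(1,2)]) (use r that in \<open>auto simp: A_def\<close>)
    also have "\<dots> \<le> exp (C * (4 * r) powr \<alpha>)"
      using r order C_nonneg by (auto intro!: mult_left_mono powr_mono2)
    finally show ?thesis using r by (simp add: powr_mult mult.assoc)
  qed
  have sc: "simply_connected (ball (0::complex) r)" by (simp add: convex_imp_simply_connected)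
  have hb_hol: "h holomorphic_on ball 0 r" using h(1) by (rule holomorphic_on_subset) auto
  obtain L where L: "L holomorphic_on ball 0 r" "\<And>z. z \<in> ball 0 r \<Longrightarrow> h z = exp (L z)"
    using simply_connected_eq_holomorphic_log[of "ball (0::complex) r"] sc hb_hol hnz by (metis open_ball)
  define L0 where "L0 = (\<lambda>z. L z - L 0)"
  \<comment> \<open>Since \<open>r powr \<alpha>\<close> is at least 1 it absorbs the value at 0,
    and the extra 1 makes the bound on the real part strict, as
    \<open>borel_caratheodory_half\<close> demands.\<close>
  define M where "M = (C * 4 powr \<alpha> + \<bar>ln (norm (f 0))\<bar> + 1) * r powr \<alpha>"
  have rp: "r powr \<alpha> \<ge> 1" using r order by (intro ge_one_powr_ge_zero) auto
  have Mpos: "M > 0" using rp C_nonneg by (auto simp: M_def intro!: mult_pos_pos add_nonneg_pos)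
  have L0hol: "L0 holomorphic_on ball 0 r" unfolding L0_def by (intro holomorphic_intros L)
  have Re: "Re (L0 z) < M" if z: "z \<in> ball 0 r" for z
  proof -
    have "norm (h z) = exp (Re (L z))" using L(2)[OF z] by simp
    then have 1: "Re (L z) \<le> C * 4 powr \<alpha> * r powr \<alpha>" using hb[of z] z by simp
    have "norm (f 0) = exp (Re (L 0))" using L(2)[of 0] r h0 by simp
    then have 2: "ln (norm (f 0)) = Re (L 0)" by simp
    have "\<bar>ln (norm (f 0))\<bar> * 1 \<le> \<bar>ln (norm (f 0))\<bar> * r powr \<alpha>"
      using rp by (intro mult_left_mono) auto
    then show ?thesis using 1 2 rp by (simp add: L0_def M_def algebra_simps)
  qed
  have dL: "deriv L0 z = deriv h z / h z" if z: "z \<in> ball 0 r" for z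
  proof -
    have "(L has_field_derivative deriv L z) (at z)" by (rule holomorphic_derivI[OF L(1) _ z]) auto
    then have "((\<lambda>z. exp (L z)) has_field_derivative exp (L z) * deriv L z) (at z)"
      by (auto intro!: derivative_eq_intros)
    then have "(h has_field_derivative exp (L z) * deriv L z) (at z)"
      by (rule has_field_derivative_transform_within_open[of _ _ _ "ball 0 r"]) (use z L(2) in auto)
    then have "deriv h z = h z * deriv L z" using L(2)[OF z] by (simp add: DERIV_imp_deriv)
    moreover have "deriv L0 z = deriv L z"
      using holomorphic_on_imp_differentiable_at[OF L(1) _ z] unfolding L0_def by simp
    ultimately show ?thesis using hnz[OF z] by simp
  qed
  have ld: "deriv f z / f z = deriv L0 z + (\<Sum>\<rho>\<in>A. of_nat (zero_mult f \<rho>) / (z - \<rho>))"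
    if z: "z \<in> ball 0 r" and fz: "f z \<noteq> 0" for z
  proof -
    let ?P = "\<Prod>\<rho>\<in>A. (1 - z / \<rho>) ^ zero_mult f \<rho>" and ?S = "\<Sum>\<rho>\<in>A. of_nat (zero_mult f \<rho>) / (z - \<rho>)"
    have zA: "z \<notin> A" using fz by (auto simp: A_def Zeros_def)
    have "(h has_field_derivative deriv h z) (at z)" by (rule holomorphic_derivI[OF h(1)]) auto
    from DERIV_mult[OF this has_field_derivative_zero_prod[OF fin A0 zA, of "zero_mult f"]]
    have "(f has_field_derivative deriv h z * ?P + ?P * ?S * h z) (at z)"
      by (simp only: h(2)[symmetric])
    then have "deriv f z = deriv h z * ?P + ?P * ?S * h z" by (rule DERIV_imp_deriv)
    then show ?thesis using h(2)[of z] fz dL[OF z] by (simp add: field_simps)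
  qed
  have "norm (deriv L0 s - deriv L0 0) \<le> 96 * M / r\<^sup>2 * norm s"
    by (rule deriv_variation_bound[OF L0hol _ _ Mpos Re s]) (use r in \<open>auto simp: L0_def\<close>)
  moreover have "deriv L0 s - deriv L0 0 = deriv f s / f s - deriv f 0 / f 0 -
       (\<Sum>\<rho>\<in>A. of_real (zmult \<rho>) * s / (\<rho> * (s - \<rho>)))"
  proof -
    have "(\<Sum>\<rho>\<in>A. of_nat (zero_mult f \<rho>) / (s - \<rho>)) - (\<Sum>\<rho>\<in>A. of_nat (zero_mult f \<rho>) / (0 - \<rho>)) =
       (\<Sum>\<rho>\<in>A. of_real (zmult \<rho>) * s / (\<rho> * (s - \<rho>)))"
      unfolding sum_subtractf[symmetric]
    proof (rule sum.cong)
      fix \<rho> assume "\<rho> \<in> A"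
      then have "\<rho> \<noteq> 0" "s - \<rho> \<noteq> 0" using A0 fs by (auto simp: A_def Zeros_def)
      then show "of_nat (zero_mult f \<rho>) / (s - \<rho>) - of_nat (zero_mult f \<rho>) / (0 - \<rho>) = of_real (zmult \<rho>) * s / (\<rho> * (s - \<rho>))"
        by (simp add: zmult_def field_simps)
    qed auto
    moreover have "s \<in> ball 0 r" "0 \<in> ball (0::complex) r" using s r by auto
    ultimately show ?thesis using ld[of s] ld[of 0] fs f0 by (simp add: algebra_simps)
  qed
  moreover have "96 * M / r\<^sup>2 = 96 * (C * 4 powr \<alpha> + \<bar>ln (norm (f 0))\<bar> + 1) * r powr (\<alpha> - 2)"
    using r by (simp add: M_def powr_diff)
  ultimately show "norm (deriv f s / f s - deriv f 0 / f 0 - (\<Sum>\<rho>\<in>Zeros \<inter> cball 0 r. of_real (zmult \<rho>) * s / (\<rho> * (s - \<rho>))))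
      \<le> 96 * (C * 4 powr \<alpha> + \<bar>ln (norm (f 0))\<bar> + 1) * r powr (\<alpha> - 2) * norm s"
    by (simp add: A_def)
qed

lemma filterlim_Zeros_cball: "filterlim (\<lambda>n::nat. Zeros \<inter> cball 0 (real n)) (finite_subsets_at_top Zeros) sequentially"
  unfolding filterlim_finite_subsets_at_top
proof (intro allI impI)
  fix X :: "complex set" assume X: "finite X \<and> X \<subseteq> Zeros"
  obtain n :: nat where n: "\<And>x. x \<in> X \<Longrightarrow> norm x \<le> n"
    using X by (metis finite_imp_bounded bounded_iff real_arch_simple order_trans)
  show "\<forall>\<^sub>F n in sequentially. finite (Zeros \<inter> cball 0 (real n)) \<and> X \<subseteq> Zeros \<inter> cball 0 (real n) \<and> Zeros \<inter> cball 0 (real n) \<subseteq> Zeros"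
    using eventually_ge_at_top[of n]
  proof eventually_elim
    case (elim m)
    have "norm x \<le> real m" if "x \<in> X" for x using n[OF that] elim by linarith
    then show ?case using X finite_Zeros_cball by auto
  qed
qed

text \<open>A disc contains only finitely many zeros, so a comparison with the convergent series is
  needed only far out.\<close>

lemma abs_summable_zero_sum:
  assumes bound: "\<And>\<rho>. \<rho> \<in> Zeros \<Longrightarrow> norm \<rho> \<ge> R \<Longrightarrow> norm (g \<rho>) \<le> K * (zmult \<rho> / (norm \<rho>)\<^sup>2)"
  shows "(\<lambda>\<rho>. norm (g \<rho>)) summable_on Zeros"
proof -
  have "(\<lambda>\<rho>. norm (g \<rho>)) summable_on (Zeros - cball 0 R)"
  proof (rule summable_on_comparison_test)
    show "(\<lambda>\<rho>. K * (zmult \<rho> / (norm \<rho>)\<^sup>2)) summable_on (Zeros - cball 0 R)"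
      by (intro summable_on_cmult_right summable_on_subset_banach[OF summable_zmult]) auto
  qed (use bound in auto)
  moreover have "(\<lambda>\<rho>. norm (g \<rho>)) summable_on (Zeros \<inter> cball 0 R)"
    by (intro summable_on_finite finite_Zeros_cball)
  ultimately have "(\<lambda>\<rho>. norm (g \<rho>)) summable_on ((Zeros - cball 0 R) \<union> (Zeros \<inter> cball 0 R))"
    by (intro summable_on_Un_disjoint) auto
  moreover have "(Zeros - cball 0 R) \<union> (Zeros \<inter> cball 0 R) = Zeros" by auto
  ultimately show ?thesis by simp
qed

text \<open>The logarithmic derivative of a Hadamard product of genus 1: the summand is 1/(s -
  \<rho>) + 1/\<rho>, and the exponential factor appears as the value at 0. Absolute convergence
  identifies the unordered sum with its limit over growing discs, where the error O(r^(\<alpha> -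
  2)) vanishes.\<close>

theorem logderiv_has_sum:
  assumes fs: "f s \<noteq> 0"
  shows "((\<lambda>\<rho>. of_real (zmult \<rho>) * s / (\<rho> * (s - \<rho>))) has_sum (deriv f s / f s - deriv f 0 / f 0)) Zeros"
proof -
  let ?g = "\<lambda>\<rho>. of_real (zmult \<rho>) * s / (\<rho> * (s - \<rho>))"
  have "(\<lambda>\<rho>. norm (?g \<rho>)) summable_on Zeros"
  proof (rule abs_summable_zero_sum[where R = "2 * norm s" and K = "2 * norm s"])
    fix \<rho> assume \<rho>: "\<rho> \<in> Zeros" "2 * norm s \<le> norm \<rho>"
    then have n: "norm \<rho> > 0" by auto
    have "norm \<rho> / 2 \<le> norm (s - \<rho>)" using \<rho>(2) norm_triangle_ineq2[of \<rho> s] by (simp add: norm_minus_commute)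
    then have "zmult \<rho> * norm s / (norm \<rho> * norm (s - \<rho>)) \<le> zmult \<rho> * norm s / (norm \<rho> * (norm \<rho> / 2))"
      using n by (intro divide_left_mono mult_left_mono mult_pos_pos mult_nonneg_nonneg) auto
    then show "norm (?g \<rho>) \<le> 2 * norm s * (zmult \<rho> / (norm \<rho>)\<^sup>2)"
      by (simp add: norm_mult norm_divide power2_eq_square mult_ac)
  qed
  then have "?g summable_on Zeros" by (rule abs_summable_summable)
  then have "(?g has_sum infsum ?g Zeros) Zeros" by (rule has_sum_infsum)
  then have lim: "(\<lambda>n. \<Sum>\<rho>\<in>Zeros \<inter> cball 0 (real n). ?g \<rho>) \<longlonglongrightarrow> infsum ?g Zeros"
    unfolding has_sum_def by (rule filterlim_compose[OF _ filterlim_Zeros_cball])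
  obtain K where K: "\<And>r s. r \<ge> 1 \<Longrightarrow> norm s < r / 4 \<Longrightarrow> f s \<noteq> 0 \<Longrightarrow>
    norm (deriv f s / f s - deriv f 0 / f 0 - (\<Sum>\<rho>\<in>Zeros \<inter> cball 0 r. of_real (zmult \<rho>) * s / (\<rho> * (s - \<rho>))))
      \<le> K * r powr (\<alpha> - 2) * norm s"
    using logderiv_approx by blast
  have "(\<lambda>n. deriv f s / f s - deriv f 0 / f 0 - (\<Sum>\<rho>\<in>Zeros \<inter> cball 0 (real n). ?g \<rho>)) \<longlonglongrightarrow> 0"
  proof (rule Lim_null_comparison)
    show "\<forall>\<^sub>F n in sequentially. norm (deriv f s / f s - deriv f 0 / f 0 - (\<Sum>\<rho>\<in>Zeros \<inter> cball 0 (real n). ?g \<rho>))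
        \<le> K * real n powr (\<alpha> - 2) * norm s"
      using eventually_ge_at_top[of "nat \<lceil>4 * norm s\<rceil> + 1"]
    proof eventually_elim
      case (elim n)
      then have "real n \<ge> 1" "norm s < real n / 4" by linarith+
      then show ?case using K fs by blast
    qed
    have "(\<lambda>n. real n powr (\<alpha> - 2)) \<longlonglongrightarrow> 0"
      by (rule tendsto_neg_powr[OF _ filterlim_real_sequentially]) (use order in auto)
    then show "(\<lambda>n. K * real n powr (\<alpha> - 2) * norm s) \<longlonglongrightarrow> 0"
      by (auto intro!: tendsto_mult_left_zero tendsto_mult_right_zero)
  qed
  from tendsto_diff[OF tendsto_const[of "deriv f s / f s - deriv f 0 / f 0"] this]
  have "(\<lambda>n. \<Sum>\<rho>\<in>Zeros \<inter> cball 0 (real n). ?g \<rho>) \<longlonglongrightarrow> deriv f s / f s - deriv f 0 / f 0" by simp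
  then have "infsum ?g Zeros = deriv f s / f s - deriv f 0 / f 0" using lim LIMSEQ_unique by blast
  then show ?thesis using \<open>(?g has_sum infsum ?g Zeros) Zeros\<close> by simp
qed

end

section \<open>Dirichlet series\<close>

lemma summable_Suc_powr:
  assumes "\<sigma> > 1" shows "summable (\<lambda>n. 1 / real (Suc n) powr \<sigma>)"
proof -
  have "summable (\<lambda>n. real (Suc n) powr (-\<sigma>))"
    using assms by (subst summable_Suc_iff) (simp add: summable_real_powr_iff)
  then show ?thesis by (simp add: powr_minus field_simps)
qed

lemma norm_dirichlet_term:
  assumes "norm (a (Suc n)) \<le> 1"
  shows "norm (a (Suc n) / of_nat (Suc n) powr s) \<le> 1 / real (Suc n) powr Re s"
proof -
  have "norm (of_nat (Suc n) powr s) = real (Suc n) powr Re s"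
    using norm_powr_real_powr[of "of_nat (Suc n)" s] by (simp del: of_nat_Suc)
  then show ?thesis using assms by (simp add: norm_divide divide_right_mono del: of_nat_Suc)
qed

text \<open>Coefficients bounded by 1 are general enough: 1 and \<Lambda>(n) / ln n both qualify,
  and termwise differentiation then supplies the series of ln n and \<Lambda>(n).\<close>

lemma dirichlet_series:
  fixes a :: "nat \<Rightarrow> complex"
  assumes a: "\<And>n. norm (a (Suc n)) \<le> 1"
  defines "F \<equiv> \<lambda>s. \<Sum>n. a (Suc n) / of_nat (Suc n) powr s"
  assumes s: "Re s > 1"
  shows dirichlet_sums: "(\<lambda>n. a (Suc n) / of_nat (Suc n) powr s) sums F s"
    and dirichlet_deriv_sums: "(\<lambda>n. - of_real (ln (real (Suc n))) * a (Suc n) / of_nat (Suc n) powr s) sums deriv F s"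
    and dirichlet_field_derivative: "(F has_field_derivative deriv F s) (at s)"
proof -
  let ?S = "{s. Re s > 1}"
  have "\<exists>g g'. \<forall>x\<in>?S. (\<lambda>n. a (Suc n) / of_nat (Suc n) powr x) sums g x \<and>
             (\<lambda>n. - of_real (ln (real (Suc n))) * a (Suc n) / of_nat (Suc n) powr x) sums g' x \<and> (g has_field_derivative g' x) (at x)"
  proof (rule series_and_derivative_comparison_complex)
    show "open ?S" by (rule open_halfspace_Re_gt)
    show "((\<lambda>x. a (Suc n) / of_nat (Suc n) powr x) has_field_derivative
         - of_real (ln (real (Suc n))) * a (Suc n) / of_nat (Suc n) powr x) (at x)" for n x
    proof -
      have ne: "complex_of_nat (Suc n) \<noteq> 0" by (rule of_nat_neq_0)
      have "Ln (of_nat (Suc n)) = of_real (ln (real (Suc n)))"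
        using Ln_of_real[of "real (Suc n)"] by (simp del: of_nat_Suc)
      moreover have "((\<lambda>x. a (Suc n) * exp (- x * Ln (of_nat (Suc n)))) has_field_derivative
           a (Suc n) * (exp (- x * Ln (of_nat (Suc n))) * - Ln (of_nat (Suc n)))) (at x)"
        by (auto intro!: derivative_eq_intros simp del: of_nat_Suc)
      ultimately show ?thesis using ne
        by (simp add: powr_def exp_minus divide_inverse mult_ac del: of_nat_Suc)
    qed
    fix x assume x: "x \<in> ?S"
    \<comment> \<open>Half the distance to the line Re s = 1: on the ball of this radius real parts
      stay at least 1 + d, which gives a convergent majorant.\<close>
    define d where "d = (Re x - 1) / 2"
    have d: "d > 0" using x by (simp add: d_def)
    show "\<exists>d h. 0 < d \<and> summable h \<and> range h \<subseteq> \<real>\<^sub>\<ge>\<^sub>0 \<and>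
             (\<forall>\<^sub>F n in sequentially. \<forall>y\<in>ball x d \<inter> ?S. cmod (a (Suc n) / of_nat (Suc n) powr y) \<le> cmod (h n))"
    proof (intro exI conjI always_eventually allI ballI)
      show "summable (\<lambda>n. complex_of_real (1 / real (Suc n) powr (1 + d)))"
        using summable_Suc_powr[of "1 + d"] d by (subst summable_of_real_iff) auto
      show "range (\<lambda>n. complex_of_real (1 / real (Suc n) powr (1 + d))) \<subseteq> \<real>\<^sub>\<ge>\<^sub>0"
        by auto
      fix n y assume y: "y \<in> ball x d \<inter> ?S"
      have "\<bar>Re (x - y)\<bar> < d" using abs_Re_le_cmod[of "x - y"] y by (simp add: dist_norm)
      then have "Re y \<ge> 1 + d" using d by (simp add: d_def field_simps abs_if split: if_splits)
      then have "1 / real (Suc n) powr Re y \<le> 1 / real (Suc n) powr (1 + d)"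
        by (intro divide_left_mono powr_mono mult_pos_pos) auto
      then show "cmod (a (Suc n) / of_nat (Suc n) powr y) \<le> cmod (complex_of_real (1 / real (Suc n) powr (1 + d)))"
        using norm_dirichlet_term[where a=a, OF a, of n y] unfolding norm_of_real by (simp del: of_nat_Suc)
    qed (use d in auto)
  qed
  then obtain g g' where g: "\<And>x. x \<in> ?S \<Longrightarrow> (\<lambda>n. a (Suc n) / of_nat (Suc n) powr x) sums g x"
      "\<And>x. x \<in> ?S \<Longrightarrow> (\<lambda>n. - of_real (ln (real (Suc n))) * a (Suc n) / of_nat (Suc n) powr x) sums g' x"
      "\<And>x. x \<in> ?S \<Longrightarrow> (g has_field_derivative g' x) (at x)" by blast
  have Fg: "F x = g x" if "x \<in> ?S" for x using sums_unique[OF g(1)[OF that]] by (simp add: F_def)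
  have S: "s \<in> ?S" using s by simp
  have D: "(F has_field_derivative g' s) (at s)"
    by (rule has_field_derivative_transform_within_open[OF g(3)[OF S] open_halfspace_Re_gt S]) (use Fg in auto)
  then have "deriv F s = g' s" by (rule DERIV_imp_deriv)
  then show "(\<lambda>n. - of_real (ln (real (Suc n))) * a (Suc n) / of_nat (Suc n) powr s) sums deriv F s"
    "(F has_field_derivative deriv F s) (at s)" "(\<lambda>n. a (Suc n) / of_nat (Suc n) powr s) sums F s"
    using g(1,2)[OF S] D Fg[OF S] by simp_all
qed

lemma dirichlet_holomorphic:
  fixes a :: "nat \<Rightarrow> complex"
  assumes a: "\<And>n. norm (a (Suc n)) \<le> 1"
  shows "(\<lambda>s. \<Sum>n. a (Suc n) / of_nat (Suc n) powr s) holomorphic_on {s. Re s > 1}"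
  unfolding holomorphic_on_open[OF open_halfspace_Re_gt]
  using dirichlet_field_derivative[of a, OF a] by blast

lemma dirichlet_abs_summable:
  fixes a :: "nat \<Rightarrow> complex"
  assumes a: "\<And>n. norm (a (Suc n)) \<le> 1" and s: "Re s > 1"
  shows "summable (\<lambda>n. norm (a (Suc n) / of_nat (Suc n) powr s))"
  by (rule summable_comparison_test'[OF summable_Suc_powr[OF s], of 0])
     (use norm_dirichlet_term[where a=a, OF a] in simp)

lemma abs_summable_imp_has_sum_nat:
  fixes f :: "nat \<Rightarrow> complex"
  assumes "summable (\<lambda>n. norm (f (Suc n)))"
  shows "((\<lambda>n. f n) has_sum (\<Sum>n. f (Suc n))) {1..}" "(\<lambda>n. norm (f n)) summable_on {1..}"
proof -
  have "((\<lambda>n. f (Suc n)) has_sum (\<Sum>n. f (Suc n))) UNIV"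
    using norm_summable_imp_has_sum[OF assms] summable_norm_cancel[OF assms] by (simp add: summable_sums)
  moreover have bij: "bij_betw Suc UNIV {1..}"
    by (rule bij_betwI[of _ _ _ "\<lambda>n. n - 1"]) auto
  ultimately show "((\<lambda>n. f n) has_sum (\<Sum>n. f (Suc n))) {1..}"
    using has_sum_reindex_bij_betw[OF bij, of f] by simp
  have "(\<lambda>n. norm (f (Suc n))) summable_on UNIV"
    using assms by (intro summable_nonneg_imp_summable_on) auto
  then show "(\<lambda>n. norm (f n)) summable_on {1..}"
    using summable_on_reindex_bij_betw[OF bij, of "\<lambda>n. norm (f n)"] by simp
qed

text \<open>Absolute convergence allows the double sum over (m, n) to be regrouped by the product m
  n.\<close>

lemma dirichlet_convolution:
  fixes a b :: "nat \<Rightarrow> complex"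
  assumes a: "summable (\<lambda>n. norm (a (Suc n) / of_nat (Suc n) powr s))"
    and b: "summable (\<lambda>n. norm (b (Suc n) / of_nat (Suc n) powr s))"
  shows "(\<lambda>n. (\<Sum>d | d dvd Suc n. a d * b (Suc n div d)) / of_nat (Suc n) powr s) sums
           ((\<Sum>n. a (Suc n) / of_nat (Suc n) powr s) * (\<Sum>n. b (Suc n) / of_nat (Suc n) powr s))"
proof -
  let ?A = "\<lambda>n. a n / of_nat n powr s" and ?B = "\<lambda>n. b n / of_nat n powr s"
  let ?T = "(\<Sum>n. a (Suc n) / of_nat (Suc n) powr s) * (\<Sum>n. b (Suc n) / of_nat (Suc n) powr s)"
  note A = abs_summable_imp_has_sum_nat[of ?A, OF a]
  note B = abs_summable_imp_has_sum_nat[of ?B, OF b]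
  have 1: "(\<lambda>x. norm ((\<lambda>(m,n). ?A m * ?B n) x)) summable_on {1..} \<times> {1..}"
  proof -
    have "(\<lambda>m. norm (?A m) * infsum (\<lambda>n. norm (?B n)) {1..}) summable_on {1..}"
      by (rule summable_on_cmult_left[OF A(2)])
    then have "(\<lambda>m. norm (infsum (\<lambda>n. norm (?A m * ?B n)) {1..})) summable_on {1..}"
      by (simp only: norm_mult infsum_cmult_right' real_norm_def abs_mult abs_norm_cancel infsum_nonneg abs_of_nonneg norm_ge_zero)
    moreover have "(\<lambda>n. norm (?A m * ?B n)) summable_on {1..}" for m
      unfolding norm_mult by (rule summable_on_cmult_right[OF B(2)])
    ultimately show ?thesis by (subst Infinite_Sum.abs_summable_on_Sigma_iff) auto
  qed
  have "((\<lambda>(m,n). ?A m * ?B n) has_sum ?T) ({1..} \<times> {1..})"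
  proof -
    have "((\<lambda>m. ?A m * (\<Sum>n. ?B (Suc n))) has_sum ?T) {1..}"
      by (rule has_sum_cmult_left[OF A(1)])
    then show ?thesis
    proof (rule has_sum_SigmaI[rotated])
      show "(\<lambda>(m,n). ?A m * ?B n) summable_on {1..} \<times> {1..}"
        by (rule abs_summable_summable[OF 1])
      show "((\<lambda>y. case (x, y) of (m, n) \<Rightarrow> ?A m * ?B n) has_sum ?A x * (\<Sum>n. ?B (Suc n))) {1..}" for x
        unfolding prod.case by (rule has_sum_cmult_right[OF B(1)])
    qed
  qed
  moreover have bij: "bij_betw (\<lambda>(n::nat,d). (d, n div d)) (SIGMA n:{1..}. {d. d dvd n}) ({1..} \<times> {1..})"
    by (rule bij_betwI[of _ _ _ "\<lambda>(m,n). (m * n, m)"])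
       (auto simp: Suc_le_eq intro: Nat.gr0I)
  ultimately have "((\<lambda>(n,d). ?A d * ?B (n div d)) has_sum ?T) (SIGMA n:{1..}. {d. d dvd n})"
    by (subst (asm) has_sum_reindex_bij_betw[OF bij, symmetric]) (simp add: case_prod_unfold)
  then have "((\<lambda>n. \<Sum>d | d dvd n. ?A d * ?B (n div d)) has_sum ?T) {1..}"
    by (rule has_sum_SigmaD) (auto intro!: has_sum_finite)
  then have "((\<lambda>n. (\<Sum>d | d dvd n. a d * b (n div d)) / of_nat n powr s) has_sum ?T) {1..}"
  proof (rule has_sum_cong[THEN iffD1, rotated])
    fix n :: nat assume n: "n \<in> {1..}"
    have "?A d * ?B (n div d) = a d * b (n div d) / of_nat n powr s" if "d dvd n" for d
    proof -
      obtain e where e: "n = d * e" using \<open>d dvd n\<close> by (rule dvdE)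
      then have "(of_nat n :: complex) powr s = of_nat d powr s * of_nat e powr s"
        using powr_times_real[of "of_nat d" "of_nat e" s] by simp
      then show ?thesis using e n by (cases "d = 0") auto
    qed
    then show "(\<Sum>d | d dvd n. ?A d * ?B (n div d)) = (\<Sum>d | d dvd n. a d * b (n div d)) / of_nat n powr s"
      unfolding sum_divide_distrib by (intro sum.cong) auto
  qed
  moreover have bS: "bij_betw Suc UNIV {1..}" by (rule bij_betwI[of _ _ _ "\<lambda>n. n - 1"]) auto
  ultimately have "((\<lambda>n. (\<Sum>d | d dvd Suc n. a d * b (Suc n div d)) / of_nat (Suc n) powr s) has_sum ?T) UNIV"
    by (subst has_sum_reindex_bij_betw[OF bS, of "\<lambda>n. (\<Sum>d | d dvd n. a d * b (n div d)) / of_nat n powr s"])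
  then show ?thesis by (rule has_sum_imp_sums)
qed

section \<open>The Dirichlet series of zeta and its logarithm\<close>

definition dir_zeta :: "complex \<Rightarrow> complex" where
  "dir_zeta s = (\<Sum>n. 1 / of_nat (Suc n) powr s)"

text \<open>This is log zeta for Re s > 1: the coefficient at a prime power p^k is 1/k, and at 1 it
  is 0 / 0 = 0.\<close>

definition prime_zeta_log :: "complex \<Rightarrow> complex" where
  "prime_zeta_log s = (\<Sum>n. of_real (mangoldt (Suc n) / ln (real (Suc n))) / of_nat (Suc n) powr s)"

lemma norm_mangoldt_div_ln: "norm (complex_of_real (mangoldt (Suc n) / ln (real (Suc n)))) \<le> 1"
proof (cases n)
  case (Suc m)
  then have "ln (real (Suc n)) > 0" by simp
  then show ?thesis using mangoldt_le[of "Suc n"] mangoldt_nonneg[of "Suc n"]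
    unfolding norm_of_real by (simp del: of_nat_Suc)
qed simp

text \<open>\<Lambda>(n) is at most ln n, and the series of ln n / n^\<sigma> converges because it
  is, up to sign, the termwise derivative of the zeta series at a real point.\<close>

lemma mangoldt_dirichlet_summable:
  assumes s: "Re s > 1"
  shows "summable (\<lambda>n. norm (mangoldt (Suc n) / of_nat (Suc n) powr s :: complex))"
proof -
  have "(\<lambda>n. - complex_of_real (ln (real (Suc n))) * 1 / of_nat (Suc n) powr (of_real (Re s))) sums
      deriv (\<lambda>s::complex. \<Sum>n. 1 / of_nat (Suc n) powr s) (of_real (Re s))"
    by (rule dirichlet_deriv_sums[of "\<lambda>_. 1"]) (use s in auto)
  then have "summable (\<lambda>n. - of_real (ln (real (Suc n))) * 1 / of_nat (Suc n) powr (of_real (Re s)) :: complex)"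
    by (rule sums_summable)
  moreover have "- of_real (ln (real (Suc n))) * 1 / of_nat (Suc n) powr (of_real (Re s)) =
      complex_of_real (- (ln (real (Suc n)) / real (Suc n) powr Re s))" for n
    using powr_of_real[of "real (Suc n)" "Re s"] by (simp del: of_nat_Suc)
  ultimately have "summable (\<lambda>n. complex_of_real (- (ln (real (Suc n)) / real (Suc n) powr Re s)))"
    by (simp only:)
  then have "summable (\<lambda>n. ln (real (Suc n)) / real (Suc n) powr Re s)"
    unfolding summable_of_real_iff by (simp only: summable_minus_iff)
  then show ?thesis
  proof (rule summable_comparison_test'[of _ 0])
    fix n
    have "norm (of_nat (Suc n) powr s) = real (Suc n) powr Re s"
      using norm_powr_real_powr[of "of_nat (Suc n)" s] by (simp del: of_nat_Suc)
    then show "norm (norm (mangoldt (Suc n) / of_nat (Suc n) powr s :: complex)) \<le> ln (real (Suc n)) / real (Suc n) powr Re s"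
      using mangoldt_le[of "Suc n"] by (simp add: norm_divide divide_right_mono del: of_nat_Suc)
  qed
qed

lemma deriv_prime_zeta_log_sums:
  assumes s: "Re s > 1"
  shows "(\<lambda>n. - mangoldt (Suc n) / of_nat (Suc n) powr s) sums deriv prime_zeta_log s"
proof -
  have "(\<lambda>n. - of_real (ln (real (Suc n))) * of_real (mangoldt (Suc n) / ln (real (Suc n))) / of_nat (Suc n) powr s)
      sums deriv prime_zeta_log s"
    unfolding prime_zeta_log_def[abs_def]
    by (rule dirichlet_deriv_sums[of "\<lambda>n. of_real (mangoldt n / ln (real n))", OF norm_mangoldt_div_ln s])
  moreover have "- of_real (ln (real (Suc n))) * of_real (mangoldt (Suc n) / ln (real (Suc n))) = (- mangoldt (Suc n) :: complex)" for n
    by (cases n) (auto simp del: of_nat_Suc)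
  ultimately show ?thesis by simp
qed

lemma prime_zeta_log_has_field_derivative:
  assumes s: "Re s > 1"
  shows "(prime_zeta_log has_field_derivative deriv prime_zeta_log s) (at s)"
  unfolding prime_zeta_log_def[abs_def]
  by (rule dirichlet_field_derivative[of "\<lambda>n. of_real (mangoldt n / ln (real n))", OF norm_mangoldt_div_ln s])

lemma dir_zeta_sums:
  assumes s: "Re s > 1"
  shows "(\<lambda>n. 1 / of_nat (Suc n) powr s) sums dir_zeta s"
  unfolding dir_zeta_def by (rule dirichlet_sums[of "\<lambda>_. 1", OF _ s]) simp

lemma dir_zeta_has_field_derivative:
  assumes s: "Re s > 1"
  shows "(dir_zeta has_field_derivative deriv dir_zeta s) (at s)"
  unfolding dir_zeta_def[abs_def] by (rule dirichlet_field_derivative[of "\<lambda>_. 1", OF _ s]) simp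

text \<open>The series form of the identity that \<Lambda>(d), summed over the divisors d of n,
  gives ln n.\<close>

lemma deriv_dir_zeta:
  assumes s: "Re s > 1"
  shows "deriv dir_zeta s = dir_zeta s * deriv prime_zeta_log s"
proof -
  have "(\<lambda>n. (\<Sum>d | d dvd Suc n. - mangoldt d * 1) / of_nat (Suc n) powr s) sums
           ((\<Sum>n. - mangoldt (Suc n) / of_nat (Suc n) powr s) * (\<Sum>n. 1 / of_nat (Suc n) powr s))"
    by (rule dirichlet_convolution[of "\<lambda>n. - mangoldt n" s "\<lambda>_. 1"])
       (use mangoldt_dirichlet_summable[OF s] dirichlet_abs_summable[of "\<lambda>_. 1", OF _ s] in \<open>auto simp: norm_divide\<close>)
  moreover have "(\<Sum>d | d dvd Suc n. - mangoldt d * 1) = - complex_of_real (ln (real (Suc n))) * 1" for n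
    using mangoldt_sum[of "Suc n", where 'a=complex] by (simp add: sum_negf del: of_nat_Suc)
  ultimately have "(\<lambda>n. - complex_of_real (ln (real (Suc n))) * 1 / of_nat (Suc n) powr s) sums
     (deriv prime_zeta_log s * dir_zeta s)"
    using sums_unique[OF deriv_prime_zeta_log_sums[OF s]] by (simp add: dir_zeta_def)
  moreover have "(\<lambda>n. - complex_of_real (ln (real (Suc n))) * 1 / of_nat (Suc n) powr s) sums deriv dir_zeta s"
    unfolding dir_zeta_def[abs_def] by (rule dirichlet_deriv_sums[of "\<lambda>_. 1", OF _ s]) simp
  ultimately show ?thesis by (simp add: sums_unique2 mult.commute)
qed

text \<open>The quotient of the two functions has derivative 0 on a convex half-plane. The constant
  is read off at s = 2, where both series are real and the zeta series is positive. Being positive,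
  it does not affect arguments, and arguments are what \<open>zeta_S\<close> is made of.\<close>

lemma dir_zeta_eq_exp:
  obtains c where "c > 0" "\<And>s. Re s > 1 \<Longrightarrow> dir_zeta s = of_real c * exp (prime_zeta_log s)"
proof -
  let ?S = "{s. Re s > 1}" and ?h = "\<lambda>s. dir_zeta s * exp (- prime_zeta_log s)"
  have "\<exists>c. \<forall>s\<in>?S. ?h s = c"
  proof (rule has_field_derivative_zero_constant)
    show "convex ?S" by (rule convex_halfspace_Re_gt)
    fix s assume s: "s \<in> ?S"
    then have "Re s > 1" by simp
    note D = dir_zeta_has_field_derivative[OF this] prime_zeta_log_has_field_derivative[OF this]
    have "(?h has_field_derivative deriv dir_zeta s * exp (- prime_zeta_log s) +
       exp (- prime_zeta_log s) * - deriv prime_zeta_log s * dir_zeta s) (at s)"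
      by (rule DERIV_mult) (auto intro!: derivative_eq_intros D)
    then have "(?h has_field_derivative 0) (at s)"
      using deriv_dir_zeta[of s] s by simp
    then show "(?h has_field_derivative 0) (at s within ?S)" by (rule has_field_derivative_at_within)
  qed
  then obtain c where c: "\<And>s. Re s > 1 \<Longrightarrow> ?h s = c" by auto
  have Z: "dir_zeta s = c * exp (prime_zeta_log s)" if "Re s > 1" for s
    unfolding c[OF that, symmetric] by (simp add: exp_minus field_simps)
  have np: "complex_of_nat (Suc n) powr 2 = of_real (real (Suc n) powr 2)" for n
    using powr_of_real[of "real (Suc n)" 2] by (simp del: of_nat_Suc)
  have "(\<lambda>n. 1 / of_nat (Suc n) powr 2) sums dir_zeta 2" by (rule dir_zeta_sums) simp
  then have 1: "(\<lambda>n. complex_of_real (1 / real (Suc n) powr 2)) sums dir_zeta 2"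
    unfolding np by simp
  define z where "z = (\<Sum>n. 1 / real (Suc n) powr 2)"
  have "(\<lambda>n. 1 / real (Suc n) powr 2) sums z"
    unfolding z_def by (rule summable_sums[OF summable_Suc_powr]) simp
  then have zz: "dir_zeta 2 = of_real z" using 1 sums_of_real sums_unique2 by blast
  have "z > 0" unfolding z_def
    by (rule suminf_pos[OF summable_Suc_powr]) auto
  have P: "(\<lambda>n. of_real (mangoldt (Suc n) / ln (real (Suc n))) / of_nat (Suc n) powr 2) sums prime_zeta_log 2"
    unfolding prime_zeta_log_def
    by (rule dirichlet_sums[of "\<lambda>n. of_real (mangoldt n / ln (real n))", OF norm_mangoldt_div_ln]) simp
  then have P: "(\<lambda>n. complex_of_real (mangoldt (Suc n) / ln (real (Suc n)) / real (Suc n) powr 2)) sums prime_zeta_log 2"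
    unfolding np by simp
  have "summable (\<lambda>n. mangoldt (Suc n) / ln (real (Suc n)) / real (Suc n) powr 2)"
    using sums_summable[OF P] unfolding summable_of_real_iff .
  then obtain p where "(\<lambda>n. mangoldt (Suc n) / ln (real (Suc n)) / real (Suc n) powr 2) sums p"
    by (auto simp: summable_def)
  then have pp: "prime_zeta_log 2 = of_real p" using P sums_of_real sums_unique2 by blast
  have "c = of_real (z * exp (- p))" using c[of 2] zz pp by (simp add: exp_of_real[symmetric])
  then show ?thesis using that[of "z * exp (- p)"] Z \<open>z > 0\<close> by simp
qed

section \<open>Analytic continuation and growth of the zeta function\<close>

text \<open>For small w, |1 + w|^2 = 1 + 2 Re w + |w|^2 \<le> exp (2 Re w + |w|^2), so the linear
  term cancels and exp (|w|^2 / 2) is left; for large w the crude bound exp (2 |w|) suffices. The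
  exponent 3/2 lies between the 2 and the 1 of these two ranges.\<close>

lemma norm_weierstrass_factor_le: "norm ((1 + w) * exp (- w)) \<le> exp (2 * norm w powr (3/2))" for w :: complex
proof (cases "norm w \<le> 1")
  case True
  have "(norm (1 + w))\<^sup>2 = 1 + (2 * Re w + (norm w)\<^sup>2)"
    unfolding cmod_power2 by (simp add: power2_eq_square algebra_simps)
  also have "\<dots> \<le> exp (2 * Re w + (norm w)\<^sup>2)" by (rule exp_ge_add_one_self)
  finally have "(norm (1 + w))\<^sup>2 \<le> (exp (Re w + (norm w)\<^sup>2 / 2))\<^sup>2"
    by (simp add: exp_double[symmetric] algebra_simps)
  then have "norm (1 + w) \<le> exp (Re w + (norm w)\<^sup>2 / 2)"
    by (rule power2_le_imp_le) simp
  then have "norm (1 + w) * exp (- Re w) \<le> exp (Re w + (norm w)\<^sup>2 / 2) * exp (- Re w)"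
    by (intro mult_right_mono) auto
  also have "\<dots> = exp ((norm w)\<^sup>2 / 2)" by (simp add: exp_add[symmetric])
  finally have "norm ((1 + w) * exp (- w)) \<le> exp ((norm w)\<^sup>2 / 2)" by (simp add: norm_mult)
  moreover have "(norm w)\<^sup>2 \<le> norm w powr (3/2)"
  proof (cases "w = 0")
    case False
    then have "norm w powr 2 \<le> norm w powr (3/2)" using True by (intro powr_mono') auto
    then show ?thesis using False by (simp add: powr_numeral)
  qed simp
  ultimately show ?thesis by (smt (verit) exp_le_cancel_iff powr_ge_zero field_sum_of_halves)
next
  case False
  have "norm ((1 + w) * exp (- w)) \<le> (1 + norm w) * exp (norm w)"
    unfolding norm_mult using norm_triangle_ineq[of 1 w] norm_exp[of "- w"]
    by (intro mult_mono) auto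
  also have "\<dots> \<le> exp (norm w) * exp (norm w)"
    by (intro mult_right_mono exp_ge_add_one_self) auto
  also have "\<dots> = exp (2 * norm w)" by (simp add: exp_double power2_eq_square)
  also have "\<dots> \<le> exp (2 * norm w powr (3/2))"
    using powr_mono[of 1 "3/2" "norm w"] False by simp
  finally show ?thesis .
qed

text \<open>The k-th factor of the Weierstrass product is at most exp (2 |z/k|^(3/2)), and the sum
  over k converges because 3/2 > 1.\<close>

lemma norm_rGamma_le:
  obtains C where "C \<ge> 0" "\<And>z::complex. norm (rGamma z) \<le> exp (C * (norm z + 2) powr (3/2))"
proof -
  define S where "S = (\<Sum>n. 1 / real (Suc n) powr (3/2))"
  have S0: "S \<ge> 0" unfolding S_def by (intro suminf_nonneg summable_Suc_powr) auto
  let ?e = "euler_mascheroni :: real"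
  have e0: "?e > 0" using euler_mascheroni_pos .
  have "norm (rGamma z) \<le> exp ((?e + 1 + 2 * S) * (norm z + 2) powr (3/2))" for z :: complex
  proof (rule Lim_norm_ubound[OF _ rGamma_Weierstrass_complex])
    show "\<forall>\<^sub>F n in sequentially. norm (rGamma_series_Weierstrass z n) \<le> exp ((?e + 1 + 2 * S) * (norm z + 2) powr (3/2))"
    proof (rule always_eventually, rule allI)
      fix n
      let ?A = "(norm z + 2) powr (3/2)"
      have A: "norm z \<le> ?A" using powr_mono[of 1 "3/2" "norm z + 2"] by simp
      have A': "norm z powr (3/2) \<le> ?A" by (intro powr_mono2) auto
      have "norm (\<Prod>k=1..n. (1 + z / of_nat k) * exp (-z / of_nat k)) \<le> exp (2 * ?A * S)"
      proof -
        have "norm (\<Prod>k=1..n. (1 + z / of_nat k) * exp (-z / of_nat k)) \<le>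
            (\<Prod>k=1..n. exp (2 * ?A * (1 / real k powr (3/2))))"
          unfolding prod_norm[symmetric]
        proof (intro prod_mono conjI)
          fix k assume k: "k \<in> {1..n}"
          have "norm ((1 + z / of_nat k) * exp (-z / of_nat k)) \<le> exp (2 * norm (z / of_nat k) powr (3/2))"
            using norm_weierstrass_factor_le[of "z / of_nat k"] by simp
          also have "norm (z / of_nat k) powr (3/2) = norm z powr (3/2) / real k powr (3/2)"
            by (simp add: norm_divide powr_divide)
          also have "exp (2 * (norm z powr (3/2) / real k powr (3/2))) \<le> exp (2 * ?A * (1 / real k powr (3/2)))"
            using A' by (simp add: divide_right_mono)
          finally show "norm ((1 + z / of_nat k) * exp (-z / of_nat k)) \<le> exp (2 * ?A * (1 / real k powr (3/2)))" .
        qed auto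
        also have "\<dots> = exp (2 * ?A * (\<Sum>k=1..n. 1 / real k powr (3/2)))"
          by (simp add: exp_sum sum_distrib_left)
        also have "(\<Sum>k=1..n. 1 / real k powr (3/2)) \<le> S"
        proof -
          have "(\<Sum>k=1..n. 1 / real k powr (3/2)) = (\<Sum>k<n. 1 / real (Suc k) powr (3/2))"
            by (rule sum.reindex_bij_witness[of _ Suc "\<lambda>k. k - 1"]) auto
          also have "\<dots> \<le> S" unfolding S_def by (intro sum_le_suminf summable_Suc_powr) auto
          finally show ?thesis .
        qed
        finally show ?thesis by (simp add: mult_left_mono)
      qed
      moreover have "norm (exp (euler_mascheroni * z)) \<le> exp (?e * ?A)"
      proof -
        have "Re (euler_mascheroni * z) = ?e * Re z"
          by (metis Re_complex_of_real of_real_euler_mascheroni Im_complex_of_real times_complex.sel(1) diff_zero mult_zero_left)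
        also have "\<dots> \<le> ?e * ?A" using e0 A complex_Re_le_cmod[of z] by (intro mult_left_mono) auto
        finally show ?thesis by simp
      qed
      moreover have "norm z \<le> exp ?A" using A exp_ge_add_one_self[of ?A] by linarith
      ultimately have "norm (rGamma_series_Weierstrass z n) \<le> exp (?e * ?A) * exp ?A * exp (2 * ?A * S)"
        unfolding rGamma_series_Weierstrass_def norm_mult by (intro mult_mono mult_nonneg_nonneg) auto
      also have "\<dots> = exp ((?e + 1 + 2 * S) * ?A)" by (simp add: exp_add[symmetric] algebra_simps)
      finally show "norm (rGamma_series_Weierstrass z n) \<le> exp ((?e + 1 + 2 * S) * ?A)" .
    qed
  qed simp
  then show ?thesis using that[of "?e + 1 + 2 * S"] e0 S0 by simp
qed

text \<open>The majorant is asked for only from some index on: a term of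
  \<open>bernoulli_part\<close> is controlled on a disc only once the point -m lies well outside
  it.\<close>

lemma holomorphic_suminf:
  fixes f :: "nat \<Rightarrow> complex \<Rightarrow> complex"
  assumes hol: "\<And>n. f n holomorphic_on UNIV"
    and bound: "\<And>R. \<exists>M. summable M \<and> (\<forall>\<^sub>F n in sequentially. \<forall>z. norm z \<le> R \<longrightarrow> norm (f n z) \<le> M n)"
  shows "(\<lambda>z. \<Sum>n. f n z) holomorphic_on UNIV"
proof (rule holomorphic_uniform_sequence[where f = "\<lambda>n z. \<Sum>i<n. f i z"])
  fix x :: complex
  obtain M where M: "summable M" "\<forall>\<^sub>F n in sequentially. \<forall>z. norm z \<le> norm x + 1 \<longrightarrow> norm (f n z) \<le> M n"
    using bound[of "norm x + 1"] by blast
  have sub: "norm z \<le> norm x + 1" if "z \<in> cball x 1" for z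
    using norm_triangle_sub[of z x] that by (simp add: dist_norm norm_minus_commute)
  have "uniform_limit (cball x 1) (\<lambda>n z. \<Sum>i<n. f i z) (\<lambda>z. \<Sum>n. f n z) sequentially"
    by (rule Weierstrass_m_test_ev[OF _ M(1)]) (use M(2) sub in \<open>auto elim: eventually_mono\<close>)
  then show "\<exists>d>0. cball x d \<subseteq> UNIV \<and> uniform_limit (cball x d) (\<lambda>n z. \<Sum>i<n. f i z) (\<lambda>z. \<Sum>n. f n z) sequentially"
    by (intro exI[of _ 1]) auto
qed (auto intro!: holomorphic_intros hol)

text \<open>The zeros of (exp z - 1) / z are the nonzero multiples of 2 pi i, outside
  \<open>ball 0 6\<close>, so the reciprocal has a power series that converges beyond 1, hence
  absolutely at 1. Taking real parts of the coefficients yields a real series at once.\<close>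

lemma bernoulli_kernel_expansion:
  obtains b :: "nat \<Rightarrow> real" where "b 0 = 1" "summable (\<lambda>n. \<bar>b n\<bar>)"
    "\<And>x. 0 < x \<Longrightarrow> x \<le> 1 \<Longrightarrow> (\<lambda>n. b n * x ^ n) sums (x / (exp x - 1))"
proof -
  \<comment> \<open>(exp z - 1) / z with its singularity at 0 removed, in the shape that
    \<open>pole_theorem\<close> delivers; the subtracted term is 0.\<close>
  define G where "G = (\<lambda>z::complex. if z = 0 then deriv (\<lambda>z. exp z - 1) 0 else (exp z - 1) / z - (exp 0 - 1) / (z - 0))"
  have "G holomorphic_on UNIV" unfolding G_def
    by (rule pole_theorem[where f = "\<lambda>z. (exp z - 1) / z"]) (auto intro!: holomorphic_intros)
  moreover have d1: "deriv (\<lambda>z::complex. exp z - 1) 0 = 1"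
    by (rule DERIV_imp_deriv) (auto intro!: derivative_eq_intros)
  have G: "G z = (if z = 0 then 1 else (exp z - 1) / z)" for z by (simp add: G_def d1)
  have Gnz: "G z \<noteq> 0" if "z \<in> ball 0 6" for z
  proof
    assume "G z = 0"
    then have z0: "z \<noteq> 0" and "exp z = 1" by (auto simp: G split: if_splits)
    then obtain n :: int where n: "Re z = 0" "Im z = of_int (2 * n) * pi" by (auto simp: exp_eq_1)
    have "n \<noteq> 0" using n z0 by (auto simp: complex_eq_iff)
    then have "\<bar>real_of_int n\<bar> \<ge> 1" by linarith
    then have "6 \<le> \<bar>real_of_int n\<bar> * (2 * pi)" using pi_gt3 mult_mono[of 1 "\<bar>real_of_int n\<bar>" 6 "2 * pi"] by simp
    also have "\<dots> = \<bar>Im z\<bar>" unfolding n(2) by (simp add: abs_mult)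
    also have "\<dots> \<le> norm z" by (rule abs_Im_le_cmod)
    finally show False using that by simp
  qed
  define \<phi> where "\<phi> = (\<lambda>z. inverse (G z))"
  have hol: "\<phi> holomorphic_on ball 0 6" unfolding \<phi>_def
    using Gnz by (intro holomorphic_intros holomorphic_on_subset[OF \<open>G holomorphic_on UNIV\<close>]) auto
  define c where "c = (\<lambda>n. (deriv ^^ n) \<phi> 0 / fact n)"
  have c: "(\<lambda>n. c n * w ^ n) sums \<phi> w" if "norm w < 6" for w
    using holomorphic_power_series[OF hol, of w] that by (simp add: c_def)
  define b where "b = (\<lambda>n. Re (c n))"
  have "summable (\<lambda>n. norm (c n * 1 ^ n))"
    by (rule powser_insidea[of c 2]) (use c[of 2] in \<open>auto simp: sums_iff\<close>)
  then have sc: "summable (\<lambda>n. norm (c n))" by simp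
  show ?thesis
  proof (rule that[of b])
    have "\<phi> 0 = 1" by (simp add: \<phi>_def G)
    then show "b 0 = 1" by (simp add: b_def c_def)
    show "summable (\<lambda>n. \<bar>b n\<bar>)"
      by (rule summable_comparison_test'[OF sc, of 0]) (simp add: b_def abs_Re_le_cmod)
    fix x :: real assume x: "0 < x" "x \<le> 1"
    have "(\<lambda>n. Re (c n * of_real x ^ n)) sums Re (\<phi> (of_real x))"
      by (rule sums_Re[OF c]) (use x in auto)
    moreover have "Re (c n * of_real x ^ n) = b n * x ^ n" for n
      by (simp add: b_def flip: of_real_power)
    moreover have "\<phi> (of_real x) = of_real (x / (exp x - 1))"
      using x by (simp add: \<phi>_def G exp_of_real[symmetric])
    ultimately show "(\<lambda>n. b n * x ^ n) sums (x / (exp x - 1))" by (simp only: Re_complex_of_real)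
  qed
qed

text \<open>These numbers are B_n / n! with B_n the Bernoulli numbers. The value 1 at index 0
  becomes the residue of zeta at 1.\<close>

definition bernoulli_coeff :: "nat \<Rightarrow> real" where
  "bernoulli_coeff = (SOME b. b 0 = 1 \<and> summable (\<lambda>n. \<bar>b n\<bar>) \<and>
     (\<forall>x. 0 < x \<longrightarrow> x \<le> 1 \<longrightarrow> (\<lambda>n. b n * x ^ n) sums (x / (exp x - 1))))"

lemma bernoulli_coeff:
  "bernoulli_coeff 0 = 1" "summable (\<lambda>n. \<bar>bernoulli_coeff n\<bar>)"
  "0 < x \<Longrightarrow> x \<le> 1 \<Longrightarrow> (\<lambda>n. bernoulli_coeff n * x ^ n) sums (x / (exp x - 1))"
proof -
  let ?P = "\<lambda>b::nat \<Rightarrow> real. b 0 = 1 \<and> summable (\<lambda>n. \<bar>b n\<bar>) \<and>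
     (\<forall>x. 0 < x \<longrightarrow> x \<le> 1 \<longrightarrow> (\<lambda>n. b n * x ^ n) sums (x / (exp x - 1)))"
  obtain b :: "nat \<Rightarrow> real" where "b 0 = 1" "summable (\<lambda>n. \<bar>b n\<bar>)"
    "\<And>x. 0 < x \<Longrightarrow> x \<le> 1 \<Longrightarrow> (\<lambda>n. b n * x ^ n) sums (x / (exp x - 1))"
    by (rule bernoulli_kernel_expansion) blast
  then have "\<exists>b. ?P b" by (intro exI[of _ b]) simp
  from someI_ex[OF this] have "?P bernoulli_coeff" unfolding bernoulli_coeff_def[symmetric] .
  then show "bernoulli_coeff 0 = 1" "summable (\<lambda>n. \<bar>bernoulli_coeff n\<bar>)"
    "0 < x \<Longrightarrow> x \<le> 1 \<Longrightarrow> (\<lambda>n. bernoulli_coeff n * x ^ n) sums (x / (exp x - 1))" by blast+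
qed

text \<open>The part of the integral of x^(s-1) / (exp x - 1) over one unit interval. Cutting [1,
  \<infinity>) into such intervals leaves proper integrals, each entire in s by differentiation
  under the integral sign.\<close>

definition mellin_piece :: "nat \<Rightarrow> complex \<Rightarrow> complex" where
  "mellin_piece k s = integral {real k + 1..real k + 2} (\<lambda>x. exp ((s - 1) * of_real (ln x)) / of_real (exp x - 1))"

lemma holomorphic_mellin_piece: "mellin_piece k holomorphic_on UNIV"
proof -
  have "(\<lambda>s. integral (cbox (real k + 1) (real k + 2)) (\<lambda>x. exp ((s - 1) * of_real (ln x)) / of_real (exp x - 1)))
      holomorphic_on UNIV"
  proof (rule leibniz_rule_holomorphic[where fx = "\<lambda>s x. of_real (ln x) * exp ((s - 1) * of_real (ln x)) / of_real (exp x - 1)"])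
    fix s :: complex and x :: real
    assume "x \<in> cbox (real k + 1) (real k + 2)"
    show "((\<lambda>s. exp ((s - 1) * complex_of_real (ln x)) / complex_of_real (exp x - 1)) has_field_derivative
         complex_of_real (ln x) * exp ((s - 1) * complex_of_real (ln x)) / complex_of_real (exp x - 1)) (at s within UNIV)"
      unfolding divide_inverse by (auto intro!: derivative_eq_intros)
  next
    have "x \<noteq> 0" if "real k + 1 \<le> x" for x using that by linarith
    moreover have "complex_of_real (exp x) \<noteq> 1" if "real k + 1 \<le> x" for x
    proof -
      have "exp x > 1" using that by simp
      then show ?thesis by (metis less_irrefl of_real_eq_1_iff)
    qed
    ultimately show "continuous_on (UNIV \<times> cbox (real k + 1) (real k + 2))
      (\<lambda>(s, x). complex_of_real (ln x) * exp ((s - 1) * complex_of_real (ln x)) / complex_of_real (exp x - 1))"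
      and "(\<lambda>x. exp ((s - 1) * complex_of_real (ln x)) / complex_of_real (exp x - 1)) integrable_on cbox (real k + 1) (real k + 2)" for s
      by (auto simp: case_prod_unfold intro!: continuous_intros integrable_continuous_interval)
  qed auto
  then show ?thesis by (simp add: mellin_piece_def[abs_def])
qed

text \<open>Writing y as y/(2 A) times 2 A bounds ln y by y/(2 A) + 2 sqrt (2 A). Multiplied by A,
  this is y/2 plus a multiple of A^(3/2).\<close>

lemma powr_le_exp:
  fixes y A :: real
  assumes "y \<ge> 1" "A \<ge> 2"
  shows "y powr A \<le> exp (y / 2) * exp (4 * A powr (3/2))"
proof -
  have "ln y = ln (y / (2 * A)) + ln (2 * A)" using assms by (simp add: ln_div)
  also have "\<dots> \<le> y / (2 * A) + 2 * (2 * A) powr (1/2)"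
  proof (rule add_mono)
    show "ln (y / (2 * A)) \<le> y / (2 * A)" using assms by (intro ln_bound) auto
    have "ln ((2 * A) powr (1/2)) \<le> (2 * A) powr (1/2)" using assms by (intro ln_bound) auto
    then show "ln (2 * A) \<le> 2 * (2 * A) powr (1/2)" using assms by (simp add: ln_powr)
  qed
  finally have "A * ln y \<le> A * (y / (2 * A) + 2 * (2 * A) powr (1/2))"
    using assms by (intro mult_left_mono) auto
  also have "\<dots> = y / 2 + 2 * 2 powr (1/2) * (A powr 1 * A powr (1/2))"
    using assms by (simp add: powr_mult field_simps)
  also have "A powr 1 * A powr (1/2) = A powr (3/2)"
    unfolding powr_add[symmetric] by simp
  also have "2 * 2 powr (1/2) * A powr (3/2) \<le> 4 * A powr (3/2)"
    using powr_mono[of "1/2" 1 "2::real"] by (intro mult_right_mono) auto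
  finally have "exp (A * ln y) \<le> exp (y / 2 + 4 * A powr (3/2))" by simp
  then show ?thesis using assms by (simp add: powr_def exp_add mult.commute)
qed

text \<open>Half of the exponential decay pays for the power of x through
  \<open>powr_le_exp\<close>; the other half remains as the geometric factor that makes the pieces
  summable.\<close>

lemma norm_mellin_piece_le:
  "norm (mellin_piece k s) \<le> 2 * exp (4 * (norm s + 2) powr (3/2)) * exp (- (1/2)) ^ k"
proof -
  let ?A = "norm s + 2"
  let ?B = "2 * exp (4 * (norm s + 2) powr (3/2)) * exp (- (1/2)) ^ k"
  have ne: "exp x > 1" "x > 0" if "real k + 1 \<le> x" for x :: real using that by auto
  have "norm (integral {real k + 1..real k + 2} (\<lambda>x. exp ((s - 1) * of_real (ln x)) / of_real (exp x - 1)))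
      \<le> ?B * ((real k + 2) - (real k + 1))"
  proof (rule integral_bound)
    have "x \<noteq> 0" "complex_of_real (exp x) \<noteq> 1" if "real k + 1 \<le> x" for x
      using ne[OF that] by (auto simp del: of_real_exp)
    then show "continuous_on {real k + 1..real k + 2} (\<lambda>x. exp ((s - 1) * of_real (ln x)) / complex_of_real (exp x - 1))"
      by (auto intro!: continuous_intros)
    fix x assume "x \<in> {real k + 1..real k + 2}"
    then have x: "real k + 1 \<le> x" "x \<le> real k + 2" by auto
    have lnx: "ln x \<ge> 0" "ln x \<le> ln (real k + 2)" using x by auto
    have "norm (exp ((s - 1) * of_real (ln x))) = exp (ln x * (Re s - 1))" by (simp add: mult.commute)
    also have "\<dots> \<le> exp (ln (real k + 2) * ?A)"
    proof (subst exp_le_cancel_iff)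
      have "ln x * (Re s - 1) \<le> ln x * ?A"
        using lnx complex_Re_le_cmod[of s] by (intro mult_left_mono) auto
      also have "\<dots> \<le> ln (real k + 2) * ?A" using lnx by (intro mult_right_mono) auto
      finally show "ln x * (Re s - 1) \<le> ln (real k + 2) * ?A" .
    qed
    also have "\<dots> = (real k + 2) powr ?A" by (simp add: powr_def mult.commute)
    also have "\<dots> \<le> exp ((real k + 2) / 2) * exp (4 * ?A powr (3/2))"
      by (rule powr_le_exp) auto
    finally have 1: "norm (exp ((s - 1) * of_real (ln x))) \<le> exp ((real k + 2) / 2) * exp (4 * ?A powr (3/2))" .
    have "exp x \<ge> 2" using exp_ge_add_one_self[of x] x by linarith
    then have "exp x - 1 \<ge> exp x / 2" by simp
    also have "exp x / 2 \<ge> exp (real k + 1) / 2" using x by simp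
    finally have 2: "exp (real k + 1) / 2 \<le> exp x - 1" .
    have "norm (exp ((s - 1) * of_real (ln x)) / complex_of_real (exp x - 1)) = norm (exp ((s - 1) * of_real (ln x))) / (exp x - 1)"
      using ne[OF x(1)] unfolding norm_divide norm_of_real by simp
    also have "\<dots> \<le> exp ((real k + 2) / 2) * exp (4 * ?A powr (3/2)) / (exp (real k + 1) / 2)"
      using 1 2 ne[OF x(1)] by (intro frac_le) auto
    also have "\<dots> = 2 * exp (4 * ?A powr (3/2)) * (exp ((real k + 2) / 2) / exp (real k + 1))" by simp
    also have "exp ((real k + 2) / 2) / exp (real k + 1) = exp (- (1/2)) ^ k"
      unfolding exp_diff[symmetric] exp_of_nat_mult[symmetric] by (simp add: field_simps)
    finally show "norm (exp ((s - 1) * of_real (ln x)) / complex_of_real (exp x - 1)) \<le> ?B" .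
  qed auto
  then show ?thesis by (simp add: mellin_piece_def)
qed

lemma summable_exp_half: "summable (\<lambda>k. exp (- (1/2) :: real) ^ k)"
  by (intro summable_geometric) simp

definition mellin_tail :: "complex \<Rightarrow> complex" where
  "mellin_tail s = (\<Sum>k. mellin_piece k s)"

lemma holomorphic_mellin_tail: "mellin_tail holomorphic_on UNIV"
  unfolding mellin_tail_def[abs_def]
proof (rule holomorphic_suminf[OF holomorphic_mellin_piece])
  fix R :: real
  show "\<exists>M. summable M \<and> (\<forall>\<^sub>F n in sequentially. \<forall>z. norm z \<le> R \<longrightarrow> norm (mellin_piece n z) \<le> M n)"
  proof (intro exI conjI always_eventually allI impI)
    show "summable (\<lambda>k. 2 * exp (4 * (R + 2) powr (3/2)) * exp (- (1/2)) ^ k)"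
      by (intro summable_mult summable_exp_half)
    fix n and z :: complex assume "norm z \<le> R"
    then have "exp (4 * (norm z + 2) powr (3/2)) \<le> exp (4 * (R + 2) powr (3/2))"
      by (auto intro!: powr_mono2)
    then show "norm (mellin_piece n z) \<le> 2 * exp (4 * (R + 2) powr (3/2)) * exp (- (1/2)) ^ n"
      using norm_mellin_piece_le[of n z] by (smt (verit) mult_right_mono zero_le_power exp_ge_zero)
  qed
qed

lemma summable_norm_mellin_piece: "summable (\<lambda>k. norm (mellin_piece k s))"
  by (rule summable_comparison_test'[OF summable_mult[OF summable_exp_half], of 0])
     (use norm_mellin_piece_le[of _ s] in simp)

lemma norm_mellin_tail_le:
  "norm (mellin_tail s) \<le> 2 / (1 - exp (- (1/2))) * exp (4 * (norm s + 2) powr (3/2))"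
proof -
  have "norm (mellin_tail s) \<le> (\<Sum>k. norm (mellin_piece k s))"
    unfolding mellin_tail_def by (rule summable_norm[OF summable_norm_mellin_piece])
  also have "\<dots> \<le> (\<Sum>k. 2 * exp (4 * (norm s + 2) powr (3/2)) * exp (- (1/2)) ^ k)"
    by (intro suminf_le norm_mellin_piece_le summable_norm_mellin_piece summable_mult summable_exp_half)
  also have "\<dots> = 2 * exp (4 * (norm s + 2) powr (3/2)) * (1 / (1 - exp (- (1/2))))"
    by (subst suminf_mult[OF summable_exp_half], subst suminf_geometric) auto
  finally show ?thesis by (simp add: field_simps)
qed

text \<open>An entire form of \<open>rGamma s / (s + m)\<close>, whose only possible pole is a zero of \<open>rGamma\<close>.\<close>

definition rGamma_quot :: "nat \<Rightarrow> complex \<Rightarrow> complex" where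
  "rGamma_quot m s = pochhammer s m * rGamma (s + of_nat (Suc m))"

lemma rGamma_quot: "(s + of_nat m) * rGamma_quot m s = rGamma s"
  using pochhammer_rGamma[of s "Suc m"] by (simp add: rGamma_quot_def pochhammer_Suc mult_ac)

lemma norm_rGamma_quot_le:
  assumes "norm (s + of_nat m) \<ge> 1/2" shows "norm (rGamma_quot m s) \<le> 2 * norm (rGamma s)"
proof -
  have "1/2 * norm (rGamma_quot m s) \<le> norm (s + of_nat m) * norm (rGamma_quot m s)"
    using assms by (intro mult_right_mono) auto
  also have "\<dots> = norm (rGamma s)" using rGamma_quot[of s m] by (simp flip: norm_mult)
  finally show ?thesis by simp
qed

text \<open>The index shift sets aside the term 1/(s - 1) for n = 0. It is the pole of zeta, and in
  \<open>zeta_entire\<close> it becomes the separate summand \<open>rGamma s\<close>.\<close>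

definition bernoulli_part :: "complex \<Rightarrow> complex" where
  "bernoulli_part s = (\<Sum>m. of_real (bernoulli_coeff (Suc m)) * rGamma_quot m s)"

lemma summable_bernoulli_Suc: "summable (\<lambda>m. \<bar>bernoulli_coeff (Suc m)\<bar>)"
  using bernoulli_coeff(2) by (subst summable_Suc_iff)

lemma holomorphic_bernoulli_part: "bernoulli_part holomorphic_on UNIV"
  unfolding bernoulli_part_def[abs_def]
proof (rule holomorphic_suminf)
  show "(\<lambda>s. of_real (bernoulli_coeff (Suc m)) * rGamma_quot m s) holomorphic_on UNIV" for m
    unfolding rGamma_quot_def pochhammer_prod by (intro holomorphic_intros)
  fix R :: real
  obtain C where C: "C \<ge> 0" "\<And>z::complex. norm (rGamma z) \<le> exp (C * (norm z + 2) powr (3/2))"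
    using norm_rGamma_le by blast
  let ?K = "exp (C * (\<bar>R\<bar> + 2) powr (3/2))"
  show "\<exists>M. summable M \<and> (\<forall>\<^sub>F m in sequentially. \<forall>s. norm s \<le> R \<longrightarrow>
      norm (of_real (bernoulli_coeff (Suc m)) * rGamma_quot m s) \<le> M m)"
  proof (intro exI conjI)
    show "summable (\<lambda>m. \<bar>bernoulli_coeff (Suc m)\<bar> * (2 * ?K))"
      by (intro summable_mult2 summable_bernoulli_Suc)
    show "\<forall>\<^sub>F m in sequentially. \<forall>s. norm s \<le> R \<longrightarrow>
      norm (of_real (bernoulli_coeff (Suc m)) * rGamma_quot m s) \<le> \<bar>bernoulli_coeff (Suc m)\<bar> * (2 * ?K)"
      using eventually_ge_at_top[of "nat \<lceil>R + 1\<rceil>"]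
    proof eventually_elim
      case (elim m)
      show ?case
      proof (intro allI impI)
        fix s :: complex assume s: "norm s \<le> R"
        have "norm (s + of_nat m) \<ge> real m - norm s"
          using norm_triangle_ineq4[of "s + of_nat m" s] by simp
        moreover have "real m \<ge> R + 1" using elim by linarith
        ultimately have "norm (rGamma_quot m s) \<le> 2 * norm (rGamma s)"
          using s by (intro norm_rGamma_quot_le) auto
        also have "norm (rGamma s) \<le> exp (C * (norm s + 2) powr (3/2))" by (rule C)
        also have "\<dots> \<le> ?K" using s C(1) by (auto intro!: mult_left_mono powr_mono2)
        finally show "norm (of_real (bernoulli_coeff (Suc m)) * rGamma_quot m s) \<le> \<bar>bernoulli_coeff (Suc m)\<bar> * (2 * ?K)"
          by (simp add: norm_mult mult_left_mono)
      qed
    qed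
  qed
qed

text \<open>Integrating the expansion of \<open>x / (exp x - 1)\<close> over \<open>(0,1]\<close> term by term gives
  \<open>Gamma s * zeta s = (\<Sum>n. b n / (s + n - 1)) + mellin_tail s\<close>; this is \<open>(s - 1) * rGamma s\<close> times the right-hand side.\<close>

definition zeta_entire :: "complex \<Rightarrow> complex" where
  "zeta_entire s = rGamma s + (s - 1) * (bernoulli_part s + rGamma s * mellin_tail s)"

lemma holomorphic_zeta_entire: "zeta_entire holomorphic_on A"
proof -
  have "zeta_entire holomorphic_on UNIV" unfolding zeta_entire_def[abs_def]
    by (intro holomorphic_intros holomorphic_bernoulli_part holomorphic_mellin_tail)
  then show ?thesis by (rule holomorphic_on_subset) auto
qed

lemma zeta_entire_1: "zeta_entire 1 = 1"
  by (simp add: zeta_entire_def rGamma_inverse_Gamma)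

text \<open>On a circle of radius N + 1/2 each s + m has modulus at least 1/2, so every quotient in
  \<open>bernoulli_part\<close> is at most 2 |rGamma s|. Any s lies inside such a circle of radius
  at most |s| + 3/2, and the maximum principle does the rest.\<close>

lemma zeta_entire_growth:
  obtains C where "C \<ge> 0" "\<And>s. norm (zeta_entire s) \<le> exp (C * (norm s + 2) powr (3/2))"
proof -
  obtain C where C: "C \<ge> 0" "\<And>z::complex. norm (rGamma z) \<le> exp (C * (norm z + 2) powr (3/2))"
    using norm_rGamma_le by blast
  define B where "B = (\<Sum>m. \<bar>bernoulli_coeff (Suc m)\<bar>)"
  have B0: "B \<ge> 0" unfolding B_def by (intro suminf_nonneg summable_bernoulli_Suc) auto
  define D where "D = 2 / (1 - exp (- (1/2) :: real))"
  have D0: "D \<ge> 0" unfolding D_def by simp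
  define E where "E = 1 + 2 * B + D"
  have E: "E \<ge> 1" using B0 D0 by (simp add: E_def)
  have circ: "norm (zeta_entire s) \<le> exp ((C + 5 + E) * (norm s + 2) powr (3/2))"
    if s: "norm s = real N + 1/2" for s N
  proof -
    let ?A = "(norm s + 2) powr (3/2)"
    have A: "norm s + 2 \<le> ?A" using powr_mono[of 1 "3/2" "norm s + 2"] by simp
    have "norm (of_real (bernoulli_coeff (Suc m)) * rGamma_quot m s) \<le> \<bar>bernoulli_coeff (Suc m)\<bar> * (2 * norm (rGamma s))" for m
    proof -
      have "norm (s + of_nat m) \<ge> \<bar>norm s - real m\<bar>"
        using norm_triangle_ineq3[of s "- of_nat m"] by simp
      also have "\<bar>norm s - real m\<bar> \<ge> 1/2" unfolding s by (cases "m \<le> N") auto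
      finally show ?thesis using norm_rGamma_quot_le[of s m] by (simp add: norm_mult mult_left_mono)
    qed
    then have "norm (bernoulli_part s) \<le> (\<Sum>m. \<bar>bernoulli_coeff (Suc m)\<bar> * (2 * norm (rGamma s)))"
      unfolding bernoulli_part_def by (intro norm_suminf_le summable_mult2 summable_bernoulli_Suc)
    also have "\<dots> = B * (2 * norm (rGamma s))"
      unfolding B_def by (intro suminf_mult2[symmetric] summable_bernoulli_Suc)
    finally have b: "norm (bernoulli_part s) \<le> 2 * B * norm (rGamma s)" by simp
    have e1: "exp (4 * ?A) \<ge> 1" by simp
    have "norm (zeta_entire s) \<le> norm (rGamma s) + norm (s - 1) * (norm (bernoulli_part s) + norm (rGamma s) * norm (mellin_tail s))"
      unfolding zeta_entire_def by (intro norm_triangle_le add_mono order.refl)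
        (auto simp: norm_mult intro!: mult_left_mono norm_triangle_le)
    also have "\<dots> \<le> norm (rGamma s) * 1 + norm (s - 1) * (norm (rGamma s) * (2 * B) + norm (rGamma s) * (D * exp (4 * ?A)))"
      using b norm_mellin_tail_le[of s] unfolding D_def
      by (intro add_mono mult_left_mono order.refl) (auto simp: mult_ac)
    also have "\<dots> = norm (rGamma s) * (1 + norm (s - 1) * (2 * B + D * exp (4 * ?A)))"
      by (simp add: algebra_simps)
    also have "\<dots> \<le> exp (C * ?A) * (exp ?A * (E * exp (4 * ?A)))"
    proof (intro mult_mono C)
      have n1: "1 + norm (s - 1) \<le> exp ?A"
        using norm_triangle_ineq4[of s 1] A exp_ge_add_one_self[of ?A] unfolding norm_one by linarith
      have "2 * B * 1 \<le> 2 * B * exp (4 * ?A)" using e1 B0 by (intro mult_left_mono) auto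
      then have 2: "1 + (2 * B + D * exp (4 * ?A)) \<le> E * exp (4 * ?A)"
        using e1 unfolding E_def distrib_right by linarith
      have "1 + norm (s - 1) * (2 * B + D * exp (4 * ?A)) \<le> (1 + norm (s - 1)) * (1 + (2 * B + D * exp (4 * ?A)))"
        using B0 D0 by (simp add: algebra_simps)
      also have "\<dots> \<le> exp ?A * (E * exp (4 * ?A))" using n1 2 B0 D0 by (intro mult_mono) auto
      finally show "1 + norm (s - 1) * (2 * B + D * exp (4 * ?A)) \<le> exp ?A * (E * exp (4 * ?A))" .
    qed (use B0 D0 in \<open>auto intro!: add_nonneg_nonneg mult_nonneg_nonneg\<close>)
    also have "E \<le> exp (E * ?A)"
    proof -
      have "E * 1 \<le> E * ?A" using E A by (intro mult_left_mono) (auto intro: order_trans[of 1 "norm s + 2"])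
      then show ?thesis using exp_ge_add_one_self[of "E * ?A"] by linarith
    qed
    also have "exp (C * ?A) * (exp ?A * (exp (E * ?A) * exp (4 * ?A))) = exp ((C + 5 + E) * ?A)"
      by (simp add: exp_add[symmetric] algebra_simps)
    finally show ?thesis by (simp add: mult_left_mono)
  qed
  have "norm (zeta_entire s) \<le> exp (((C + 5 + E) * 4) * (norm s + 2) powr (3/2))" for s
  proof -
    define N where "N = nat \<lceil>norm s\<rceil>"
    define r where "r = real N + 1/2"
    have N: "norm s \<le> real N" "real N \<le> norm s + 1" unfolding N_def using zero_le_ceiling[of "norm s"] norm_ge_zero[of s] by linarith+
    have "norm (zeta_entire s) \<le> exp ((C + 5 + E) * (r + 2) powr (3/2))"
    proof (rule maximum_modulus_frontier[of zeta_entire "cball 0 r"])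
      fix z :: complex assume "z \<in> frontier (cball 0 r)"
      then have "norm z = real N + 1/2" by (simp add: r_def)
      from circ[OF this] this show "norm (zeta_entire z) \<le> exp ((C + 5 + E) * (r + 2) powr (3/2))"
        by (simp add: r_def)
    qed (use N holomorphic_zeta_entire in \<open>auto simp: r_def intro!: holomorphic_on_imp_continuous_on\<close>)
    then have le: "norm (zeta_entire s) \<le> exp ((C + 5 + E) * (r + 2) powr (3/2))" .
    have "(r + 2) powr (3/2) \<le> (2 * (norm s + 2)) powr (3/2)"
    proof (intro powr_mono2)
      have "real N + 1/2 + 2 \<le> (norm s + 1) + 1/2 + 2" using N(2) by (intro add_right_mono)
      also have "\<dots> \<le> 2 * (norm s + 2)" using norm_ge_zero[of s] by (simp add: field_simps)
      finally show "r + 2 \<le> 2 * (norm s + 2)" by (simp add: r_def)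
    qed (use N in \<open>auto simp: r_def\<close>)
    also have "\<dots> = 2 powr (3/2) * (norm s + 2) powr (3/2)"
      using powr_mult[of 2 "norm s + 2" "3/2"] by simp
    also have "\<dots> \<le> 4 * (norm s + 2) powr (3/2)"
      using powr_mono[of "3/2" 2 "2::real"] by (intro mult_right_mono) auto
    finally have "(C + 5 + E) * (r + 2) powr (3/2) \<le> (C + 5 + E) * (4 * (norm s + 2) powr (3/2))"
      using C(1) E by (intro mult_left_mono) auto
    then have "exp ((C + 5 + E) * (r + 2) powr (3/2)) \<le> exp ((C + 5 + E) * 4 * (norm s + 2) powr (3/2))"
      unfolding exp_le_cancel_iff mult.assoc .
    with le show ?thesis by (rule order_trans)
  qed
  then show ?thesis using that[of "(C + 5 + E) * 4"] C(1) E by auto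
qed

section \<open>The Mellin integral of zeta on the real axis\<close>

lemma integral_tendsto_to_inf:
  fixes h :: "real \<Rightarrow> real"
  assumes int: "h integrable_on {a..}" and nonneg: "\<And>x. x \<ge> a \<Longrightarrow> 0 \<le> h x"
  shows "((\<lambda>y. integral {a..y} h) \<longlongrightarrow> integral {a..} h) at_top"
proof (rule tendsto_at_topI_sequentially)
  fix X :: "nat \<Rightarrow> real" assume X: "filterlim X at_top sequentially"
  let ?f = "\<lambda>n x. if x \<in> {a..X n} then h x else 0"
  have sub: "{a..y} \<inter> {a..} = {a..y}" for y by auto
  have hi: "h integrable_on {a..y}" for y
    using integrable_on_subinterval[OF int, of a y] by auto
  have eq: "integral {a..} (?f n) = integral {a..X n} h" for n
    using integral_restrict_Int[of "{a..}" "{a..X n}" h] by (simp only: sub)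
  have "(\<lambda>n. integral {a..} (?f n)) \<longlonglongrightarrow> integral {a..} h"
  proof (rule dominated_convergence(2)[OF _ int])
    show "?f n integrable_on {a..}" for n
      using integrable_restrict_Int[of "{a..X n}" h "{a..}"] hi[of "X n"] by (simp only: sub)
    show "norm (?f n x) \<le> h x" if "x \<in> {a..}" for n x using nonneg that by auto
    fix x assume x: "x \<in> {a..}"
    have "eventually (\<lambda>n. ?f n x = h x) sequentially"
      using filterlim_at_top[THEN iffD1, OF X, rule_format, of x] by eventually_elim (use x in auto)
    then show "(\<lambda>n. ?f n x) \<longlonglongrightarrow> h x" by (rule tendsto_eventually)
  qed
  then show "(\<lambda>n. integral {a..X n} h) \<longlonglongrightarrow> integral {a..} h" by (simp only: eq)
qed

lemma Gamma_integral_real_scaled: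
  assumes x: "x > (0::real)" and m: "m > 0"
  shows "((\<lambda>t. t powr (x - 1) * exp (- (m * t))) has_integral Gamma x / m powr x) {0..}"
proof (rule has_integral_to_inf)
  let ?g = "\<lambda>t. t powr (x - 1) / exp t"
  note G = Gamma_integral_real[OF x]
  have gi: "?g integrable_on {0..y}" for y
    using integrable_on_subinterval[of ?g "{0..}" 0 y] G by (auto simp: integrable_on_def)
  have H: "((\<lambda>t. t powr (x - 1) * exp (- (m * t))) has_integral integral {0..m * y} ?g / m powr x) {0..y}" for y
  proof -
    have "((\<lambda>t. ?g (m * t)) has_integral (1 / \<bar>m\<bar>) *\<^sub>R integral {0..m * y} ?g) ((\<lambda>x. x / m) ` {0..m * y})"
      by (rule has_integral_stretch_real[OF integrable_integral[OF gi]]) (use m in auto)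
    moreover have "(\<lambda>x. x / m) ` {0..m * y} = {0..y}"
      using m by (auto simp: field_simps image_iff intro!: bexI[of _ "m * _"])
    ultimately have "((\<lambda>t. ?g (m * t)) has_integral integral {0..m * y} ?g / m) {0..y}"
      using m by simp
    then have "((\<lambda>t. m powr (1 - x) * ?g (m * t)) has_integral m powr (1 - x) * (integral {0..m * y} ?g / m)) {0..y}"
      by (rule has_integral_mult_right)
    then have "((\<lambda>t. t powr (x - 1) * exp (- (m * t))) has_integral m powr (1 - x) * (integral {0..m * y} ?g / m)) {0..y}"
    proof (rule has_integral_eq[rotated])
      fix t assume t: "t \<in> {0..y}"
      have "m powr (1 - x) * m powr (x - 1) = 1" using m by (simp add: powr_add[symmetric])
      then show "m powr (1 - x) * ?g (m * t) = t powr (x - 1) * exp (- (m * t))"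
        by (simp add: powr_mult exp_minus divide_inverse)
    qed
    moreover have "m powr (1 - x) = m / m powr x" using m by (simp add: powr_diff)
    then have "m powr (1 - x) * (integral {0..m * y} ?g / m) = integral {0..m * y} ?g / m powr x"
      using m by simp
    ultimately show ?thesis by simp
  qed
  show "(\<lambda>t. t powr (x - 1) * exp (- (m * t))) integrable_on {0..y}" for y
    using H[of y] by (auto simp: integrable_on_def)
  have "((\<lambda>y. integral {0..y} ?g) \<longlongrightarrow> integral {0..} ?g) at_top"
    by (rule integral_tendsto_to_inf) (use G in \<open>auto simp: integrable_on_def\<close>)
  moreover have "filterlim (\<lambda>y. m * y) at_top at_top"
    by (rule filterlim_tendsto_pos_mult_at_top[OF tendsto_const m filterlim_ident])
  ultimately have "((\<lambda>y. integral {0..m * y} ?g) \<longlongrightarrow> integral {0..} ?g) at_top"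
    by (rule filterlim_compose)
  moreover have "integral {0..} ?g = Gamma x" using G by (rule integral_unique)
  ultimately have "((\<lambda>y. integral {0..m * y} ?g / m powr x) \<longlongrightarrow> Gamma x / m powr x) at_top"
    using m by (auto intro!: tendsto_intros)
  moreover have "integral {0..y} (\<lambda>t. t powr (x - 1) * exp (- (m * t))) = integral {0..m * y} ?g / m powr x" for y
    using H by (rule integral_unique)
  ultimately show "((\<lambda>y. integral {0..y} (\<lambda>t. t powr (x - 1) * exp (- (m * t)))) \<longlongrightarrow> Gamma x / m powr x) at_top"
    by simp
qed auto

text \<open>1 / (exp x - 1) is a geometric series in exp (- x) with positive terms, so monotone
  convergence applies. At x = 0 the kernel and all partial sums are 0 by the conventions for
  \<open>powr\<close> and division.\<close>

lemma zeta_kernel_has_integral: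
  assumes "\<sigma> > (1::real)"
  shows "((\<lambda>x. x powr (\<sigma> - 1) / (exp x - 1)) has_integral Gamma \<sigma> * (\<Sum>n. 1 / real (Suc n) powr \<sigma>)) {0..}"
proof -
  let ?F = "\<lambda>x. x powr (\<sigma> - 1) / (exp x - 1)"
  let ?f = "\<lambda>k x. \<Sum>n<k. x powr (\<sigma> - 1) * exp (- (real (Suc n) * x))"
  have G: "Gamma \<sigma> > 0" using assms by (simp add: Gamma_real_pos)
  have f: "(?f k has_integral (\<Sum>n<k. Gamma \<sigma> / real (Suc n) powr \<sigma>)) {0..}" for k
    using assms by (intro has_integral_sum Gamma_integral_real_scaled) auto
  then have fi: "integral {0..} (?f k) = (\<Sum>n<k. Gamma \<sigma> / real (Suc n) powr \<sigma>)" for k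
    by (rule integral_unique)
  have lim: "(\<lambda>k. \<Sum>n<k. Gamma \<sigma> / real (Suc n) powr \<sigma>) \<longlonglongrightarrow> Gamma \<sigma> * (\<Sum>n. 1 / real (Suc n) powr \<sigma>)"
    using sums_mult[OF summable_sums[OF summable_Suc_powr[OF assms]], of "Gamma \<sigma>"]
    by (simp add: sums_def del: of_nat_Suc)
  have mc: "?F integrable_on {0..} \<and> (\<lambda>k. integral {0..} (?f k)) \<longlonglongrightarrow> integral {0..} ?F"
  proof (rule monotone_convergence_increasing)
    show "?f k integrable_on {0..}" for k using f by (auto simp: integrable_on_def)
    show "bounded (range (\<lambda>k. integral {0..} (?f k)))"
      unfolding fi using lim by (intro convergent_imp_bounded)
    fix x :: real assume x: "x \<in> {0..}"
    show "(\<lambda>k. ?f k x) \<longlonglongrightarrow> ?F x"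
    proof (cases "x = 0")
      case False
      then have "x > 0" using x by simp
      have eq: "exp (- (real (Suc n) * x)) = exp (- x) * exp (- x) ^ n" for n
        by (simp add: exp_of_nat_mult[symmetric] exp_add[symmetric] algebra_simps)
      have "(\<lambda>n. exp (- x) ^ n) sums (1 / (1 - exp (- x)))" using \<open>x > 0\<close> by (intro geometric_sums) auto
      from sums_mult[OF this, of "x powr (\<sigma> - 1) * exp (- x)"]
      have "(\<lambda>n. x powr (\<sigma> - 1) * exp (- (real (Suc n) * x))) sums (x powr (\<sigma> - 1) * exp (- x) * (1 / (1 - exp (- x))))"
        unfolding eq by (simp only: mult.assoc)
      moreover have "exp (- x) * (1 / (1 - exp (- x))) = 1 / (exp x - 1)"
        using \<open>x > 0\<close> by (simp add: exp_minus field_simps)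
      then have "x powr (\<sigma> - 1) * exp (- x) * (1 / (1 - exp (- x))) = ?F x" by (simp only: mult.assoc) simp
      ultimately show ?thesis unfolding sums_def by simp
    qed (use assms in simp)
  qed (auto intro!: sum_mono2)
  have "integral {0..} ?F = Gamma \<sigma> * (\<Sum>n. 1 / real (Suc n) powr \<sigma>)"
    by (rule LIMSEQ_unique[OF conjunct2[OF mc] lim[folded fi]])
  then show ?thesis using mc by (simp only: has_integral_iff simp_thms)
qed

text \<open>Absolute summability of the coefficients bounds all partial sums by a multiple of
  x^(\<sigma> - 2), which is integrable at 0 because \<sigma> > 1.\<close>

lemma zeta_kernel_integral_01:
  assumes "\<sigma> > (1::real)"
  shows "(\<lambda>n. bernoulli_coeff n / (\<sigma> + real n - 1)) sums integral {0..1} (\<lambda>x. x powr (\<sigma> - 1) / (exp x - 1))"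
proof -
  let ?b = bernoulli_coeff
  let ?F = "\<lambda>x. x powr (\<sigma> - 1) / (exp x - 1)"
  let ?f = "\<lambda>k x. \<Sum>n<k. ?b n * x powr (\<sigma> + real n - 2)"
  define B where "B = (\<Sum>n. \<bar>?b n\<bar>)"
  have pi: "((\<lambda>x. x powr (\<sigma> + real n - 2)) has_integral 1 / (\<sigma> + real n - 1)) {0..1}" for n
    using has_integral_powr_from_0[of "\<sigma> + real n - 2" 1] assms by simp
  have f: "(?f k has_integral (\<Sum>n<k. ?b n * (1 / (\<sigma> + real n - 1)))) {0..1}" for k
    by (intro has_integral_sum has_integral_mult_right pi) auto
  have xp: "x powr (\<sigma> + real n - 2) = x powr (\<sigma> - 2) * x ^ n" if "x > 0" for x n
    using that by (simp add: powr_add[symmetric] powr_realpow[symmetric] algebra_simps)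
  have "(\<lambda>k. integral {0..1} (?f k)) \<longlonglongrightarrow> integral {0..1} ?F"
  proof (rule dominated_convergence(2))
    show "?f k integrable_on {0..1}" for k using f by (auto simp: integrable_on_def)
    show "(\<lambda>x. x powr (\<sigma> - 2) * B) integrable_on {0..1}"
      using pi[of 0] by (intro integrable_on_mult_left) (auto simp: integrable_on_def)
    fix x :: real assume x: "x \<in> {0..1}"
    show "norm (?f k x) \<le> x powr (\<sigma> - 2) * B" for k
    proof (cases "x = 0")
      case False
      have "norm (?f k x) \<le> (\<Sum>n<k. x powr (\<sigma> - 2) * \<bar>?b n\<bar>)"
      proof (intro sum_norm_le)
        fix n
        have "norm (?b n * x powr (\<sigma> + real n - 2)) = x powr (\<sigma> - 2) * (\<bar>?b n\<bar> * x ^ n)"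
          using xp[of x n] x False by (simp add: abs_mult)
        also have "\<dots> \<le> x powr (\<sigma> - 2) * (\<bar>?b n\<bar> * 1)"
          using x by (intro mult_left_mono power_le_one) auto
        finally show "norm (?b n * x powr (\<sigma> + real n - 2)) \<le> x powr (\<sigma> - 2) * \<bar>?b n\<bar>" by simp
      qed
      also have "\<dots> \<le> x powr (\<sigma> - 2) * B"
        unfolding sum_distrib_left[symmetric] B_def
        by (intro mult_left_mono sum_le_suminf bernoulli_coeff) auto
      finally show ?thesis .
    qed simp
    show "(\<lambda>k. ?f k x) \<longlonglongrightarrow> ?F x"
    proof (cases "x = 0")
      case False
      then have x': "x > 0" "x \<le> 1" using x by auto
      have "(\<lambda>n. x powr (\<sigma> - 2) * (?b n * x ^ n)) sums (x powr (\<sigma> - 2) * (x / (exp x - 1)))"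
        using bernoulli_coeff(3)[OF x'] by (rule sums_mult)
      moreover have "x powr (\<sigma> - 2) * x = x powr (\<sigma> - 1)"
        using x' powr_add[of x "\<sigma> - 2" 1] by simp
      ultimately show ?thesis using xp[OF x'(1)] by (simp add: sums_def mult_ac)
    qed simp
  qed
  moreover have "integral {0..1} (?f k) = (\<Sum>n<k. ?b n / (\<sigma> + real n - 1))" for k
    using integral_unique[OF f[of k]] by simp
  ultimately show ?thesis by (simp add: sums_def)
qed

lemma mellin_piece_of_real:
  "mellin_piece k (of_real \<sigma>) = of_real (integral {real k + 1..real k + 2} (\<lambda>x. x powr (\<sigma> - 1) / (exp x - 1)))"
proof -
  let ?F = "\<lambda>x. x powr (\<sigma> - 1) / (exp x - 1)"
  have "x \<noteq> 0" if "real k + 1 \<le> x" for x using that by linarith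
  moreover have "exp x \<noteq> 1" if "real k + 1 \<le> x" for x using that by simp
  ultimately have "?F integrable_on {real k + 1..real k + 2}"
    by (auto intro!: integrable_continuous_interval continuous_intros)
  then have "((\<lambda>x. complex_of_real (?F x)) has_integral of_real (integral {real k + 1..real k + 2} ?F)) {real k + 1..real k + 2}"
    by (intro has_integral_of_real integrable_integral)
  then have "((\<lambda>x. exp ((of_real \<sigma> - 1) * of_real (ln x)) / of_real (exp x - 1)) has_integral
      complex_of_real (integral {real k + 1..real k + 2} ?F)) {real k + 1..real k + 2}"
  proof (rule has_integral_eq[rotated])
    fix x assume "x \<in> {real k + 1..real k + 2}"
    then have "x > 0" by auto
    then have "x powr (\<sigma> - 1) = exp ((\<sigma> - 1) * ln x)" by (simp add: powr_def)
    then show "complex_of_real (?F x) = exp ((of_real \<sigma> - 1) * of_real (ln x)) / of_real (exp x - 1)"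
      by (simp add: exp_of_real[symmetric])
  qed
  then show ?thesis unfolding mellin_piece_def by (rule integral_unique)
qed

text \<open>Real \<sigma> keeps the integrand nonnegative, so the real convergence theorems apply;
  the identity theorem extends the result afterwards. With the integral cut at 1, the Bernoulli
  expansion serves (0, 1] and the unit pieces serve the rest.\<close>

lemma zeta_entire_of_real:
  assumes s: "\<sigma> > (1::real)"
  shows "zeta_entire (of_real \<sigma>) = of_real (\<sigma> - 1) * of_real (\<Sum>n. 1 / real (Suc n) powr \<sigma>)"
proof -
  let ?F = "\<lambda>x. x powr (\<sigma> - 1) / (exp x - 1)"
  define I where "I = integral {0..1} ?F"
  define Z where "Z = (\<Sum>n. 1 / real (Suc n) powr \<sigma>)"
  note K = zeta_kernel_has_integral[OF s, folded Z_def]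
  have Fi: "?F integrable_on {a..b}" if "a \<ge> 0" for a b
    using integrable_on_subinterval[of ?F "{0..}" a b] K that by (auto simp: integrable_on_def)
  have part: "integral {0..real k + 1} ?F = I + (\<Sum>j<k. integral {real j + 1..real j + 2} ?F)" for k
  proof (induction k)
    case (Suc k)
    have "integral {0..real k + 1} ?F + integral {real k + 1..real k + 2} ?F = integral {0..real k + 2} ?F"
      by (intro Henstock_Kurzweil_Integration.integral_combine Fi) auto
    then show ?case using Suc by (simp add: add_ac)
  qed (simp add: I_def)
  have "((\<lambda>y. integral {0..y} ?F) \<longlongrightarrow> integral {0..} ?F) at_top"
    by (rule integral_tendsto_to_inf) (use K in \<open>auto simp: integrable_on_def\<close>)
  moreover have "filterlim (\<lambda>k. real k + 1) at_top sequentially"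
    using filterlim_tendsto_add_at_top[OF tendsto_const filterlim_real_sequentially, of 1] by (simp add: add.commute)
  ultimately have "(\<lambda>k. integral {0..real k + 1} ?F) \<longlonglongrightarrow> integral {0..} ?F"
    by (rule filterlim_compose)
  then have "(\<lambda>k. I + (\<Sum>j<k. integral {real j + 1..real j + 2} ?F)) \<longlonglongrightarrow> Gamma \<sigma> * Z"
    unfolding part integral_unique[OF K] .
  from tendsto_diff[OF this tendsto_const[of I]]
  have "(\<lambda>j. integral {real j + 1..real j + 2} ?F) sums (Gamma \<sigma> * Z - I)"
    by (simp add: sums_def)
  then have "(\<lambda>j. mellin_piece j (of_real \<sigma>)) sums of_real (Gamma \<sigma> * Z - I)"
    unfolding mellin_piece_of_real by (rule sums_of_real)
  then have tail: "mellin_tail (of_real \<sigma>) = of_real (Gamma \<sigma> * Z - I)"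
    unfolding mellin_tail_def by (simp add: sums_iff)
  have q: "rGamma_quot m (of_real \<sigma>) = rGamma (of_real \<sigma>) * of_real (1 / (\<sigma> + real m))" for m
  proof -
    have "complex_of_real \<sigma> + of_nat m = of_real (\<sigma> + real m)" by simp
    moreover have "\<sigma> + real m \<noteq> 0" using s by linarith
    ultimately show ?thesis using rGamma_quot[of "of_real \<sigma>" m]
      by (metis mult.commute nonzero_mult_div_cancel_right of_real_1 of_real_divide of_real_eq_0_iff times_divide_eq_right mult_1_right)
  qed
  have "(\<lambda>n. bernoulli_coeff n / (\<sigma> + real n - 1)) sums I"
    unfolding I_def by (rule zeta_kernel_integral_01[OF s])
  then have "(\<lambda>m. bernoulli_coeff (Suc m) / (\<sigma> + real (Suc m) - 1)) sums (I - bernoulli_coeff 0 / (\<sigma> + real 0 - 1))"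
    by (subst sums_Suc_iff) simp
  then have "(\<lambda>m. bernoulli_coeff (Suc m) / (\<sigma> + real m)) sums (I - 1 / (\<sigma> - 1))"
    by (simp add: bernoulli_coeff)
  then have "(\<lambda>m. complex_of_real (bernoulli_coeff (Suc m) / (\<sigma> + real m))) sums of_real (I - 1 / (\<sigma> - 1))"
    by (rule sums_of_real)
  from sums_mult[OF this, of "rGamma (of_real \<sigma>)"]
  have "(\<lambda>m. of_real (bernoulli_coeff (Suc m)) * rGamma_quot m (of_real \<sigma>)) sums (rGamma (of_real \<sigma>) * of_real (I - 1 / (\<sigma> - 1)))"
    unfolding q by (simp add: mult_ac)
  then have bp: "bernoulli_part (of_real \<sigma>) = rGamma (of_real \<sigma>) * of_real (I - 1 / (\<sigma> - 1))"
    unfolding bernoulli_part_def by (simp add: sums_iff)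
  have rg: "rGamma (complex_of_real \<sigma>) = of_real (1 / Gamma \<sigma>)"
    by (simp add: rGamma_inverse_Gamma Gamma_complex_of_real divide_inverse)
  have "Gamma \<sigma> > 0" using s by (simp add: Gamma_real_pos)
  have "zeta_entire (of_real \<sigma>) = of_real (1 / Gamma \<sigma> + (\<sigma> - 1) * ((1 / Gamma \<sigma>) * (I - 1 / (\<sigma> - 1)) + (1 / Gamma \<sigma>) * (Gamma \<sigma> * Z - I)))"
    unfolding zeta_entire_def bp tail rg by simp
  also have "1 / Gamma \<sigma> + (\<sigma> - 1) * ((1 / Gamma \<sigma>) * (I - 1 / (\<sigma> - 1)) + (1 / Gamma \<sigma>) * (Gamma \<sigma> * Z - I)) = (\<sigma> - 1) * Z"
  proof -
    have "(1 / Gamma \<sigma>) * (I - 1 / (\<sigma> - 1)) + (1 / Gamma \<sigma>) * (Gamma \<sigma> * Z - I) = Z - 1 / Gamma \<sigma> * (1 / (\<sigma> - 1))"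
      using \<open>Gamma \<sigma> > 0\<close> by (simp add: right_diff_distrib diff_divide_distrib)
    moreover have "(\<sigma> - 1) * (1 / Gamma \<sigma> * (1 / (\<sigma> - 1))) = 1 / Gamma \<sigma>" using s by simp
    ultimately show ?thesis by (simp only: right_diff_distrib)
  qed
  finally show ?thesis by (simp add: Z_def)
qed

lemma zeta_entire_eq_dir_zeta:
  assumes s: "Re s > 1"
  shows "zeta_entire s = (s - 1) * dir_zeta s"
proof -
  let ?S = "{s. Re s > 1}" and ?U = "of_real ` {1<..<(3::real)}"
  have "zeta_entire s - (s - 1) * dir_zeta s = 0"
  proof (rule analytic_continuation[where f = "\<lambda>s. zeta_entire s - (s - 1) * dir_zeta s" and w = s and S = ?S and U = ?U and \<xi> = 2])
    have "dir_zeta holomorphic_on ?S"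
      unfolding dir_zeta_def[abs_def] by (rule dirichlet_holomorphic[of "\<lambda>_. 1"]) simp
    then show "(\<lambda>s. zeta_entire s - (s - 1) * dir_zeta s) holomorphic_on ?S"
      by (intro holomorphic_intros holomorphic_zeta_entire)
    show "open ?S" by (rule open_halfspace_Re_gt)
    show "connected ?S" by (intro convex_connected convex_halfspace_Re_gt)
    show "2 islimpt complex_of_real ` {1<..<3}"
    proof -
      have "(2::real) islimpt {1<..<3}" by (simp add: open_imp_islimpt)
      moreover have "complex_of_real x \<noteq> 2" if "x \<noteq> 2" for x
        using that by (metis of_real_eq_iff of_real_numeral)
      ultimately have "complex_of_real 2 islimpt complex_of_real ` {1<..<3}"
        by (intro islimpt_isCont_image) (auto simp: eventually_at_filter)
      then show ?thesis by simp
    qed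
    show "zeta_entire z - (z - 1) * dir_zeta z = 0" if z: "z \<in> ?U" for z
    proof -
      obtain \<sigma> where \<sigma>: "z = of_real \<sigma>" "\<sigma> > 1" using z by auto
      have np: "1 / complex_of_nat (Suc n) powr of_real \<sigma> = of_real (1 / real (Suc n) powr \<sigma>)" for n
        using powr_of_real[of "real (Suc n)" \<sigma>] by (simp del: of_nat_Suc)
      have "(\<lambda>n. complex_of_real (1 / real (Suc n) powr \<sigma>)) sums dir_zeta z"
        using dir_zeta_sums[of z] \<sigma> unfolding \<sigma>(1) np by simp
      moreover have "(\<lambda>n. complex_of_real (1 / real (Suc n) powr \<sigma>)) sums of_real (\<Sum>n. 1 / real (Suc n) powr \<sigma>)"
        by (intro sums_of_real summable_sums summable_Suc_powr \<sigma>)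
      ultimately have "dir_zeta z = of_real (\<Sum>n. 1 / real (Suc n) powr \<sigma>)" by (rule sums_unique2)
      then show ?thesis using zeta_entire_of_real[OF \<sigma>(2)] \<sigma> by simp
    qed
  qed (use s in auto)
  then show ?thesis by simp
qed

text \<open>Resolves the definite description: two candidates agree for Re s > 1, and the punctured
  plane is connected.\<close>

lemma zeta_eq: "zeta = (\<lambda>s. if s = 1 then 0 else zeta_entire s / (s - 1))"
  unfolding zeta_def
proof (rule the_equality)
  let ?z = "\<lambda>s. if s = 1 then 0 else zeta_entire s / (s - 1)"
  have hol: "?z holomorphic_on - {1}"
  proof (rule holomorphic_transform)
    show "(\<lambda>s. zeta_entire s / (s - 1)) holomorphic_on - {1}"
      by (intro holomorphic_intros holomorphic_zeta_entire) auto
  qed auto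
  moreover have sums: "(\<lambda>n. 1 / of_nat (Suc n) powr s) sums ?z s" if "Re s > 1" for s
    using dir_zeta_sums[OF that] zeta_entire_eq_dir_zeta[OF that] that by auto
  ultimately show "?z holomorphic_on - {1} \<and> (\<forall>s. Re s > 1 \<longrightarrow> (\<lambda>n. 1 / of_nat (Suc n) powr s) sums ?z s) \<and> ?z 1 = 0"
    by simp
  fix g assume g: "g holomorphic_on - {1} \<and> (\<forall>s. Re s > 1 \<longrightarrow> (\<lambda>n. 1 / of_nat (Suc n) powr s) sums g s) \<and> g 1 = (0::complex)"
  show "g = ?z"
  proof
    fix s
    show "g s = ?z s"
    proof (cases "s = 1")
      case False
      have "g s - ?z s = 0"
      proof (rule analytic_continuation[where f = "\<lambda>s. g s - ?z s" and w = s and S = "- {1}" and U = "{s. Re s > 1}" and \<xi> = 2])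
        show "(\<lambda>s. g s - ?z s) holomorphic_on - {1}"
          using g hol by (intro holomorphic_on_diff) auto
        show "connected (- {1::complex})" by (rule connected_punctured_universe) simp
        show "(2::complex) islimpt {s. Re s > 1}"
          by (rule open_imp_islimpt[OF open_halfspace_Re_gt]) simp
        show "g z - ?z z = 0" if "z \<in> {s. Re s > 1}" for z
        proof -
          have z: "Re z > 1" using that by simp
          then have "(\<lambda>n. 1 / of_nat (Suc n) powr z) sums g z" using g by blast
          from sums_unique2[OF this sums[OF z]] show ?thesis by simp
        qed
      qed (use False in auto)
      then show ?thesis by simp
    qed (use g in simp)
  qed
qed

lemma zeta_entire_eq: "s \<noteq> 1 \<Longrightarrow> zeta_entire s = (s - 1) * zeta s"
  by (simp add: zeta_eq)

lemma holomorphic_zeta: "zeta holomorphic_on - {1}"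
proof (rule holomorphic_transform)
  show "(\<lambda>s. zeta_entire s / (s - 1)) holomorphic_on - {1}"
    by (intro holomorphic_intros holomorphic_zeta_entire) auto
qed (auto simp: zeta_eq)

lemma zeta_eq_dir_zeta: "Re s > 1 \<Longrightarrow> zeta s = dir_zeta s"
  using zeta_entire_eq_dir_zeta[of s] by (auto simp: zeta_eq)

section \<open>Moments and the interchange of sums and integrals\<close>

text \<open>The function h is orthogonal to all polynomials, hence to functions uniformly close to h
  itself, so the integral of h^2 is at most e times that of |h| for every e > 0.\<close>

lemma vanishing_moments_real:
  fixes h :: "real \<Rightarrow> real"
  assumes cont: "continuous_on {0..1} h" and mom: "\<And>k::nat. integral {0..1} (\<lambda>u. u ^ k * h u) = 0"
    and u: "u \<in> {0..1}"
  shows "h u = 0"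
proof -
  have ci: "(\<lambda>x. g x * h x) integrable_on {0..1}" if "continuous_on {0..1} g" for g :: "real \<Rightarrow> real"
    using that cont by (intro integrable_continuous_interval continuous_intros)
  have ortho: "integral {0..1} (\<lambda>x. g x * h x) = 0" if "real_polynomial_function g" for g
  proof -
    obtain a n where g: "g = (\<lambda>x. \<Sum>i\<le>n. a i * x ^ i)"
      using \<open>real_polynomial_function g\<close> unfolding real_polynomial_function_iff_sum by blast
    have "integral {0..1} (\<lambda>x. g x * h x) = integral {0..1} (\<lambda>x. \<Sum>i\<le>n. a i * (x ^ i * h x))"
      unfolding g by (simp add: sum_distrib_right mult.assoc)
    also have "\<dots> = (\<Sum>i\<le>n. integral {0..1} (\<lambda>x. a i * (x ^ i * h x)))"
      by (intro integral_sum integrable_on_mult_right ci continuous_intros) auto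
    also have "\<dots> = 0" using mom by simp
    finally show ?thesis .
  qed
  define B where "B = integral {0..1} (\<lambda>x. \<bar>h x\<bar>)"
  have "integral {0..1} (\<lambda>x. h x * h x) \<le> e * B" if "e > 0" for e
  proof -
    obtain g where g: "real_polynomial_function g" "\<And>x. x \<in> {0..1} \<Longrightarrow> \<bar>h x - g x\<bar> < e"
      using Stone_Weierstrass_real_polynomial_function[OF _ cont \<open>e > 0\<close>] by auto
    have cg: "continuous_on {0..1} g"
      using g(1) continuous_on_polymonial_function real_polynomial_function_eq by blast
    have "integral {0..1} (\<lambda>x. h x * h x) = integral {0..1} (\<lambda>x. (h x - g x) * h x) + integral {0..1} (\<lambda>x. g x * h x)"
    proof -
      have "(\<lambda>x. (h x - g x) * h x) integrable_on {0..1}" "(\<lambda>x. g x * h x) integrable_on {0..1}"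
        using cg cont by (auto intro!: ci continuous_on_diff)
      from integral_add[OF this] show ?thesis by (simp add: left_diff_distrib)
    qed
    also have "\<dots> = integral {0..1} (\<lambda>x. (h x - g x) * h x)" using ortho[OF g(1)] by simp
    also have "\<dots> \<le> integral {0..1} (\<lambda>x. e * \<bar>h x\<bar>)"
    proof (rule integral_le)
      fix x :: real assume x: "x \<in> {0..1}"
      have "(h x - g x) * h x \<le> \<bar>h x - g x\<bar> * \<bar>h x\<bar>" by (metis abs_ge_self abs_mult)
      also have "\<dots> \<le> e * \<bar>h x\<bar>" using g(2)[OF x] by (intro mult_right_mono) auto
      finally show "(h x - g x) * h x \<le> e * \<bar>h x\<bar>" .
    qed (use cg cont in \<open>auto intro!: ci integrable_continuous_interval continuous_intros\<close>)
    also have "\<dots> = e * B" by (simp add: B_def)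
    finally show ?thesis .
  qed
  then have "integral {0..1} (\<lambda>x. h x * h x) \<le> 0 + e" if "e > 0" for e
  proof -
    have "B \<ge> 0" unfolding B_def by (intro integral_nonneg integrable_continuous_interval continuous_intros cont) auto
    then have "e / (B + 1) * B \<le> e" using that by (simp add: field_simps)
    moreover have "integral {0..1} (\<lambda>x. h x * h x) \<le> e / (B + 1) * B"
      using that \<open>B \<ge> 0\<close> by (intro \<open>\<And>e. e > 0 \<Longrightarrow> integral {0..1} (\<lambda>x. h x * h x) \<le> e * B\<close>) auto
    ultimately show ?thesis by simp
  qed
  then have "integral {0..1} (\<lambda>x. h x * h x) \<le> 0" by (rule field_le_epsilon)
  moreover have "integral {0..1} (\<lambda>x. h x * h x) \<ge> 0"
    by (intro integral_nonneg ci cont) auto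
  ultimately have "integral {0..1} (\<lambda>x. h x * h x) = 0" by (rule antisym)
  moreover have "integral {0..1} (\<lambda>x. h x * h x) = 0 \<longleftrightarrow> (\<forall>x\<in>{0..1}. h x * h x = 0)"
    by (intro integral_eq_0_iff continuous_intros cont) auto
  ultimately have "h u * h u = 0" using u by blast
  then show ?thesis by (simp only: mult_eq_0_iff disj_absorb)
qed

lemma vanishing_moments:
  fixes h :: "real \<Rightarrow> complex"
  assumes cont: "continuous_on {0..1} h" and mom: "\<And>k::nat. ((\<lambda>u. of_real (u ^ k) * h u) has_integral 0) {0..1}"
    and u: "u \<in> {0..1}"
  shows "h u = 0"
proof -
  have "((\<lambda>u. u ^ k * Re (h u)) has_integral 0) {0..1}" "((\<lambda>u. u ^ k * Im (h u)) has_integral 0) {0..1}" for k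
    using has_integral_linear[OF mom[of k] bounded_linear_Re] has_integral_linear[OF mom[of k] bounded_linear_Im]
    by (simp_all add: o_def)
  then have "integral {0..1} (\<lambda>u. u ^ k * Re (h u)) = 0" "integral {0..1} (\<lambda>u. u ^ k * Im (h u)) = 0" for k
    by (blast intro: integral_unique)+
  then have "Re (h u) = 0" "Im (h u) = 0"
    using vanishing_moments_real[of "\<lambda>u. Re (h u)", OF _ _ u] vanishing_moments_real[of "\<lambda>u. Im (h u)", OF _ _ u] cont
    by (auto intro!: continuous_intros)
  then show ?thesis by (simp add: complex_eq_iff)
qed

text \<open>The Weierstrass M-test along the filter of finite subsets, so that one statement serves
  both sums over integers and sums over zeros.\<close>

lemma has_sum_integral_exchange:
  fixes c :: "'i \<Rightarrow> complex" and g :: "'i \<Rightarrow> real \<Rightarrow> complex"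
  assumes c: "(\<lambda>i. norm (c i)) summable_on I"
    and g: "\<And>i. i \<in> I \<Longrightarrow> continuous_on {a..b} (g i)"
    and bound: "\<And>i x. i \<in> I \<Longrightarrow> x \<in> {a..b} \<Longrightarrow> norm (g i x) \<le> B"
  defines "G \<equiv> \<lambda>x. infsum (\<lambda>i. c i * g i x) I"
  shows has_sum_pointwise: "x \<in> {a..b} \<Longrightarrow> ((\<lambda>i. c i * g i x) has_sum G x) I"
    and continuous_on_infsum: "continuous_on {a..b} G"
    and has_sum_integral: "((\<lambda>i. c i * integral {a..b} (g i)) has_sum integral {a..b} G) I"
proof -
  have cB: "(\<lambda>i. norm (c i) * B) summable_on I" by (rule summable_on_cmult_left[OF c])
  have le: "norm (c i * g i x) \<le> norm (c i) * B" if "i \<in> I" "x \<in> {a..b}" for i x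
    unfolding norm_mult using bound[OF that] by (intro mult_left_mono) auto
  have hs: "((\<lambda>i. c i * g i x) has_sum G x) I" if x: "x \<in> {a..b}" for x
  proof -
    have "(\<lambda>i. norm (c i * g i x)) summable_on I"
      by (rule summable_on_comparison_test[OF cB le[OF _ x]]) auto
    then have "(\<lambda>i. c i * g i x) summable_on I" by (rule abs_summable_summable)
    then show ?thesis unfolding G_def by (rule has_sum_infsum)
  qed
  then show "x \<in> {a..b} \<Longrightarrow> ((\<lambda>i. c i * g i x) has_sum G x) I" .
  have ul: "uniform_limit {a..b} (\<lambda>X x. \<Sum>i\<in>X. c i * g i x) G (finite_subsets_at_top I)"
    by (rule Weierstrass_m_test_general'[OF le hs cB])
  have ev: "\<forall>\<^sub>F X in finite_subsets_at_top I. continuous_on {a..b} (\<lambda>x. \<Sum>i\<in>X. c i * g i x)"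
    by (rule eventually_finite_subsets_at_top_weakI) (use g in \<open>auto intro!: continuous_intros\<close>)
  show cG: "continuous_on {a..b} G"
    by (rule uniform_limit_theorem[OF ev ul]) simp
  \<comment> \<open>\<open>uniform_limit_integral\<close> wants continuity for every
    \<open>X\<close>, not just eventually; setting \<open>F\<close> to 0 off the subsets of
    \<open>I\<close> provides it.\<close>
  define F where "F = (\<lambda>X x. if X \<subseteq> I then \<Sum>i\<in>X. c i * g i x else 0)"
  have "\<forall>\<^sub>F X in finite_subsets_at_top I. \<forall>x\<in>{a..b}. (\<Sum>i\<in>X. c i * g i x) = F X x"
    by (rule eventually_finite_subsets_at_top_weakI) (simp add: F_def)
  then have "uniform_limit {a..b} (\<lambda>X x. \<Sum>i\<in>X. c i * g i x) G (finite_subsets_at_top I) \<longleftrightarrow>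
      uniform_limit {a..b} F G (finite_subsets_at_top I)"
    by (rule uniform_limit_cong) simp
  with ul have "uniform_limit {a..b} F G (finite_subsets_at_top I)" by (simp only:)
  moreover have cF: "continuous_on {a..b} (F X)" for X
    unfolding F_def using g by (cases "X \<subseteq> I") (auto intro!: continuous_intros)
  ultimately obtain IF J where IF: "\<And>X. (F X has_integral IF X) {a..b}" "(G has_integral J) {a..b}"
      "(IF \<longlongrightarrow> J) (finite_subsets_at_top I)"
    by (rule uniform_limit_integral) auto
  have "\<forall>\<^sub>F X in finite_subsets_at_top I. IF X = (\<Sum>i\<in>X. c i * integral {a..b} (g i))"
  proof (rule eventually_finite_subsets_at_top_weakI)
    fix X assume X: "finite X" "X \<subseteq> I"
    have "((\<lambda>x. \<Sum>i\<in>X. c i * g i x) has_integral (\<Sum>i\<in>X. c i * integral {a..b} (g i))) {a..b}"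
      using X g by (intro has_integral_sum has_integral_mult_right integrable_integral integrable_continuous_interval) auto
    then have "(F X has_integral (\<Sum>i\<in>X. c i * integral {a..b} (g i))) {a..b}"
      using X by (simp add: F_def)
    then show "IF X = (\<Sum>i\<in>X. c i * integral {a..b} (g i))" using IF(1) has_integral_unique by blast
  qed
  then have "((\<lambda>X. \<Sum>i\<in>X. c i * integral {a..b} (g i)) \<longlongrightarrow> J) (finite_subsets_at_top I)"
    using IF(3) by (rule Lim_transform_eventually[rotated])
  then show "((\<lambda>i. c i * integral {a..b} (g i)) has_sum integral {a..b} G) I"
    using integral_unique[OF IF(2)] by (simp add: has_sum_def)
qed

lemma has_vector_derivative_powr:
  fixes a :: complex
  assumes "x > (0::real)"
  shows "((\<lambda>x. of_real x powr a) has_vector_derivative (a * of_real x powr (a - 1))) (at x within S)"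
proof -
  have "((\<lambda>z. z powr a) has_field_derivative a * of_real x powr (a - 1)) (at (of_real x))"
    by (rule has_field_derivative_powr) (use assms in simp)
  then show ?thesis by (rule has_vector_derivative_real_field)
qed

lemma has_integral_powr_01:
  assumes a: "Re a > 0"
  shows "((\<lambda>u. of_real u powr a) has_integral (1 / (a + 1))) {0..1}"
proof -
  have a1: "a + 1 \<noteq> 0" using a by (auto simp: complex_eq_iff)
  have "((\<lambda>u. of_real u powr a) has_integral (of_real 1 powr (a + 1) / (a + 1) - of_real 0 powr (a + 1) / (a + 1))) {0..1}"
  proof (rule fundamental_theorem_of_calculus_interior)
    show "continuous_on {0..1} (\<lambda>x. complex_of_real x powr (a + 1) / (a + 1))"
      using a a1 by (intro continuous_intros continuous_on_powr_complex) auto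
    fix x :: real assume "x \<in> {0<..<1}"
    then have "x > 0" by auto
    from has_vector_derivative_powr[OF this, of "a + 1" UNIV]
    have "((\<lambda>x. of_real x powr (a + 1) / (a + 1)) has_vector_derivative ((a + 1) * of_real x powr (a + 1 - 1)) / (a + 1)) (at x)"
      by (rule has_vector_derivative_divide)
    then show "((\<lambda>x. of_real x powr (a + 1) / (a + 1)) has_vector_derivative of_real x powr a) (at x)"
      using a1 by simp
  qed auto
  then show ?thesis by simp
qed

lemma has_integral_powr_1_X:
  fixes a :: complex
  assumes a: "a \<noteq> 0" and X: "X \<ge> 1"
  shows "((\<lambda>u. of_real u powr (a - 1)) has_integral ((of_real X powr a - 1) / a)) {1..X}"
proof -
  have "((\<lambda>u. of_real u powr (a - 1)) has_integral (of_real X powr a / a - of_real 1 powr a / a)) {1..X}"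
  proof (rule fundamental_theorem_of_calculus)
    fix x :: real assume "x \<in> {1..X}"
    then have "x > 0" by auto
    from has_vector_derivative_divide[OF has_vector_derivative_powr[OF this, of a "{1..X}"], of a]
    show "((\<lambda>x. of_real x powr a / a) has_vector_derivative of_real x powr (a - 1)) (at x within {1..X})"
      using a by simp
  qed (use X in auto)
  then show ?thesis by (simp add: diff_divide_distrib)
qed

lemma norm_powr_of_real: "x > 0 \<Longrightarrow> norm (of_real x powr a) = x powr Re a" for x :: real and a :: complex
  by (simp add: norm_powr_real_powr)

section \<open>Explicit formulas under the Riemann hypothesis\<close>

text \<open>Equals the integral of \<open>chebyshev_psi\<close> over [0, x]. Its continuity is what
  allows a pointwise formula to be deduced from moments.\<close>

definition psi1 :: "real \<Rightarrow> real" where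
  "psi1 x = (\<Sum>n | real n < x. mangoldt n * (x - real n))"

lemma finite_nat_less_real: "finite {n. real n < x}"
  by (rule finite_subset[of _ "{..nat \<lceil>x\<rceil>}"]) (auto simp: le_nat_iff ceiling_def less_imp_le intro: order.trans less_imp_le, linarith)

locale rh_zeros = entire_finite_order zeta_entire "3/2" C for C +
  assumes RH: riemann_hypothesis

text \<open>A zero at 0 would count as nontrivial and contradict the hypothesis, so the locale
  condition at 0 comes from the hypothesis itself.\<close>

lemma rh_zeros_exists:
  assumes riemann_hypothesis obtains C where "rh_zeros C"
proof -
  obtain C where C: "C \<ge> 0" "\<And>s. norm (zeta_entire s) \<le> exp (C * (norm s + 2) powr (3/2))"
    using zeta_entire_growth by blast
  have "zeta 0 \<noteq> 0"
  proof
    assume "zeta 0 = 0"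
    then have "0 \<in> nontrivial_zeta_zeros" by (simp add: nontrivial_zeta_zeros_def)
    then have "Re 0 = 1 / 2" using assms unfolding riemann_hypothesis_def by blast
    then show False by simp
  qed
  then have "zeta_entire 0 \<noteq> 0" by (simp add: zeta_entire_eq)
  then have "rh_zeros C"
    using C assms by unfold_locales (auto simp: holomorphic_zeta_entire)
  then show ?thesis by (rule that)
qed

context rh_zeros
begin

section \<open>Location of the zeros and the weighted partial fraction expansion\<close>

lemma Zeros_imp: "\<rho> \<in> Zeros \<Longrightarrow> \<rho> \<noteq> 1 \<and> zeta \<rho> = 0"
  using zeta_entire_1 by (auto simp: Zeros_def zeta_eq)

lemma in_Zeros_iff: "s \<noteq> 1 \<Longrightarrow> s \<in> Zeros \<longleftrightarrow> zeta s = 0"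
  by (simp add: Zeros_def zeta_entire_eq)

lemma nontrivial_subset: "nontrivial_zeta_zeros \<subseteq> Zeros"
  by (auto simp: nontrivial_zeta_zeros_def in_Zeros_iff)

text \<open>Nontrivial zeros are defined by exclusion, so the hypothesis alone sorts all zeros into
  the critical line and the negative even integers.\<close>

lemma Zeros_cases:
  assumes "\<rho> \<in> Zeros"
  obtains "\<rho> \<in> nontrivial_zeta_zeros" "Re \<rho> = 1/2" | n where "n \<ge> (1::nat)" "\<rho> = - 2 * of_nat n"
proof (cases "\<exists>n::nat. n \<ge> 1 \<and> \<rho> = - 2 * of_nat n")
  case True
  then show ?thesis using that by blast
next
  case False
  then have "\<rho> \<in> nontrivial_zeta_zeros"
    using Zeros_imp[OF assms] by (auto simp: nontrivial_zeta_zeros_def)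
  moreover from this have "Re \<rho> = 1/2" using RH by (auto simp: riemann_hypothesis_def)
  ultimately show ?thesis using that by blast
qed

lemma Re_Zeros: "\<rho> \<in> Zeros \<Longrightarrow> Re \<rho> \<le> 1/2"
  by (erule Zeros_cases) auto

text \<open>Makes 1/(\<rho> (\<rho> + 1)) comparable with 1/|\<rho>|^2. The factor 1/2 is the ratio
  at \<rho> = -2.\<close>

lemma norm_Zeros_add_1: assumes "\<rho> \<in> Zeros" shows "norm \<rho> / 2 \<le> norm (\<rho> + 1)" "norm \<rho> \<ge> 1/2"
  using assms
proof (atomize(full), cases rule: Zeros_cases)
  case 1
  have "(norm \<rho>)\<^sup>2 \<le> (norm (\<rho> + 1))\<^sup>2"
    unfolding cmod_power2 using 1 by (simp add: power2_eq_square algebra_simps)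
  then have "norm \<rho> \<le> norm (\<rho> + 1)" by (rule power2_le_imp_le) simp
  moreover have "1/2 \<le> norm \<rho>" using 1 complex_Re_le_cmod[of \<rho>] by simp
  ultimately show "norm \<rho> / 2 \<le> norm (\<rho> + 1) \<and> norm \<rho> \<ge> 1/2"
    using norm_ge_zero[of \<rho>] by linarith
next
  case (2 n)
  have "\<rho> + 1 = - of_real (2 * real n - 1)" using 2 by simp
  then have "norm (\<rho> + 1) = 2 * real n - 1" using 2(1) unfolding norm_minus_cancel \<open>\<rho> + 1 = _\<close> norm_of_real by simp
  moreover have "norm \<rho> = 2 * real n" using 2 by (simp add: norm_mult)
  ultimately show "norm \<rho> / 2 \<le> norm (\<rho> + 1) \<and> norm \<rho> \<ge> 1/2" using 2 by simp
qed

lemma Zeros_ne: assumes "\<rho> \<in> Zeros" shows "\<rho> \<noteq> 0" "\<rho> + 1 \<noteq> 0" "\<rho> \<noteq> -1"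
  using norm_Zeros_add_1[OF assms] by auto

text \<open>Minus the coefficient of x^(\<rho> + 1) in \<open>psi1\<close>; the denominator is s (s
  + 1) at s = \<rho>.\<close>

definition wt :: "complex \<Rightarrow> complex" where "wt \<rho> = of_real (zmult \<rho>) / (\<rho> * (\<rho> + 1))"

lemma norm_wt_le: assumes "\<rho> \<in> Zeros" shows "norm (wt \<rho>) \<le> 2 * (zmult \<rho> / (norm \<rho>)\<^sup>2)"
proof -
  have "norm (wt \<rho>) \<le> zmult \<rho> / (norm \<rho> * (norm \<rho> / 2))"
    using norm_Zeros_add_1[OF assms] unfolding wt_def norm_divide norm_mult norm_of_real
    by (simp only: abs_of_nonneg zmult_nonneg) (intro divide_left_mono mult_left_mono mult_pos_pos, auto)
  then show ?thesis by (simp add: power2_eq_square mult.commute)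
qed

lemma wt_summable: "(\<lambda>\<rho>. norm (wt \<rho>)) summable_on Zeros"
  by (rule abs_summable_zero_sum) (rule norm_wt_le)

definition wt_sum :: complex where "wt_sum = infsum wt Zeros"

definition W :: "complex \<Rightarrow> complex" where "W s = infsum (\<lambda>\<rho>. wt \<rho> / (s - \<rho>)) Zeros"

definition b0 :: complex where "b0 = deriv zeta_entire 0 / zeta_entire 0"

text \<open>By \<open>zeta_logderiv\<close>, \<open>c1\<close> is - zeta'/zeta(0) and
  \<open>c0\<close> is zeta'/zeta(-1). These are the residues of - zeta'/zeta(s) / (s (s + 1)) at 0
  and -1, which become the coefficients of x and 1 in \<open>psi1\<close>.\<close>

definition c1 :: complex where "c1 = - 1 - b0"

definition c0 :: complex where "c0 = 1/2 + b0 + wt_sum"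

lemma wt_has_sum: "(wt has_sum wt_sum) Zeros"
  unfolding wt_sum_def by (rule has_sum_infsum[OF abs_summable_summable[OF wt_summable]])

lemma W_has_sum: "((\<lambda>\<rho>. wt \<rho> / (s - \<rho>)) has_sum W s) Zeros"
proof -
  have "(\<lambda>\<rho>. norm (wt \<rho> / (s - \<rho>))) summable_on Zeros"
  proof (rule abs_summable_zero_sum[where R = "norm s + 1"])
    fix \<rho> assume \<rho>: "\<rho> \<in> Zeros" "norm \<rho> \<ge> norm s + 1"
    have "1 \<le> norm (s - \<rho>)" using \<rho>(2) norm_triangle_ineq2[of \<rho> s] by (simp add: norm_minus_commute)
    then have "norm (wt \<rho> / (s - \<rho>)) \<le> norm (wt \<rho>) / 1"
      unfolding norm_divide by (intro divide_left_mono) auto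
    then show "norm (wt \<rho> / (s - \<rho>)) \<le> 2 * (zmult \<rho> / (norm \<rho>)\<^sup>2)" using norm_wt_le[OF \<rho>(1)] by simp
  qed
  from has_sum_infsum[OF abs_summable_summable[OF this]] show ?thesis unfolding W_def .
qed

text \<open>Each summand s/(\<rho> (s - \<rho>)) is rewritten as s (s + 1)
  \<open>wt \<rho>\<close>/(s - \<rho>) - s \<open>wt \<rho>\<close>, so that division by s (s + 1)
  leaves simple fractions with summable weights.\<close>

lemma zeta_entire_logderiv:
  assumes s: "s \<notin> Zeros"
  shows "deriv zeta_entire s / zeta_entire s = b0 + s * (s + 1) * W s - s * wt_sum"
proof -
  have "((\<lambda>\<rho>. s * (s + 1) * (wt \<rho> / (s - \<rho>)) - s * wt \<rho>) has_sum (s * (s + 1) * W s - s * wt_sum)) Zeros"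
    using has_sum_add[OF has_sum_cmult_right[OF W_has_sum, of "s * (s + 1)"] has_sum_cmult_right[OF wt_has_sum, of "- s"]]
    by (simp add: mult.assoc)
  moreover have "s * (s + 1) * (wt \<rho> / (s - \<rho>)) - s * wt \<rho> = of_real (zmult \<rho>) * s / (\<rho> * (s - \<rho>))" if "\<rho> \<in> Zeros" for \<rho>
  proof -
    have ne: "\<rho> \<noteq> 0" "\<rho> + 1 \<noteq> 0" "s - \<rho> \<noteq> 0" using Zeros_ne[OF that] s that by auto
    have "s * (s + 1) * (wt \<rho> / (s - \<rho>)) - s * wt \<rho> = s * wt \<rho> * ((s + 1) / (s - \<rho>) - 1)"
      by (simp add: algebra_simps)
    also have "(s + 1) / (s - \<rho>) - 1 = (\<rho> + 1) / (s - \<rho>)" using ne by (simp add: field_simps)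
    also have "s * wt \<rho> * ((\<rho> + 1) / (s - \<rho>)) = of_real (zmult \<rho>) * s / (\<rho> * (s - \<rho>))"
      using ne by (simp add: wt_def)
    finally show ?thesis .
  qed
  ultimately have "((\<lambda>\<rho>. of_real (zmult \<rho>) * s / (\<rho> * (s - \<rho>))) has_sum (s * (s + 1) * W s - s * wt_sum)) Zeros"
    using has_sum_cong[of Zeros "\<lambda>\<rho>. s * (s + 1) * (wt \<rho> / (s - \<rho>)) - s * wt \<rho>" "\<lambda>\<rho>. of_real (zmult \<rho>) * s / (\<rho> * (s - \<rho>))"]
    by blast
  moreover have "((\<lambda>\<rho>. of_real (zmult \<rho>) * s / (\<rho> * (s - \<rho>))) has_sum (deriv zeta_entire s / zeta_entire s - b0)) Zeros"
    unfolding b0_def by (rule logderiv_has_sum) (use s in \<open>simp add: Zeros_def\<close>)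
  ultimately have "s * (s + 1) * W s - s * wt_sum = deriv zeta_entire s / zeta_entire s - b0"
    by (rule has_sum_unique)
  then show ?thesis by (simp add: algebra_simps)
qed

lemma zeta_logderiv:
  assumes s: "s \<notin> Zeros" "s \<noteq> 1"
  shows "deriv zeta s / zeta s = b0 + s * (s + 1) * W s - s * wt_sum - 1 / (s - 1)"
proof -
  have z: "zeta s \<noteq> 0" using s by (simp add: in_Zeros_iff)
  have "(zeta has_field_derivative deriv zeta s) (at s)"
    by (rule holomorphic_derivI[OF holomorphic_zeta]) (use s in auto)
  then have "((\<lambda>s. (s - 1) * zeta s) has_field_derivative (s - 1) * deriv zeta s + zeta s) (at s)"
    by (auto intro!: derivative_eq_intros)
  then have "(zeta_entire has_field_derivative (s - 1) * deriv zeta s + zeta s) (at s)"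
    by (rule has_field_derivative_transform_within_open[where S = "- {1}"]) (use s in \<open>auto simp: zeta_entire_eq\<close>)
  then have "deriv zeta_entire s / zeta_entire s = deriv zeta s / zeta s + 1 / (s - 1)"
    using s z by (simp add: DERIV_imp_deriv zeta_entire_eq add_divide_distrib)
  then show ?thesis using zeta_entire_logderiv[OF s(1)] by (simp add: algebra_simps)
qed

lemma deriv_prime_zeta_log_eq:
  assumes s: "Re s > 1"
  shows "deriv prime_zeta_log s = deriv zeta s / zeta s"
proof -
  obtain c where c: "c > 0" "\<And>s. Re s > 1 \<Longrightarrow> dir_zeta s = of_real c * exp (prime_zeta_log s)"
    using dir_zeta_eq_exp by blast
  have "dir_zeta s \<noteq> 0" using c(1) c(2)[OF s] by simp
  moreover have "(zeta has_field_derivative deriv dir_zeta s) (at s)"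
    by (rule has_field_derivative_transform_within_open[OF dir_zeta_has_field_derivative[OF s] open_halfspace_Re_gt[of 1]])
       (use s in \<open>auto simp: zeta_eq_dir_zeta\<close>)
  then have "deriv zeta s = deriv dir_zeta s" by (rule DERIV_imp_deriv)
  ultimately show ?thesis using deriv_dir_zeta[OF s] zeta_eq_dir_zeta[OF s] by simp
qed

lemma Re_gt_not_Zeros: "Re s > 1/2 \<Longrightarrow> s \<notin> Zeros"
  using Re_Zeros[of s] by auto

text \<open>The substitution \<open>u = 1 / x\<close> turns Mellin transforms over \<open>[1, \<infinity>)\<close> into moments over \<open>[0,1]\<close>:
  \<open>Q u = u ^ 4 * psi1 (1 / u)\<close>, the extra powers of \<open>u\<close> securing continuity at \<open>0\<close>.\<close>

definition Q :: "real \<Rightarrow> complex" where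
  "Q u = infsum (\<lambda>n. of_real (mangoldt n / real n ^ 3) * of_real ((real n * u) ^ 3 * max (1 - real n * u) 0)) {1..}"

text \<open>The integrand vanishes beyond 1/n. The cube is paired with the 1/n^3 in
  \<open>Q\<close>: the tents stay bounded by 1 on [0, 1], while the coefficients \<Lambda>(n)/n^3
  are summable.\<close>

lemma tent_has_integral:
  assumes n: "n \<ge> (1::nat)"
  shows "((\<lambda>u. u ^ k * ((real n * u) ^ 3 * max (1 - real n * u) 0)) has_integral
     (real n ^ 3 / (real n ^ (k + 4) * (real (k + 4) * real (k + 5))))) {0..1}"
proof -
  let ?N = "real n"
  have N: "?N > 0" using n by simp
  let ?F = "\<lambda>u::real. ?N ^ 3 * (u ^ (k + 4) / real (k + 4) - ?N * (u ^ (k + 5) / real (k + 5)))"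
  have "((\<lambda>u. u ^ k * ((?N * u) ^ 3 * (1 - ?N * u))) has_integral (?F (1 / ?N) - ?F 0)) {0..1/?N}"
  proof (rule fundamental_theorem_of_calculus)
    fix x :: real
    have d: "((\<lambda>u. u ^ (m + 1) / real (m + 1)) has_real_derivative x ^ m) (at x within {0..1/?N})" for m
      using DERIV_cdivide[OF DERIV_subset[OF DERIV_pow[of "m + 1" x] subset_UNIV], of "real (m + 1)"] by simp
    have e: "k + 3 + 1 = k + 4" "k + 4 + 1 = k + 5" by simp_all
    have "(?F has_real_derivative ?N ^ 3 * (x ^ (k + 3) - ?N * x ^ (k + 4))) (at x within {0..1/?N})"
      using DERIV_cmult[OF DERIV_diff[OF d[of "k + 3"] DERIV_cmult[OF d[of "k + 4"]]]] unfolding e .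
    moreover have "?N ^ 3 * (x ^ (k + 3) - ?N * x ^ (k + 4)) = x ^ k * ((?N * x) ^ 3 * (1 - ?N * x))"
      by (simp add: power_add eval_nat_numeral algebra_simps)
    ultimately show "(?F has_vector_derivative x ^ k * ((?N * x) ^ 3 * (1 - ?N * x))) (at x within {0..1/?N})"
      by (simp add: has_real_derivative_iff_has_vector_derivative)
  qed simp
  then have 1: "((\<lambda>u. u ^ k * ((?N * u) ^ 3 * max (1 - ?N * u) 0)) has_integral (?F (1 / ?N) - ?F 0)) {0..1/?N}"
    by (rule has_integral_eq[rotated]) (use N in \<open>auto simp: field_simps max_def\<close>)
  have "((\<lambda>u. 0) has_integral 0) {1/?N..1}" by (rule has_integral_0)
  then have 2: "((\<lambda>u. u ^ k * ((?N * u) ^ 3 * max (1 - ?N * u) 0)) has_integral 0) {1/?N..1}"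
    by (rule has_integral_eq[rotated]) (use N in \<open>auto simp: field_simps max_def\<close>)
  have "?F (1 / ?N) - ?F 0 = ?N ^ 3 / (?N ^ (k + 4)) * (1 / real (k + 4) - 1 / real (k + 5))"
    using N by (simp add: power_divide power_add field_simps eval_nat_numeral del: of_nat_add of_nat_Suc)
  also have "1 / real (k + 4) - 1 / real (k + 5) = 1 / (real (k + 4) * real (k + 5))"
    by (simp add: field_simps)
  finally have F: "?F (1 / ?N) - ?F 0 = ?N ^ 3 / (?N ^ (k + 4) * (real (k + 4) * real (k + 5)))" by simp
  have "1 / ?N \<le> 1" using n by simp
  from has_integral_combine[OF _ this 1 2] N F show ?thesis by simp
qed

lemma mangoldt_cube_summable: "(\<lambda>n. norm (complex_of_real (mangoldt n / real n ^ 3))) summable_on {1..}"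
proof -
  have "summable (\<lambda>n. norm (mangoldt (Suc n) / of_nat (Suc n) powr 3 :: complex))"
    by (rule mangoldt_dirichlet_summable) simp
  moreover have "complex_of_nat (Suc n) powr 3 = of_real (real (Suc n) ^ 3)" for n
    by (simp add: powr_nat)
  ultimately have "summable (\<lambda>n. norm (complex_of_real (mangoldt (Suc n) / real (Suc n) ^ 3)))"
    by (simp del: of_nat_Suc)
  then show ?thesis by (rule abs_summable_imp_has_sum_nat(2))
qed

lemma tent_bound:
  assumes "u \<in> {0..1}"
  shows "norm (complex_of_real (u ^ k * ((real n * u) ^ 3 * max (1 - real n * u) 0))) \<le> 1"
proof (cases "real n * u \<le> 1")
  case True
  have "u ^ k \<le> 1" "(real n * u) ^ 3 \<le> 1" using True assms by (auto intro!: power_le_one)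
  moreover have "max (1 - real n * u) 0 \<le> 1" using assms by auto
  ultimately have "u ^ k * ((real n * u) ^ 3 * max (1 - real n * u) 0) \<le> 1 * (1 * 1)"
    using assms by (intro mult_mono) auto
  then show ?thesis using assms unfolding norm_of_real by (subst abs_of_nonneg) auto
qed simp

text \<open>With x = 1/u the k-th moment is the integral of psi1(x) x^(-s-2) at s = k + 4, that is,
  - zeta'/zeta(s) / (s (s + 1)). Hence only integer points, all in the half-plane of absolute
  convergence, are ever compared.\<close>

lemma Q_moment:
  shows "((\<lambda>u. of_real (u ^ k) * Q u) has_integral
     (- deriv prime_zeta_log (of_nat (k + 4)) / (of_nat (k + 4) * of_nat (k + 5)))) {0..1}"
    and "continuous_on {0..1} Q"
proof -
  let ?c = "\<lambda>n. complex_of_real (mangoldt n / real n ^ 3)"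
  let ?g = "\<lambda>k n u. complex_of_real (u ^ k * ((real n * u) ^ 3 * max (1 - real n * u) 0))"
  have cg: "continuous_on {0..1} (?g k n)" for k n by (intro continuous_intros)
  note E = has_sum_integral_exchange[where c = ?c and I = "{1..}" and a = 0 and b = 1 and B = 1, OF mangoldt_cube_summable]
  note E0 = E[where g = "?g 0", OF cg tent_bound] and Ek = E[where g = "?g k", OF cg tent_bound]
  have Q0: "Q = (\<lambda>x. infsum (\<lambda>n. ?c n * ?g 0 n x) {1..})" by (simp add: Q_def[abs_def])
  have Qk: "(\<lambda>x. of_real (x ^ k) * Q x) = (\<lambda>x. infsum (\<lambda>n. ?c n * ?g k n x) {1..})" for k
    unfolding Q_def infsum_cmult_right'[symmetric] by (simp add: mult_ac)
  show cQ: "continuous_on {0..1} Q" unfolding Q0 by (rule E0(2))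
  let ?s = "complex_of_nat (k + 4)"
  have intg: "integral {0..1} (?g k n) = of_real (real n ^ 3 / (real n ^ (k + 4) * (real (k + 4) * real (k + 5))))"
    if "n \<ge> 1" for n
    using has_integral_of_real[OF tent_has_integral[OF that, of k]] by (rule integral_unique)
  have hs: "((\<lambda>n. ?c n * integral {0..1} (?g k n)) has_sum integral {0..1} (\<lambda>x. of_real (x ^ k) * Q x)) {1..}"
    unfolding Qk by (rule Ek(3))
  have "Re ?s > 1" by simp
  note S = deriv_prime_zeta_log_sums[OF this] abs_summable_imp_has_sum_nat(1)[OF mangoldt_dirichlet_summable[OF this]]
  have "(\<Sum>n. mangoldt (Suc n) / of_nat (Suc n) powr ?s) = - deriv prime_zeta_log ?s"
    using sums_minus[OF S(1)] by (simp add: sums_iff)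
  with S(2) have "((\<lambda>n. mangoldt n / of_nat n powr ?s) has_sum (- deriv prime_zeta_log ?s)) {1..}" by simp
  from has_sum_cmult_left[OF this, of "1 / (?s * of_nat (k + 5))"]
  have "((\<lambda>n. mangoldt n / of_nat n powr ?s * (1 / (?s * of_nat (k + 5)))) has_sum
     (- deriv prime_zeta_log ?s / (?s * of_nat (k + 5)))) {1..}" by simp
  moreover have "mangoldt n / of_nat n powr ?s * (1 / (?s * of_nat (k + 5))) = ?c n * integral {0..1} (?g k n)" if "n \<in> {1..}" for n
  proof -
    have "complex_of_nat n powr ?s = of_real (real n ^ (k + 4))"
      using that powr_nat[of "of_nat n" "k + 4"] by simp
    then show ?thesis using that intg[of n] by (simp add: field_simps del: of_nat_add)
  qed
  ultimately have "((\<lambda>n. ?c n * integral {0..1} (?g k n)) has_sum (- deriv prime_zeta_log ?s / (?s * of_nat (k + 5)))) {1..}"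
    using has_sum_cong[of "{1..}" "\<lambda>n. mangoldt n / of_nat n powr ?s * (1 / (?s * of_nat (k + 5)))" "\<lambda>n. ?c n * integral {0..1} (?g k n)"]
    by blast
  with hs have "integral {0..1} (\<lambda>x. of_real (x ^ k) * Q x) = - deriv prime_zeta_log ?s / (?s * of_nat (k + 5))"
    by (rule has_sum_unique)
  moreover have "(\<lambda>x. of_real (x ^ k) * Q x) integrable_on {0..1}"
    by (intro integrable_continuous_interval continuous_intros cQ)
  ultimately show "((\<lambda>u. of_real (u ^ k) * Q u) has_integral
     (- deriv prime_zeta_log (of_nat (k + 4)) / (of_nat (k + 4) * of_nat (k + 5)))) {0..1}"
    by (simp add: has_integral_iff)
qed

text \<open>The zero sum in the normalisation of \<open>Q\<close>: u^4 times the sum of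
  \<open>wt \<rho>\<close> x^(\<rho> + 1) at x = 1/u. Its k-th moment is \<open>W\<close> at k +
  4.\<close>

definition Rz :: "real \<Rightarrow> complex" where
  "Rz u = infsum (\<lambda>\<rho>. wt \<rho> * of_real u powr (3 - \<rho>)) Zeros"

lemma Rz_moment:
  shows "((\<lambda>u. of_real (u ^ k) * Rz u) has_integral W (of_nat (k + 4))) {0..1}"
    and "continuous_on {0..1} Rz"
proof -
  let ?g = "\<lambda>k \<rho> u. complex_of_real (u ^ k) * of_real u powr (3 - \<rho>)"
  have cg: "continuous_on {0..1} (?g k \<rho>)" if "\<rho> \<in> Zeros" for k \<rho>
    using Re_Zeros[OF that] by (intro continuous_intros continuous_on_powr_complex) auto
  have bd: "norm (?g k \<rho> u) \<le> 1" if "\<rho> \<in> Zeros" "u \<in> {0..1}" for k \<rho> u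
  proof (cases "u = 0")
    case False
    then have u: "u > 0" "u \<le> 1" using that by auto
    have "norm (?g k \<rho> u) = u ^ k * u powr Re (3 - \<rho>)"
      using norm_powr_of_real[OF u(1), of "3 - \<rho>"] u by (simp add: norm_mult norm_power)
    also have "\<dots> \<le> 1 * 1" using u Re_Zeros[OF that(1)]
      by (intro mult_mono power_le_one powr_le1) auto
    finally show ?thesis by simp
  qed simp
  note E = has_sum_integral_exchange[where c = wt and I = Zeros and a = 0 and b = 1 and B = 1, OF wt_summable]
  note E0 = E[where g = "?g 0", OF cg bd] and Ek = E[where g = "?g k", OF cg bd]
  have R0: "Rz = (\<lambda>x. infsum (\<lambda>\<rho>. wt \<rho> * ?g 0 \<rho> x) Zeros)" by (simp add: Rz_def[abs_def])
  have Rk: "(\<lambda>x. of_real (x ^ k) * Rz x) = (\<lambda>x. infsum (\<lambda>\<rho>. wt \<rho> * ?g k \<rho> x) Zeros)" for k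
    unfolding Rz_def infsum_cmult_right'[symmetric] by (simp add: mult_ac)
  show cR: "continuous_on {0..1} Rz" unfolding R0 by (rule E0(2))
  have "integral {0..1} (?g k \<rho>) = 1 / (of_nat (k + 4) - \<rho>)" if "\<rho> \<in> Zeros" for \<rho>
  proof -
    have "((\<lambda>u. of_real u powr (of_nat (k + 3) - \<rho>)) has_integral (1 / (of_nat (k + 3) - \<rho> + 1))) {0..1}"
      by (rule has_integral_powr_01) (use Re_Zeros[OF that] in simp)
    then have "(?g k \<rho> has_integral (1 / (of_nat (k + 3) - \<rho> + 1))) {0..1}"
    proof (rule has_integral_eq[rotated])
      fix u :: real assume u: "u \<in> {0..1}"
      show "of_real u powr (of_nat (k + 3) - \<rho>) = ?g k \<rho> u"
      proof (cases "u = 0")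
        case False
        then have "of_real u powr (of_nat (k + 3) - \<rho>) = complex_of_real u powr (of_nat k) * of_real u powr (3 - \<rho>)"
          unfolding powr_add[symmetric] by (simp add: add_diff_eq)
        then show ?thesis using False by (simp add: powr_nat del: of_nat_add)
      qed simp
    qed
    then have "integral {0..1} (?g k \<rho>) = 1 / (of_nat (k + 3) - \<rho> + 1)" by (rule integral_unique)
    then show ?thesis by (simp add: algebra_simps)
  qed
  then have "wt \<rho> / (of_nat (k + 4) - \<rho>) = wt \<rho> * integral {0..1} (?g k \<rho>)" if "\<rho> \<in> Zeros" for \<rho>
    using that by simp
  then have "((\<lambda>\<rho>. wt \<rho> * integral {0..1} (?g k \<rho>)) has_sum W (of_nat (k + 4))) Zeros"
    using has_sum_cong[of Zeros "\<lambda>\<rho>. wt \<rho> / (of_nat (k + 4) - \<rho>)" "\<lambda>\<rho>. wt \<rho> * integral {0..1} (?g k \<rho>)"] W_has_sum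
    by blast
  moreover have "((\<lambda>\<rho>. wt \<rho> * integral {0..1} (?g k \<rho>)) has_sum integral {0..1} (\<lambda>x. of_real (x ^ k) * Rz x)) Zeros"
    unfolding Rk by (rule Ek(3))
  ultimately have "integral {0..1} (\<lambda>x. of_real (x ^ k) * Rz x) = W (of_nat (k + 4))"
    using has_sum_unique by blast
  moreover have "(\<lambda>x. of_real (x ^ k) * Rz x) integrable_on {0..1}"
    by (intro integrable_continuous_interval continuous_intros cR)
  ultimately show "((\<lambda>u. of_real (u ^ k) * Rz u) has_integral W (of_nat (k + 4))) {0..1}"
    by (simp add: has_integral_iff)
qed

text \<open>Dividing \<open>zeta_logderiv\<close> at s = k + 4 by s (s + 1) and splitting into
  partial fractions at 1, 0 and -1 matches every moment of the two sides.\<close>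

lemma Q_explicit:
  assumes u: "u \<in> {0..1}"
  shows "Q u = of_real (u\<^sup>2) / 2 + c1 * of_real (u ^ 3) + c0 * of_real (u ^ 4) - Rz u"
proof -
  define h where "h = (\<lambda>u. Q u - (of_real (u\<^sup>2) / 2 + c1 * of_real (u ^ 3) + c0 * of_real (u ^ 4) - Rz u))"
  have "h u = 0"
  proof (rule vanishing_moments[OF _ _ u])
    show "continuous_on {0..1} h" unfolding h_def
      by (intro continuous_intros Q_moment(2) Rz_moment(2)) auto
    fix k :: nat
    let ?s = "complex_of_nat (k + 4)"
    have pw: "((\<lambda>u. complex_of_real (u ^ m)) has_integral (1 / of_nat (m + 1))) {0..1}" for m
    proof -
      have "((\<lambda>u::real. u ^ m) has_integral (1 ^ (m + 1) / real (m + 1) - 0 ^ (m + 1) / real (m + 1))) {0..1}"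
      proof (rule fundamental_theorem_of_calculus)
        show "((\<lambda>u. u ^ (m + 1) / real (m + 1)) has_vector_derivative x ^ m) (at x within {0..1})" for x
          using DERIV_cdivide[OF DERIV_subset[OF DERIV_pow[of "m + 1" x] subset_UNIV], of "real (m + 1)"]
          by (simp add: has_real_derivative_iff_has_vector_derivative)
      qed simp
      then have "((\<lambda>u::real. u ^ m) has_integral (1 / real (m + 1))) {0..1}" by simp
      from has_integral_of_real[OF this, where 'b=complex] show ?thesis
        by (simp only: of_real_divide of_real_1 of_real_of_nat_eq)
    qed
    have "((\<lambda>u. of_real (u ^ k) * Q u - (1/2 * of_real (u ^ (k + 2)) + c1 * of_real (u ^ (k + 3)) + c0 * of_real (u ^ (k + 4))
          - of_real (u ^ k) * Rz u)) has_integral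
       (- deriv prime_zeta_log ?s / (?s * of_nat (k + 5)) -
         (1/2 * (1 / of_nat (k + 2 + 1)) + c1 * (1 / of_nat (k + 3 + 1)) + c0 * (1 / of_nat (k + 4 + 1)) - W ?s))) {0..1}"
      by (rule has_integral_diff has_integral_add has_integral_mult_right Q_moment(1) Rz_moment(1) pw)+
    moreover have "of_real (u ^ k) * Q u - (1/2 * of_real (u ^ (k + 2)) + c1 * of_real (u ^ (k + 3)) + c0 * of_real (u ^ (k + 4))
          - of_real (u ^ k) * Rz u) = of_real (u ^ k) * h u" for u
      by (simp add: h_def power_add power2_eq_square algebra_simps)
    moreover have "- deriv prime_zeta_log ?s / (?s * of_nat (k + 5)) -
         (1/2 * (1 / of_nat (k + 2 + 1)) + c1 * (1 / of_nat (k + 3 + 1)) + c0 * (1 / of_nat (k + 4 + 1)) - W ?s) = 0"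
    proof -
      have s: "Re ?s > 1" "?s \<noteq> 1" by (simp_all add: complex_eq_iff)
      have "?s \<notin> Zeros" by (rule Re_gt_not_Zeros) simp
      from deriv_prime_zeta_log_eq[OF s(1)] zeta_logderiv[OF this s(2)]
      have D: "deriv prime_zeta_log ?s = b0 + ?s * (?s + 1) * W ?s - ?s * wt_sum - 1 / (?s - 1)" by simp
      have e: "complex_of_nat (k + 2 + 1) = ?s - 1" "complex_of_nat (k + 3 + 1) = ?s" "complex_of_nat (k + 4 + 1) = ?s + 1"
         "complex_of_nat (k + 5) = ?s + 1" by simp_all
      have ne: "?s \<noteq> 0" "?s + 1 \<noteq> 0" "?s - 1 \<noteq> 0" by (simp_all add: complex_eq_iff)
      define z where "z = ?s"
      have "z + 1 \<noteq> 0" using ne(2) by (simp only: z_def not_False_eq_True)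
      then have "2 * (z + 1) \<noteq> 0" by (simp only: mult_eq_0_iff) simp
      then have "2 + z * 2 \<noteq> 0" by (simp add: algebra_simps)
      then show ?thesis unfolding D e c1_def c0_def using ne unfolding z_def[symmetric]
        by (simp add: divide_simps) (simp add: algebra_simps)
    qed
    ultimately show "((\<lambda>u. of_real (u ^ k) * h u) has_integral 0) {0..1}" by (simp only:)
  qed
  then show ?thesis by (simp add: h_def)
qed

lemma psi1_explicit:
  assumes x: "x \<ge> 1"
  shows "((\<lambda>\<rho>. wt \<rho> * of_real x powr (\<rho> + 1)) has_sum
           (of_real (x\<^sup>2) / 2 + c1 * of_real x + c0 - of_real (psi1 x))) Zeros"
proof -
  let ?u = "1 / x"
  have x0: "x > 0" and u: "?u \<in> {0..1}" using x by auto
  have Qx: "of_real (x ^ 4) * Q ?u = of_real (psi1 x)"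
  proof -
    let ?F = "\<lambda>n. complex_of_real (mangoldt n / real n ^ 3) * of_real ((real n * ?u) ^ 3 * max (1 - real n * ?u) 0)"
    have "Q ?u = (\<Sum>\<^sub>\<infinity>n\<in>{n. real n < x} - {0}. ?F n)" unfolding Q_def
      using x0 by (intro infsum_cong_neutral) (auto simp: max_def field_simps)
    also have "\<dots> = (\<Sum>n\<in>{n. real n < x} - {0}. ?F n)"
      by (rule infsum_finite) (simp add: finite_nat_less_real)
    also have "of_real (x ^ 4) * \<dots> = (\<Sum>n\<in>{n. real n < x} - {0}. of_real (mangoldt n * (x - real n)))"
      unfolding sum_distrib_left
    proof (rule sum.cong)
      fix n assume n: "n \<in> {n. real n < x} - {0}"
      then have "max (1 - real n * ?u) 0 = 1 - real n * ?u" using x0 by (simp add: max_def field_simps)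
      moreover have "x ^ 4 * (mangoldt n / real n ^ 3 * ((real n * ?u) ^ 3 * (1 - real n * ?u))) = mangoldt n * (x - real n)"
        using n x0 by (simp add: power_mult_distrib power_divide field_simps eval_nat_numeral)
      ultimately show "complex_of_real (x ^ 4) * ?F n = of_real (mangoldt n * (x - real n))"
        by (simp only: of_real_mult[symmetric])
    qed simp
    also have "\<dots> = of_real (psi1 x)" unfolding psi1_def of_real_sum
      by (rule sum.mono_neutral_left) (auto simp: finite_nat_less_real)
    finally show ?thesis .
  qed
  have "((\<lambda>\<rho>. wt \<rho> * (of_real ?u powr (3 - \<rho>))) has_sum Rz ?u) Zeros"
  proof -
    have bd: "norm (of_real ?u powr (3 - \<rho>)) \<le> 1" if "\<rho> \<in> Zeros" for \<rho>
    proof -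
      have "norm (of_real ?u powr (3 - \<rho>)) = ?u powr Re (3 - \<rho>)" by (rule norm_powr_of_real) (use x0 in simp)
      also have "\<dots> \<le> 1" using u Re_Zeros[OF that] by (intro powr_le1) auto
      finally show ?thesis .
    qed
    have "(\<lambda>\<rho>. norm (wt \<rho> * (of_real ?u powr (3 - \<rho>)))) summable_on Zeros"
    proof (rule summable_on_comparison_test[OF wt_summable])
      fix \<rho> assume "\<rho> \<in> Zeros"
      from mult_left_mono[OF bd[OF this], of "norm (wt \<rho>)"]
      show "norm (wt \<rho> * (of_real ?u powr (3 - \<rho>))) \<le> norm (wt \<rho>)" by (simp only: norm_mult mult_1_right norm_ge_zero)
    qed auto
    from has_sum_infsum[OF abs_summable_summable[OF this]] show ?thesis unfolding Rz_def .
  qed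
  from has_sum_cmult_right[OF this, of "of_real (x ^ 4)"]
  have "((\<lambda>\<rho>. of_real (x ^ 4) * (wt \<rho> * (of_real ?u powr (3 - \<rho>)))) has_sum of_real (x ^ 4) * Rz ?u) Zeros" .
  moreover have "of_real (x ^ 4) * (wt \<rho> * (of_real ?u powr (3 - \<rho>))) = wt \<rho> * of_real x powr (\<rho> + 1)" for \<rho>
  proof -
    have "of_real ?u powr (3 - \<rho>) = exp ((3 - \<rho>) * of_real (ln ?u))"
      using x0 Ln_of_real[of ?u] by (simp add: powr_def del: of_real_divide)
    also have "\<dots> = exp ((\<rho> - 3) * of_real (ln x))" using x0 by (simp add: ln_div algebra_simps)
    also have "\<dots> = of_real x powr (\<rho> - 3)" using x0 by (simp add: powr_def Ln_of_real)
    finally have "of_real ?u powr (3 - \<rho>) = of_real x powr (\<rho> - 3)" .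
    moreover have "complex_of_real (x ^ 4) = of_real x powr (of_nat 4)" using x0 by (subst powr_nat) auto
    then have "complex_of_real (x ^ 4) * of_real x powr (\<rho> - 3) = of_real x powr (\<rho> + 1)"
      by (simp only: powr_add[symmetric]) (simp add: algebra_simps)
    ultimately show ?thesis by (metis mult.left_commute)
  qed
  moreover have "of_real (x ^ 4) * Rz ?u = of_real (x\<^sup>2) / 2 + c1 * of_real x + c0 - of_real (psi1 x)"
  proof -
    have "of_real (x ^ 4) * Rz ?u = of_real (x ^ 4) * (of_real (?u\<^sup>2) / 2 + c1 * of_real (?u ^ 3) + c0 * of_real (?u ^ 4)) - of_real (x ^ 4) * Q ?u"
      using Q_explicit[OF u] by (simp only: right_diff_distrib[symmetric]) simp
    also have "of_real (x ^ 4) * (of_real (?u\<^sup>2) / 2 + c1 * of_real (?u ^ 3) + c0 * of_real (?u ^ 4)) =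
        of_real (x\<^sup>2) / 2 + c1 * of_real x + c0"
      using x0 by (simp add: power_divide field_simps eval_nat_numeral)
    finally show ?thesis unfolding Qx .
  qed
  ultimately show ?thesis by (simp only:)
qed

end

section \<open>From \<open>psi1\<close> back to the truncated Dirichlet series\<close>

definition dir_poly :: "real \<Rightarrow> complex \<Rightarrow> complex" where
  "dir_poly X s = (\<Sum>n | real n < X. mangoldt n * of_nat n powr (- s))"

lemma tail_tent_has_integral:
  fixes s :: complex
  assumes n: "n \<ge> (1::nat)" "real n < X" and s: "s \<noteq> 0" "s + 1 \<noteq> 0"
  shows "((\<lambda>x. of_real (max (x - real n) 0) * of_real x powr (- s - 2)) has_integral
    ((of_nat n powr (- s) - of_real X powr (- s) - s * of_real (X - real n) * of_real X powr (- s - 1)) / (s * (s + 1)))) {1..X}"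
proof -
  let ?F = "\<lambda>x. - (of_real x powr (- s) + s * (of_real (x - real n) * of_real x powr (- s - 1)))"
  have "((\<lambda>x. s * (s + 1) * (of_real (x - real n) * of_real x powr (- s - 2))) has_integral (?F X - ?F (real n))) {real n..X}"
  proof (rule fundamental_theorem_of_calculus)
    fix x assume "x \<in> {real n..X}"
    then have x: "x > 0" using n by auto
    let ?S = "{real n..X}"
    have lin: "((\<lambda>x. complex_of_real (x - real n)) has_vector_derivative 1) (at x within ?S)"
      unfolding of_real_diff by (auto intro!: derivative_eq_intros)
    have e: "- s - 1 - 1 = - s - 2" by simp
    note D = has_vector_derivative_powr[OF x, of "- s" ?S] has_vector_derivative_powr[OF x, of "- s - 1" ?S, unfolded e]
    have "(?F has_vector_derivative - (- s * of_real x powr (- s - 1) + s * (of_real (x - real n) * ((- s - 1) * of_real x powr (- s - 2)) + 1 * of_real x powr (- s - 1)))) (at x within ?S)"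
      by (intro has_vector_derivative_minus has_vector_derivative_add D has_vector_derivative_mult_right has_vector_derivative_mult lin)
    moreover have "- (- s * of_real x powr (- s - 1) + s * (of_real (x - real n) * ((- s - 1) * of_real x powr (- s - 2)) + 1 * of_real x powr (- s - 1)))
       = s * (s + 1) * (of_real (x - real n) * of_real x powr (- s - 2))" by (simp add: algebra_simps)
    ultimately show "(?F has_vector_derivative s * (s + 1) * (of_real (x - real n) * of_real x powr (- s - 2))) (at x within ?S)"
      by (simp only:)
  qed (use n in simp)
  then have "((\<lambda>x. s * (s + 1) * (of_real (x - real n) * of_real x powr (- s - 2)) / (s * (s + 1))) has_integral (?F X - ?F (real n)) / (s * (s + 1))) {real n..X}"
    by (rule has_integral_divide)
  then have "((\<lambda>x. of_real (max (x - real n) 0) * of_real x powr (- s - 2)) has_integral (?F X - ?F (real n)) / (s * (s + 1))) {real n..X}"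
    by (rule has_integral_eq[rotated]) (use s in auto)
  moreover have "((\<lambda>x. 0) has_integral (0::complex)) {1..real n}" by (rule has_integral_0)
  then have "((\<lambda>x. of_real (max (x - real n) 0) * of_real x powr (- s - 2)) has_integral 0) {1..real n}"
    by (rule has_integral_eq[rotated]) auto
  ultimately have "((\<lambda>x. of_real (max (x - real n) 0) * of_real x powr (- s - 2)) has_integral (0 + (?F X - ?F (real n)) / (s * (s + 1)))) {1..X}"
    using n by (intro has_integral_combine[of 1 "real n" X]) auto
  moreover have "?F X - ?F (real n) = of_nat n powr (- s) - of_real X powr (- s) - s * of_real (X - real n) * of_real X powr (- s - 1)"
    by (simp add: algebra_simps)
  ultimately show ?thesis by (simp only: add_0)
qed

text \<open>Partial summation in reverse: \<open>psi1\<close> is a combination of tents, each tent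
  integrates to n^-s plus boundary terms at X, and these assemble into
  \<open>chebyshev_psi X\<close> and \<open>psi1 X\<close>.\<close>

lemma psi1_integral:
  assumes s: "s \<noteq> 0" "s + 1 \<noteq> 0"
  shows "((\<lambda>x. of_real (psi1 x) * of_real x powr (- s - 2)) has_integral
     ((dir_poly X s - of_real (chebyshev_psi X) * of_real X powr (- s) - s * of_real (psi1 X) * of_real X powr (- s - 1)) / (s * (s + 1)))) {1..X}"
proof -
  let ?S = "{n. real n < X}"
  let ?I = "\<lambda>n. (of_nat n powr (- s) - of_real X powr (- s) - s * of_real (X - real n) * of_real X powr (- s - 1)) / (s * (s + 1))"
  have int: "((\<lambda>x. \<Sum>n\<in>?S. mangoldt n * (of_real (max (x - real n) 0) * of_real x powr (- s - 2))) has_integral (\<Sum>n\<in>?S. mangoldt n * ?I n)) {1..X}"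
  proof (rule has_integral_sum[OF finite_nat_less_real])
    fix n assume n: "n \<in> ?S"
    show "((\<lambda>x. mangoldt n * (of_real (max (x - real n) 0) * of_real x powr (- s - 2))) has_integral mangoldt n * ?I n) {1..X}"
    proof (cases "n = 0")
      case True
      then show ?thesis by simp
    next
      case False
      then show ?thesis using n s by (intro has_integral_mult_right tail_tent_has_integral) auto
    qed
  qed
  have val: "(\<Sum>n\<in>?S. mangoldt n * ?I n) = (dir_poly X s - of_real (chebyshev_psi X) * of_real X powr (- s) - s * of_real (psi1 X) * of_real X powr (- s - 1)) / (s * (s + 1))"
  proof -
    have "(\<Sum>n\<in>?S. mangoldt n * ?I n) = (\<Sum>n\<in>?S. (mangoldt n * of_nat n powr (- s) - mangoldt n * of_real X powr (- s) - s * of_real (mangoldt n * (X - real n)) * of_real X powr (- s - 1)) / (s * (s + 1)))"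
      by (intro sum.cong) (auto simp: algebra_simps)
    also have "\<dots> = ((\<Sum>n\<in>?S. mangoldt n * of_nat n powr (- s)) - (\<Sum>n\<in>?S. mangoldt n) * of_real X powr (- s) -
        s * of_real (psi1 X) * of_real X powr (- s - 1)) / (s * (s + 1))"
      by (simp only: psi1_def of_real_sum sum_distrib_left sum_distrib_right sum_subtractf[symmetric] sum_divide_distrib)
    finally show ?thesis by (simp add: dir_poly_def chebyshev_psi_def)
  qed
  have "(\<Sum>n\<in>?S. mangoldt n * (of_real (max (x - real n) 0) * of_real x powr (- s - 2))) = of_real (psi1 x) * of_real x powr (- s - 2)"
    if x: "x \<in> {1..X}" for x
  proof -
    have "psi1 x = (\<Sum>n\<in>?S. mangoldt n * max (x - real n) 0)" unfolding psi1_def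
      using x by (intro sum.mono_neutral_cong_left) (auto simp: finite_nat_less_real max_def)
    then show ?thesis by (simp add: sum_distrib_right mult.assoc)
  qed
  from has_integral_eq[OF this int] show ?thesis unfolding val .
qed

context rh_zeros
begin

definition Tz :: "real \<Rightarrow> complex \<Rightarrow> complex" where
  "Tz X s = infsum (\<lambda>\<rho>. of_real (zmult \<rho>) * of_real X powr (\<rho> - s) / (\<rho> * (\<rho> - s))) Zeros"

definition zsum :: real where "zsum = infsum (\<lambda>\<rho>. zmult \<rho> / (norm \<rho>)\<^sup>2) Zeros"

lemma zsum_nonneg: "zsum \<ge> 0"
  unfolding zsum_def by (intro infsum_nonneg) auto

text \<open>Here \<open>K\<close> bounds the loss in replacing the distance to \<open>s\<close> by the distance to the origin.\<close>

lemma Tz_has_sum_and_bound: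
  assumes X: "X \<ge> 1" and s: "Re s \<ge> 1/2" and K: "\<And>\<rho>. \<rho> \<in> Zeros \<Longrightarrow> norm \<rho> \<le> K * norm (\<rho> - s)"
  shows "((\<lambda>\<rho>. of_real (zmult \<rho>) * of_real X powr (\<rho> - s) / (\<rho> * (\<rho> - s))) has_sum Tz X s) Zeros"
    and "norm (Tz X s) \<le> K * zsum * X powr (1/2 - Re s)"
proof -
  let ?f = "\<lambda>\<rho>. of_real (zmult \<rho>) * of_real X powr (\<rho> - s) / (\<rho> * (\<rho> - s))"
  let ?g = "\<lambda>\<rho>. zmult \<rho> / (norm \<rho>)\<^sup>2 * (K * X powr (1/2 - Re s))"
  have le: "norm (?f \<rho>) \<le> ?g \<rho>" if \<rho>: "\<rho> \<in> Zeros" for \<rho>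
  proof -
    have n: "norm \<rho> > 0" using Zeros_ne[OF \<rho>] by simp
    have d: "norm (\<rho> - s) > 0" using K[OF \<rho>] n by (metis mult_zero_right not_le zero_less_norm_iff norm_eq_zero)
    have "norm (of_real X powr (\<rho> - s)) = X powr Re (\<rho> - s)" by (rule norm_powr_of_real) (use X in simp)
    also have "\<dots> \<le> X powr (1/2 - Re s)" using Re_Zeros[OF \<rho>] X by (intro powr_mono) auto
    finally have 1: "norm (of_real X powr (\<rho> - s)) \<le> X powr (1/2 - Re s)" .
    have "1 / norm (\<rho> - s) \<le> K / norm \<rho>" using K[OF \<rho>] n d by (simp add: field_simps)
    then have "zmult \<rho> / norm \<rho> * (norm (of_real X powr (\<rho> - s)) * (1 / norm (\<rho> - s))) \<le>
       zmult \<rho> / norm \<rho> * (X powr (1/2 - Re s) * (K / norm \<rho>))"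
      using 1 by (intro mult_left_mono mult_mono) auto
    then show ?thesis by (simp add: norm_mult norm_divide power2_eq_square mult_ac)
  qed
  have gs: "?g summable_on Zeros" by (intro summable_on_cmult_left summable_zmult)
  have ns: "(\<lambda>\<rho>. norm (?f \<rho>)) summable_on Zeros"
    by (rule summable_on_comparison_test[OF gs le]) auto
  show "(?f has_sum Tz X s) Zeros" unfolding Tz_def
    by (rule has_sum_infsum[OF abs_summable_summable[OF ns]])
  have "norm (Tz X s) \<le> infsum (\<lambda>\<rho>. norm (?f \<rho>)) Zeros" unfolding Tz_def by (rule norm_infsum_bound[OF ns])
  also have "\<dots> \<le> infsum ?g Zeros" by (rule infsum_mono[OF ns gs le])
  also have "\<dots> = zsum * (K * X powr (1/2 - Re s))" unfolding zsum_def by (rule infsum_cmult_left')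
  finally show "norm (Tz X s) \<le> K * zsum * X powr (1/2 - Re s)" by (simp add: mult_ac)
qed

text \<open>Outside the disc of radius 2 |s| the constant 2 works, and only finitely many zeros
  remain. This K serves for convergence alone; the quantitative bound uses an explicit one.\<close>

lemma zero_distance_ratio:
  assumes "s \<notin> Zeros"
  obtains K where "\<And>\<rho>. \<rho> \<in> Zeros \<Longrightarrow> norm \<rho> \<le> K * norm (\<rho> - s)"
proof -
  let ?A = "Zeros \<inter> cball 0 (2 * norm s)"
  let ?M = "Max (insert 2 ((\<lambda>\<rho>. norm \<rho> / norm (\<rho> - s)) ` ?A))"
  have fin: "finite (insert 2 ((\<lambda>\<rho>. norm \<rho> / norm (\<rho> - s)) ` ?A))" using finite_Zeros_cball by simp
  have "norm \<rho> \<le> ?M * norm (\<rho> - s)" if \<rho>: "\<rho> \<in> Zeros" for \<rho>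
  proof (cases "norm \<rho> \<le> 2 * norm s")
    case True
    then have "norm \<rho> / norm (\<rho> - s) \<le> ?M" using \<rho> fin by (intro Max_ge) auto
    moreover have "norm (\<rho> - s) > 0" using \<rho> assms by auto
    ultimately show ?thesis by (simp add: divide_le_eq)
  next
    case False
    have "norm \<rho> \<le> 2 * norm (\<rho> - s)" using False norm_triangle_ineq2[of \<rho> s] by simp
    also have "\<dots> \<le> ?M * norm (\<rho> - s)" using fin by (intro mult_right_mono Max_ge) auto
    finally show ?thesis .
  qed
  then show ?thesis by (rule that)
qed

text \<open>\<open>psi1_explicit\<close> is integrated against x^(-s-2) over [1, X]. The lower
  endpoint yields \<open>W s\<close>, hence zeta'/zeta(s); the upper one yields a zero sum
  \<open>V\<close>. Replacing \<open>psi1 X\<close> by its own explicit formula cancels part of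
  \<open>V\<close> and leaves \<open>Tz\<close>. The constant 1 + \<open>b0\<close> is
  zeta'/zeta(0).\<close>

lemma truncated_explicit_formula:
  assumes X: "X \<ge> 1" and s: "s \<notin> Zeros" "s \<noteq> 1" "Re s \<ge> 1/2"
  shows "dir_poly X s + deriv zeta s / zeta s =
     of_real (psi_error X) * of_real X powr (- s) + of_real X powr (1 - s) / (1 - s) + (1 + b0) * of_real X powr (- s) - s * Tz X s"
proof -
  have s0: "s \<noteq> 0" "s + 1 \<noteq> 0" "1 - s \<noteq> 0" "s - 1 \<noteq> 0" "- s \<noteq> 0" "- s - 1 \<noteq> 0" using s by (auto simp: complex_eq_iff)
  have X0: "X > 0" using X by simp
  let ?x = "complex_of_real X"
  define E where "E = ?x powr (- s)"
  define e where "e = ?x powr (- s - 1)"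
  have Ee: "E = ?x * e" unfolding E_def e_def using X0 powr_add[of ?x 1 "- s - 1"] by simp
  have X1: "?x powr (1 - s) = ?x * E" unfolding E_def using X0 powr_add[of ?x 1 "- s"] by simp
  obtain K where K: "\<And>\<rho>. \<rho> \<in> Zeros \<Longrightarrow> norm \<rho> \<le> K * norm (\<rho> - s)" using zero_distance_ratio[OF s(1)] by blast
  note T = Tz_has_sum_and_bound(1)[OF X s(3) K]
  define Y where "Y = of_real (X\<^sup>2) / 2 + c1 * ?x + c0 - of_real (psi1 X)"
  note YS = psi1_explicit[OF X, folded Y_def]
  have rho: "\<rho> - s \<noteq> 0" "\<rho> \<noteq> 0" "\<rho> + 1 \<noteq> 0" if "\<rho> \<in> Zeros" for \<rho>
    using Zeros_ne[OF that] that s(1) by auto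
  \<comment> \<open>\<open>V\<close> is the sum of \<open>wt \<rho>\<close> X^(\<rho> - s) / (s -
    \<rho>), expressed through \<open>psi1\<close> and \<open>Tz\<close> by the identity (1 -
    (\<rho> + 1)/(\<rho> - s)) / (s + 1) = 1/(s - \<rho>).\<close>
  define V where "V = (e * Y - Tz X s) / (s + 1)"
  have VS: "((\<lambda>\<rho>. wt \<rho> * ?x powr (\<rho> - s) / (s - \<rho>)) has_sum V) Zeros"
  proof -
    have "((\<lambda>\<rho>. (e * (wt \<rho> * ?x powr (\<rho> + 1)) + (- 1) * (of_real (zmult \<rho>) * ?x powr (\<rho> - s) / (\<rho> * (\<rho> - s)))) * (1 / (s + 1))) has_sum
       (e * Y + (- 1) * Tz X s) * (1 / (s + 1))) Zeros"
      by (rule has_sum_cmult_left[OF has_sum_add[OF has_sum_cmult_right[OF YS] has_sum_cmult_right[OF T]]])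
    moreover have "(e * (wt \<rho> * ?x powr (\<rho> + 1)) + (- 1) * (of_real (zmult \<rho>) * ?x powr (\<rho> - s) / (\<rho> * (\<rho> - s)))) * (1 / (s + 1)) =
       wt \<rho> * ?x powr (\<rho> - s) / (s - \<rho>)" if "\<rho> \<in> Zeros" for \<rho>
    proof -
      have "e * ?x powr (\<rho> + 1) = ?x powr (\<rho> - s)" unfolding e_def powr_add[symmetric] by (simp add: algebra_simps)
      then have a: "e * (wt \<rho> * ?x powr (\<rho> + 1)) = wt \<rho> * ?x powr (\<rho> - s)" by (metis mult.left_commute)
      have b: "of_real (zmult \<rho>) * ?x powr (\<rho> - s) / (\<rho> * (\<rho> - s)) = wt \<rho> * ?x powr (\<rho> - s) * ((\<rho> + 1) / (\<rho> - s))"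
        using rho[OF that] by (simp add: wt_def)
      have c: "(1 + (- 1) * ((\<rho> + 1) / (\<rho> - s))) * (1 / (s + 1)) = 1 / (s - \<rho>)"
      proof -
        have "1 + (- 1) * ((\<rho> + 1) / (\<rho> - s)) = (s + 1) / (s - \<rho>)"
          using rho(1)[OF that] by (simp add: divide_simps) (simp add: algebra_simps)
        then show ?thesis using s0 by simp
      qed
      have factor: "(A + (- 1) * (A * q)) * r = A * ((1 + (- 1) * q) * r)" for A q r :: complex
        by (simp add: algebra_simps)
      have "(e * (wt \<rho> * ?x powr (\<rho> + 1)) + (- 1) * (of_real (zmult \<rho>) * ?x powr (\<rho> - s) / (\<rho> * (\<rho> - s)))) * (1 / (s + 1)) =
         wt \<rho> * ?x powr (\<rho> - s) * ((1 + (- 1) * ((\<rho> + 1) / (\<rho> - s))) * (1 / (s + 1)))"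
        unfolding a b by (rule factor)
      then show ?thesis unfolding c by simp
    qed
    moreover have "(e * Y + (- 1) * Tz X s) * (1 / (s + 1)) = V" by (simp add: V_def)
    ultimately show ?thesis
      using has_sum_cong[of Zeros "\<lambda>\<rho>. (e * (wt \<rho> * ?x powr (\<rho> + 1)) + (- 1) * (of_real (zmult \<rho>) * ?x powr (\<rho> - s) / (\<rho> * (\<rho> - s)))) * (1 / (s + 1))"
         "\<lambda>\<rho>. wt \<rho> * ?x powr (\<rho> - s) / (s - \<rho>)"] by simp
  qed
  let ?g = "\<lambda>\<rho> x. complex_of_real x powr (\<rho> - s - 1)"
  define S where "S = (\<lambda>x. infsum (\<lambda>\<rho>. wt \<rho> * ?g \<rho> x) Zeros)"
  have cg: "continuous_on {1..X} (?g \<rho>)" for \<rho>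
    by (intro continuous_on_powr_complex continuous_intros) auto
  have bd: "norm (?g \<rho> x) \<le> 1" if "\<rho> \<in> Zeros" "x \<in> {1..X}" for \<rho> x
  proof -
    have "norm (?g \<rho> x) = x powr Re (\<rho> - s - 1)" by (rule norm_powr_of_real) (use that in simp)
    also have "\<dots> \<le> x powr 0" using that Re_Zeros[OF that(1)] s(3) by (intro powr_mono) auto
    finally show ?thesis using that by simp
  qed
  note EX = has_sum_integral_exchange[where c = wt and I = Zeros and a = 1 and b = X and B = 1 and g = ?g, OF wt_summable cg bd, folded S_def]
  have int_g: "integral {1..X} (?g \<rho>) = (?x powr (\<rho> - s) - 1) / (\<rho> - s)" if "\<rho> \<in> Zeros" for \<rho>
    by (rule integral_unique[OF has_integral_powr_1_X]) (use rho[OF that] X in auto)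
  have iS: "integral {1..X} S = W s - V"
  proof (rule has_sum_unique)
    show "((\<lambda>\<rho>. wt \<rho> * integral {1..X} (?g \<rho>)) has_sum integral {1..X} S) Zeros" by (rule EX(3))
    have "((\<lambda>\<rho>. wt \<rho> / (s - \<rho>) + (- 1) * (wt \<rho> * ?x powr (\<rho> - s) / (s - \<rho>))) has_sum (W s + (- 1) * V)) Zeros"
      by (rule has_sum_add[OF W_has_sum has_sum_cmult_right[OF VS]])
    moreover have "wt \<rho> / (s - \<rho>) + (- 1) * (wt \<rho> * ?x powr (\<rho> - s) / (s - \<rho>)) = wt \<rho> * integral {1..X} (?g \<rho>)" if "\<rho> \<in> Zeros" for \<rho>
      using rho[OF that] unfolding int_g[OF that] by (simp add: divide_simps) (simp add: algebra_simps)
    ultimately show "((\<lambda>\<rho>. wt \<rho> * integral {1..X} (?g \<rho>)) has_sum (W s - V)) Zeros"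
      using has_sum_cong[of Zeros "\<lambda>\<rho>. wt \<rho> / (s - \<rho>) + (- 1) * (wt \<rho> * ?x powr (\<rho> - s) / (s - \<rho>))" "\<lambda>\<rho>. wt \<rho> * integral {1..X} (?g \<rho>)"] by simp
  qed
  have psi1_eq: "of_real (psi1 x) * of_real x powr (- s - 2) =
      1/2 * of_real x powr ((1 - s) - 1) + c1 * of_real x powr (- s - 1) + c0 * of_real x powr ((- s - 1) - 1) - S x" if x: "x \<in> {1..X}" for x
  proof -
    have x1: "x \<ge> 1" using x by simp
    let ?y = "complex_of_real x"
    have e: "2 + (- s - 2) = 1 - s - 1" "1 + (- s - 2) = - s - 1" "- s - 1 - 1 = - s - 2" by simp_all
    have p: "?y powr ((1 - s) - 1) = ?y ^ 2 * ?y powr (- s - 2)" "?y powr (- s - 1) = ?y * ?y powr (- s - 2)"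
      "?y powr ((- s - 1) - 1) = ?y powr (- s - 2)"
      using x1 powr_add[of ?y 2 "- s - 2", unfolded e] powr_add[of ?y 1 "- s - 2", unfolded e] unfolding e by simp_all
    have "((\<lambda>\<rho>. ?y powr (- s - 2) * (wt \<rho> * ?y powr (\<rho> + 1))) has_sum ?y powr (- s - 2) * (of_real (x\<^sup>2) / 2 + c1 * ?y + c0 - of_real (psi1 x))) Zeros"
      by (rule has_sum_cmult_right[OF psi1_explicit[OF x1]])
    moreover have "?y powr (- s - 2) * (wt \<rho> * ?y powr (\<rho> + 1)) = wt \<rho> * ?g \<rho> x" for \<rho>
    proof -
      have "?y powr (- s - 2) * ?y powr (\<rho> + 1) = ?g \<rho> x" unfolding powr_add[symmetric] by (simp add: algebra_simps)
      then show ?thesis by (metis mult.left_commute)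
    qed
    ultimately have "((\<lambda>\<rho>. wt \<rho> * ?g \<rho> x) has_sum ?y powr (- s - 2) * (of_real (x\<^sup>2) / 2 + c1 * ?y + c0 - of_real (psi1 x))) Zeros"
      by (simp only:)
    moreover have "((\<lambda>\<rho>. wt \<rho> * ?g \<rho> x) has_sum S x) Zeros"
      unfolding S_def by (rule EX(1)) (use x in auto)
    ultimately have "S x = ?y powr (- s - 2) * (of_real (x\<^sup>2) / 2 + c1 * ?y + c0 - of_real (psi1 x))"
      using has_sum_unique by blast
    then show ?thesis unfolding p by (simp add: algebra_simps power2_eq_square)
  qed
  have "((\<lambda>x. 1/2 * of_real x powr ((1 - s) - 1) + c1 * of_real x powr (- s - 1) + c0 * of_real x powr ((- s - 1) - 1) - S x) has_integral
     (1/2 * ((?x powr (1 - s) - 1) / (1 - s)) + c1 * ((?x powr (- s) - 1) / (- s)) + c0 * ((?x powr (- s - 1) - 1) / (- s - 1)) - integral {1..X} S)) {1..X}"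
    by (intro has_integral_diff has_integral_add has_integral_mult_right has_integral_powr_1_X s0 X integrable_integral
          integrable_continuous_interval EX(2))
  then have "((\<lambda>x. of_real (psi1 x) * of_real x powr (- s - 2)) has_integral
     (1/2 * ((?x powr (1 - s) - 1) / (1 - s)) + c1 * ((?x powr (- s) - 1) / (- s)) + c0 * ((?x powr (- s - 1) - 1) / (- s - 1)) - integral {1..X} S)) {1..X}"
    by (rule has_integral_eq[rotated]) (use psi1_eq in simp)
  from has_integral_unique[OF this psi1_integral[OF s0(1,2), of X]]
  have "(dir_poly X s - of_real (chebyshev_psi X) * E - s * of_real (psi1 X) * e) / (s * (s + 1)) =
     1/2 * ((?x * E - 1) / (1 - s)) + c1 * ((E - 1) / (- s)) + c0 * ((e - 1) / (- s - 1)) - (W s - V)"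
    unfolding iS X1 E_def[symmetric] e_def[symmetric] by simp
  then have "dir_poly X s - of_real (chebyshev_psi X) * E - s * of_real (psi1 X) * e = s * (s + 1) *
     (1/2 * ((?x * E - 1) / (1 - s)) + c1 * ((E - 1) / (- s)) + c0 * ((e - 1) / (- s - 1)) - (W s - V))"
    using s0 by (metis nonzero_mult_div_cancel_left divide_eq_eq mult.commute mult_eq_0_iff)
  also have "\<dots> = s * (s + 1) / (2 * (1 - s)) * (?x * E - 1) - c1 * (s + 1) * (E - 1) - c0 * s * (e - 1) - s * (s + 1) * (W s - V)"
  proof -
    have 1: "s * (s + 1) * (c1 * ((E - 1) / (- s))) = - c1 * (s + 1) * (E - 1)" using s0 by simp
    have m: "(e - 1) / (- s - 1) = - ((e - 1) / (s + 1))" unfolding minus_divide_right by simp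
    have 2: "s * (s + 1) * (c0 * ((e - 1) / (- s - 1))) = - c0 * s * (e - 1)" unfolding m using s0 by simp
    have 3: "s * (s + 1) * (1/2 * ((?x * E - 1) / (1 - s))) = s * (s + 1) / (2 * (1 - s)) * (?x * E - 1)" by simp
    show ?thesis unfolding right_diff_distrib[of "s * (s + 1)" _ "W s - V"] distrib_left[of "s * (s + 1)"] 1 2 3 by simp
  qed
  finally have A: "dir_poly X s = of_real (chebyshev_psi X) * E + s * of_real (psi1 X) * e +
     s * (s + 1) / (2 * (1 - s)) * (?x * E - 1) - c1 * (s + 1) * (E - 1) - c0 * s * (e - 1) - s * (s + 1) * (W s - V)"
    by (simp add: algebra_simps)
  have V: "(s + 1) * V = e * Y - Tz X s" using s0 by (simp add: V_def)
  have q: "s * (s + 1) / (2 * (1 - s)) = 1 / (1 - s) - (s + 2) / 2"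
    using s0 by (simp add: divide_simps) (simp add: algebra_simps)
  have r: "- 1 / (s - 1) = 1 / (1 - s)" using s0 by (simp add: divide_simps)
  have psi: "of_real (chebyshev_psi X) = ?x + of_real (psi_error X)" by (simp add: psi_error_def)
  have p1: "of_real (psi1 X) = ?x\<^sup>2 / 2 + c1 * ?x + c0 - Y" by (simp add: Y_def)
  have "dir_poly X s + deriv zeta s / zeta s = of_real (chebyshev_psi X) * E + s * of_real (psi1 X) * e +
     (1 / (1 - s) - (s + 2) / 2) * (?x * E - 1) - c1 * (s + 1) * (E - 1) - c0 * s * (e - 1) - s * (s + 1) * W s + s * (e * Y - Tz X s)
     + (b0 + s * (s + 1) * W s - s * wt_sum + 1 / (1 - s))"
    unfolding A q V[symmetric] zeta_logderiv[OF s(1,2)] r[symmetric] by (simp add: algebra_simps)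
  also have "\<dots> = of_real (psi_error X) * E + (?x * E) * (1 / (1 - s)) + (1 + b0) * E - s * Tz X s"
    unfolding psi p1 c1_def c0_def Ee by (simp add: algebra_simps power2_eq_square add_divide_distrib diff_divide_distrib)
  finally show ?thesis by (simp add: E_def X1)
qed

text \<open>The second difference of \<open>psi1\<close> with step \<open>1/2\<close> over \<open>[N, N+1]\<close> vanishes, whereas the
  main term \<open>x\<^sup>2 / 2\<close> alone contributes \<open>1/4\<close> and trivial zeros only \<open>O(1/N)\<close>.\<close>

lemma ordinates_nonempty: "nontrivial_zeta_zeros \<noteq> {}"
proof
  assume empty: "nontrivial_zeta_zeros = {}"
  define Y where "Y = (\<lambda>x. of_real (x\<^sup>2) / 2 + c1 * of_real x + c0 - of_real (psi1 x))"
  define M where "M = infsum (\<lambda>\<rho>. norm (wt \<rho>)) Zeros"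
  have M0: "M \<ge> 0" unfolding M_def by (intro infsum_nonneg) auto
  have Yb: "norm (Y x) \<le> M / x" if x: "x \<ge> 1" for x
  proof -
    have le: "norm (wt \<rho> * of_real x powr (\<rho> + 1)) \<le> norm (wt \<rho>) * (1 / x)" if \<rho>: "\<rho> \<in> Zeros" for \<rho>
    proof -
      have "Re (\<rho> + 1) \<le> -1" using \<rho> empty by (cases rule: Zeros_cases) auto
      have "norm (of_real x powr (\<rho> + 1)) = x powr Re (\<rho> + 1)" by (rule norm_powr_of_real) (use x in simp)
      also have "\<dots> \<le> x powr (-1)" using x \<open>Re (\<rho> + 1) \<le> -1\<close> by (intro powr_mono) auto
      also have "\<dots> = 1 / x" using x by (simp add: powr_minus_divide)
      finally show ?thesis unfolding norm_mult by (intro mult_left_mono) auto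
    qed
    have gs: "(\<lambda>\<rho>. norm (wt \<rho>) * (1 / x)) summable_on Zeros" by (intro summable_on_cmult_left wt_summable)
    have ns: "(\<lambda>\<rho>. norm (wt \<rho> * of_real x powr (\<rho> + 1))) summable_on Zeros"
      by (rule summable_on_comparison_test[OF gs le]) auto
    have "Y x = infsum (\<lambda>\<rho>. wt \<rho> * of_real x powr (\<rho> + 1)) Zeros"
      unfolding Y_def by (rule infsumI[symmetric, OF psi1_explicit[OF x]])
    also have "norm \<dots> \<le> infsum (\<lambda>\<rho>. norm (wt \<rho> * of_real x powr (\<rho> + 1))) Zeros" by (rule norm_infsum_bound[OF ns])
    also have "\<dots> \<le> infsum (\<lambda>\<rho>. norm (wt \<rho>) * (1 / x)) Zeros" by (rule infsum_mono[OF ns gs le])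
    also have "\<dots> = M / x" unfolding M_def infsum_cmult_left' by simp
    finally show ?thesis .
  qed
  \<comment> \<open>The second difference will be at most 4 M / N in modulus, which must fall below
    1/4.\<close>
  obtain N :: nat where N: "real N > 16 * M + 1" using reals_Archimedean2 by blast
  have N1: "real N \<ge> 1" using N M0 by linarith
  \<comment> \<open>One index range serves the whole closed interval: at x = N the added term n = N
    has weight 0, and at x = N + 1 the strict inequality excludes n = N + 1.\<close>
  have lin: "psi1 x = (\<Sum>n\<le>N. mangoldt n * (x - real n))" if "real N \<le> x" "x \<le> real N + 1" for x
    unfolding psi1_def using that
    by (intro sum.mono_neutral_cong_left) (auto simp: not_less)
  have "psi1 (real N) + psi1 (real N + 1) - 2 * psi1 (real N + 1/2) = 0"
    using lin[of "real N"] lin[of "real N + 1"] lin[of "real N + 1/2"]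
    by (simp add: sum_distrib_left sum_subtractf[symmetric] sum.distrib[symmetric] algebra_simps)
  then have p: "complex_of_real (psi1 (real N)) + of_real (psi1 (real N + 1)) - 2 * of_real (psi1 (real N + 1/2)) = 0"
    by (metis of_real_0 of_real_add of_real_diff of_real_mult of_real_numeral)
  have "Y (real N) + Y (real N + 1) - 2 * Y (real N + 1/2) = 1/4"
  proof -
    have c: "complex_of_real (psi1 (real N + 1/2)) = (of_real (psi1 (real N)) + of_real (psi1 (real N + 1))) / 2"
      using p by (simp add: field_simps)
    show ?thesis unfolding Y_def c by (simp add: power2_eq_square field_simps)
  qed
  then have "1/4 = norm (Y (real N) + Y (real N + 1) - 2 * Y (real N + 1/2))"
    by (simp only:) (simp add: norm_divide)
  also have "\<dots> \<le> norm (Y (real N)) + norm (Y (real N + 1)) + norm (2 * Y (real N + 1/2))"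
    by (intro norm_triangle_le_diff norm_triangle_le add_mono order.refl)
  also have "\<dots> \<le> M / real N + M / real N + 2 * (M / real N)"
  proof (intro add_mono)
    show "norm (Y (real N)) \<le> M / real N" using Yb N1 by simp
    have "norm (Y (real N + 1)) \<le> M / (real N + 1)" using Yb N1 by simp
    also have "\<dots> \<le> M / real N" using M0 N1 by (intro divide_left_mono) auto
    finally show "norm (Y (real N + 1)) \<le> M / real N" .
    have "norm (Y (real N + 1/2)) \<le> M / (real N + 1/2)" using Yb N1 by simp
    also have "\<dots> \<le> M / real N" using M0 N1 by (intro divide_left_mono) auto
    finally show "norm (2 * Y (real N + 1/2)) \<le> 2 * (M / real N)" by (simp add: norm_mult)
  qed
  also have "\<dots> = 4 * M / real N" by simp
  also have "\<dots> < 1/4" using N N1 by (simp add: field_simps)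
  finally show False by simp
qed

end

section \<open>The argument of the zeta function\<close>

text \<open>Two continuous arguments with the same start differ by 2 pi times a continuous
  integer-valued function, which is constant; this resolves the definite description in
  \<open>arg_along\<close>.\<close>

lemma arg_along_eq:
  assumes a: "continuous_on {0..1} a" "a 0 = \<theta>\<^sub>0" "\<And>t. t \<in> {0..1} \<Longrightarrow> f (g t) = rcis (cmod (f (g t))) (a t)"
    and nz: "\<And>t. t \<in> {0..1} \<Longrightarrow> f (g t) \<noteq> 0"
  shows "arg_along f g \<theta>\<^sub>0 = a 1"
  unfolding arg_along_def
proof (rule the_equality)
  show "\<exists>b. continuous_on {0..1} b \<and> b 0 = \<theta>\<^sub>0 \<and> b 1 = a 1 \<and> (\<forall>t\<in>{0..1}. f (g t) = rcis (cmod (f (g t))) (b t))"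
    using a by (intro exI[of _ a]) auto
  fix \<theta> assume "\<exists>b. continuous_on {0..1} b \<and> b 0 = \<theta>\<^sub>0 \<and> b 1 = \<theta> \<and> (\<forall>t\<in>{0..1}. f (g t) = rcis (cmod (f (g t))) (b t))"
  then obtain b where b: "continuous_on {0..1} b" "b 0 = \<theta>\<^sub>0" "b 1 = \<theta>"
    "\<And>t. t \<in> {0..1} \<Longrightarrow> f (g t) = rcis (cmod (f (g t))) (b t)" by blast
  define d where "d = (\<lambda>t. (a t - b t) / (2 * pi))"
  have dint: "\<exists>n::int. d t = of_int n" if t: "t \<in> {0..1}" for t
  proof -
    have "rcis (cmod (f (g t))) (a t) = rcis (cmod (f (g t))) (b t)" using a(3)[OF t] b(4)[OF t] by metis
    then have "cis (a t) = cis (b t)" using nz[OF t] by (simp add: rcis_def)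
    then have "cis (a t - b t) = 1" by (simp flip: cis_divide)
    then have "cos (a t - b t) = 1" by (metis cis.sel(1) one_complex.sel(1))
    then obtain n :: int where "a t - b t = of_int n * 2 * pi" by (auto simp: cos_one_2pi_int)
    then show ?thesis by (intro exI[of _ n]) (simp add: d_def)
  qed
  have "d constant_on {0..1}"
  proof (rule continuous_discrete_range_constant)
    show "continuous_on {0..1} d" unfolding d_def by (intro continuous_intros a b) auto
    fix t :: real assume t: "t \<in> {0..1}"
    show "\<exists>e>0. \<forall>y. y \<in> {0..1} \<and> d y \<noteq> d t \<longrightarrow> e \<le> norm (d y - d t)"
    proof (intro exI[of _ 1] conjI allI impI)
      fix y assume y: "y \<in> {0..1} \<and> d y \<noteq> d t"
      obtain m n :: int where mn: "d y = of_int m" "d t = of_int n" using dint y t by blast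
      then have "m \<noteq> n" using y by auto
      then have "1 \<le> \<bar>m - n\<bar>" by linarith
      then have "1 \<le> \<bar>real_of_int (m - n)\<bar>" by linarith
      then show "1 \<le> norm (d y - d t)" unfolding mn by simp
    qed simp
  qed simp
  then have "d 1 = d 0" by (auto simp: constant_on_def)
  then show "\<theta> = a 1" using a(2) b(2,3) by (simp add: d_def)
qed

lemma Im_prime_zeta_log_2: "Im (prime_zeta_log 2) = 0"
proof -
  have "(\<lambda>n. of_real (mangoldt (Suc n) / ln (real (Suc n))) / of_nat (Suc n) powr 2) sums prime_zeta_log 2"
    unfolding prime_zeta_log_def
    by (rule dirichlet_sums[of "\<lambda>n. of_real (mangoldt n / ln (real n))", OF norm_mangoldt_div_ln]) simp
  moreover have "complex_of_nat (Suc n) powr 2 = of_real (real (Suc n) powr 2)" for n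
    using powr_of_real[of "real (Suc n)" 2] by (simp del: of_nat_Suc)
  ultimately have "(\<lambda>n. complex_of_real (mangoldt (Suc n) / ln (real (Suc n)) / real (Suc n) powr 2)) sums prime_zeta_log 2"
    by (simp del: of_nat_Suc)
  from sums_Im[OF this] have "(\<lambda>n. 0::real) sums Im (prime_zeta_log 2)" by (simp only: Im_complex_of_real)
  then show ?thesis using sums_unique2 sums_zero by blast
qed

context rh_zeros
begin

text \<open>\<open>infdist\<close> to the empty set is 0, so positivity rests on the existence of
  nontrivial zeros. As these have real part 1/2, ordinates within 1 of T come from a bounded disc,
  which contains finitely many zeros.\<close>

lemma ordinate_gap:
  assumes T: "T \<notin> zeta_ordinates"
  shows "infdist T zeta_ordinates > 0" and "\<rho> \<in> nontrivial_zeta_zeros \<Longrightarrow> infdist T zeta_ordinates \<le> \<bar>Im \<rho> - T\<bar>"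
proof -
  have ne: "zeta_ordinates \<noteq> {}" using ordinates_nonempty by (simp add: zeta_ordinates_def)
  let ?A = "Im ` (Zeros \<inter> cball 0 (\<bar>T\<bar> + 2) \<inter> nontrivial_zeta_zeros)"
  have fin: "finite (insert 1 ((\<lambda>\<gamma>. \<bar>\<gamma> - T\<bar>) ` ?A))" using finite_Zeros_cball by simp
  define \<epsilon> where "\<epsilon> = Min (insert 1 ((\<lambda>\<gamma>. \<bar>\<gamma> - T\<bar>) ` ?A))"
  have pos: "\<epsilon> > 0" unfolding \<epsilon>_def using fin T by (subst Min_gr_iff) (auto simp: zeta_ordinates_def)
  have "\<epsilon> \<le> dist T \<gamma>" if "\<gamma> \<in> zeta_ordinates" for \<gamma>
  proof -
    obtain \<rho> where \<rho>: "\<rho> \<in> nontrivial_zeta_zeros" "\<gamma> = Im \<rho>"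
      using \<open>\<gamma> \<in> zeta_ordinates\<close> unfolding zeta_ordinates_def by blast
    have re: "Re \<rho> = 1/2" using RH \<rho>(1) by (auto simp: riemann_hypothesis_def)
    show ?thesis
    proof (cases "norm \<rho> \<le> \<bar>T\<bar> + 2")
      case True
      then have "\<bar>\<gamma> - T\<bar> \<in> insert 1 ((\<lambda>\<gamma>. \<bar>\<gamma> - T\<bar>) ` ?A)" using \<rho> nontrivial_subset by auto
      then have "\<epsilon> \<le> \<bar>\<gamma> - T\<bar>" unfolding \<epsilon>_def by (rule Min_le[OF fin])
      then show ?thesis by (simp add: dist_real_def abs_minus_commute)
    next
      case False
      then have "\<bar>\<gamma>\<bar> \<ge> \<bar>T\<bar> + 1" using cmod_le[of \<rho>] re \<rho>(2) by simp
      moreover have "\<epsilon> \<le> 1" unfolding \<epsilon>_def by (rule Min_le[OF fin]) simp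
      ultimately show ?thesis by (simp add: dist_real_def)
    qed
  qed
  then have "\<epsilon> \<le> infdist T zeta_ordinates" using ne by (simp add: infdist_def cINF_greatest)
  then show "infdist T zeta_ordinates > 0" using pos by linarith
  assume "\<rho> \<in> nontrivial_zeta_zeros"
  then have "Im \<rho> \<in> zeta_ordinates" by (simp add: zeta_ordinates_def)
  from infdist_le[OF this, of T] show "infdist T zeta_ordinates \<le> \<bar>Im \<rho> - T\<bar>"
    by (simp add: dist_real_def abs_minus_commute)
qed

text \<open>The minimum with T accounts for the trivial zeros and the pole, all of ordinate
  0.\<close>

definition gap :: "real \<Rightarrow> real" where "gap T = min (infdist T zeta_ordinates) T"

lemma gap_pos: "T > 0 \<Longrightarrow> T \<notin> zeta_ordinates \<Longrightarrow> gap T > 0"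
  using ordinate_gap(1) by (simp add: gap_def)

lemma gap_le_Im:
  assumes "T > 0" "T \<notin> zeta_ordinates" "\<rho> \<in> Zeros"
  shows "gap T \<le> \<bar>Im \<rho> - T\<bar>"
  using assms(3)
proof (cases rule: Zeros_cases)
  case 1
  then show ?thesis using ordinate_gap(2)[OF assms(2), of \<rho>] by (simp add: gap_def min_le_iff_disj)
qed (use assms(1) in \<open>simp add: gap_def\<close>)

text \<open>In the strip |Im s - T| < \<open>gap T\<close> zeta has neither zeros nor a pole, so a
  holomorphic logarithm exists there. It is glued at 2 + iT to \<open>prime_zeta_log\<close>, whose
  imaginary part is a continuous argument along the vertical segment.\<close>

lemma zeta_log_branch:
  assumes T: "T > 0" "T \<notin> zeta_ordinates"
  obtains L where "\<And>z. z \<in> closed_segment (Complex 2 T) (Complex (1/2) T) \<Longrightarrow> (L has_field_derivative deriv zeta z / zeta z) (at z)"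
    "Im (L (Complex 2 T)) = Im (prime_zeta_log (Complex 2 T))"
    "pi * zeta_S T = Im (L (Complex (1/2) T))"
proof -
  let ?s1 = "Complex 2 T" and ?s0 = "Complex (1/2) T"
  define S where "S = {s. T - gap T < Im s} \<inter> {s. Im s < T + gap T}"
  have g: "gap T > 0" using gap_pos T by blast
  have opS: "open S" unfolding S_def by (intro open_Int open_halfspace_Im_gt open_halfspace_Im_lt)
  have cvS: "convex S" unfolding S_def by (intro convex_Int convex_halfspace_Im_gt convex_halfspace_Im_lt)
  have S1: "s \<noteq> 1" if "s \<in> S" for s using that by (auto simp: S_def gap_def min_def split: if_splits)
  have nz: "zeta s \<noteq> 0" if "s \<in> S" for s
  proof
    assume "zeta s = 0"
    then have "s \<in> Zeros" using S1[OF that] by (simp add: in_Zeros_iff)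
    from gap_le_Im[OF T this] that show False by (auto simp: S_def)
  qed
  have hol: "zeta holomorphic_on S" using S1 by (intro holomorphic_on_subset[OF holomorphic_zeta]) auto
  obtain L0 where L0: "L0 holomorphic_on S" "\<And>z. z \<in> S \<Longrightarrow> zeta z = exp (L0 z)"
    using simply_connected_eq_holomorphic_log[OF opS] convex_imp_simply_connected[OF cvS] hol nz by metis
  obtain c where c: "c > 0" "\<And>s. Re s > 1 \<Longrightarrow> dir_zeta s = of_real c * exp (prime_zeta_log s)"
    using dir_zeta_eq_exp by blast
  have ze: "zeta s = of_real c * exp (prime_zeta_log s)" if "Re s > 1" for s
    using c(2)[OF that] zeta_eq_dir_zeta[OF that] by simp
  \<comment> \<open>The added constant fixes the branch at 2 + iT. As \<open>ln c\<close> is real,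
    the imaginary part there agrees with that of \<open>prime_zeta_log\<close>.\<close>
  define L where "L = (\<lambda>z. L0 z + (prime_zeta_log ?s1 + of_real (ln c) - L0 ?s1))"
  have s1S: "?s1 \<in> S" using g by (simp add: S_def)
  have expL: "exp (L z) = zeta z" if "z \<in> S" for z
  proof -
    have "exp (prime_zeta_log ?s1 + of_real (ln c)) = zeta ?s1" using ze[of ?s1] c(1) by (simp add: exp_add exp_of_real)
    then show ?thesis unfolding L_def using L0(2)[OF that] L0(2)[OF s1S] by (simp add: exp_add exp_diff)
  qed
  have dL: "(L has_field_derivative deriv zeta z / zeta z) (at z)" if z: "z \<in> S" for z
  proof -
    have D0: "(L0 has_field_derivative deriv L0 z) (at z)" by (rule holomorphic_derivI[OF L0(1) opS z])
    then have D: "(L has_field_derivative deriv L0 z) (at z)" unfolding L_def by (auto intro!: derivative_eq_intros)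
    have "((\<lambda>z. exp (L0 z)) has_field_derivative exp (L0 z) * deriv L0 z) (at z)"
      by (auto intro!: derivative_eq_intros D0)
    then have "(zeta has_field_derivative exp (L0 z) * deriv L0 z) (at z)"
      by (rule has_field_derivative_transform_within_open[OF _ opS z]) (use L0(2) in auto)
    then have "deriv zeta z = zeta z * deriv L0 z" using L0(2)[OF z] by (simp add: DERIV_imp_deriv)
    then show ?thesis using D nz[OF z] by simp
  qed
  have seg: "closed_segment ?s1 ?s0 \<subseteq> S"
    by (rule closed_segment_subset[OF s1S _ cvS]) (use g in \<open>simp add: S_def\<close>)
  have L1: "Im (L ?s1) = Im (prime_zeta_log ?s1)" by (simp add: L_def)
  have rc: "of_real r * exp w = rcis (cmod (of_real r * exp w)) (Im w)" if "r > 0" for r w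
    using that by (simp add: norm_mult rcis_def exp_eq_polar mult.assoc)
  define a1 where "a1 = (\<lambda>t. Im (prime_zeta_log (linepath 2 ?s1 t)))"
  define a2 where "a2 = (\<lambda>t. Im (L (linepath ?s1 ?s0 t)))"
  have re2: "Re (linepath 2 ?s1 t) = 2" for t by (simp add: linepath_def algebra_simps)
  have in2: "linepath ?s1 ?s0 t \<in> S" if "t \<in> {0..1}" for t using that seg linepath_in_path by blast
  have contP: "continuous_on {s. Re s > 1} prime_zeta_log"
    by (intro continuous_at_imp_continuous_on ballI) (use prime_zeta_log_has_field_derivative DERIV_isCont in blast)
  have contL: "continuous_on S L"
    by (intro continuous_at_imp_continuous_on ballI) (use dL DERIV_isCont in blast)
  have "continuous_on {0..1} (\<lambda>t. prime_zeta_log (linepath 2 ?s1 t))"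
    by (rule continuous_on_compose2[OF contP continuous_on_linepath]) (use re2 in auto)
  then have "path a1" unfolding path_def a1_def by (rule continuous_on_Im)
  moreover have "continuous_on {0..1} (\<lambda>t. L (linepath ?s1 ?s0 t))"
    by (rule continuous_on_compose2[OF contL continuous_on_linepath]) (use in2 in auto)
  then have "path a2" unfolding path_def a2_def by (rule continuous_on_Im)
  moreover have "pathfinish a1 = pathstart a2"
    by (simp add: a1_def a2_def pathfinish_def pathstart_def L1 linepath_0' linepath_1')
  ultimately have "path (a1 +++ a2)" by simp
  have "arg_along zeta (L_path T) 0 = (a1 +++ a2) 1"
  proof (rule arg_along_eq)
    show "continuous_on {0..1} (a1 +++ a2)" using \<open>path (a1 +++ a2)\<close> by (simp add: path_def)
    show "(a1 +++ a2) 0 = 0" by (simp add: joinpaths_def a1_def linepath_0' Im_prime_zeta_log_2)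
    fix t :: real assume t: "t \<in> {0..1}"
    have "zeta (L_path T t) = rcis (cmod (zeta (L_path T t))) ((a1 +++ a2) t) \<and> zeta (L_path T t) \<noteq> 0"
    proof (cases "t \<le> 1/2")
      case True
      have "zeta (linepath 2 ?s1 (2 * t)) = of_real c * exp (prime_zeta_log (linepath 2 ?s1 (2 * t)))"
        by (rule ze) (simp add: re2)
      then show ?thesis using True rc[OF c(1)] c(1) by (simp add: L_path_def joinpaths_def a1_def)
    next
      case False
      have "zeta (linepath ?s1 ?s0 (2 * t - 1)) = of_real 1 * exp (L (linepath ?s1 ?s0 (2 * t - 1)))"
        using expL[OF in2] t False by simp
      then show ?thesis using False rc[of 1] by (simp add: L_path_def joinpaths_def a2_def)
    qed
    then show "zeta (L_path T t) = rcis (cmod (zeta (L_path T t))) ((a1 +++ a2) t)" "zeta (L_path T t) \<noteq> 0"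
      by blast+
  qed
  also have "(a1 +++ a2) 1 = Im (L ?s0)" by (simp add: joinpaths_def a2_def linepath_1')
  finally have "pi * zeta_S T = Im (L ?s0)" by (simp add: zeta_S_def)
  then show ?thesis using that[of L] dL seg L1 by blast
qed

end

section \<open>The error estimate\<close>

lemma ln_le_two_sqrt: assumes "X > (0::real)" shows "ln X \<le> 2 * X powr (1/2)"
proof -
  have "ln (X powr (1/2)) \<le> X powr (1/2)" using assms by (intro ln_bound) auto
  then show ?thesis using assms by (simp add: ln_powr)
qed

text \<open>On Re z = 2 the exponent splits as 1/2 + 3/2: the first part saves X^(-1/2) on the tail,
  at most 2 / ln X, and the second keeps the series convergent.\<close>

lemma prime_zeta_log_tail:
  assumes X: "X \<ge> 2" and z: "Re z = 2"
  shows "norm (prime_zeta_log z - (\<Sum>n | real n < X. of_real (mangoldt n / ln (real n)) * of_nat n powr (- z)))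
    \<le> 2 * (\<Sum>n. 1 / real (Suc n) powr (3/2)) / ln X"
proof -
  define f where "f = (\<lambda>n. complex_of_real (mangoldt n / ln (real n)) / of_nat n powr z)"
  let ?F = "{n. real (Suc n) < X}"
  have finF: "finite ?F" by (rule finite_subset[OF _ finite_nat_less_real[of X]]) auto
  have fin: "(\<Sum>n | real n < X. of_real (mangoldt n / ln (real n)) * of_nat n powr (- z)) = (\<Sum>n\<in>?F. f (Suc n))"
  proof -
    have set: "{n. real n < X} = insert 0 (Suc ` ?F)"
    proof (intro equalityI subsetI)
      fix n assume "n \<in> {n. real n < X}"
      then show "n \<in> insert 0 (Suc ` ?F)" by (cases n) auto
    qed (use X in auto)
    have "(\<Sum>n | real n < X. of_real (mangoldt n / ln (real n)) * of_nat n powr (- z)) = (\<Sum>n | real n < X. f n)"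
      unfolding f_def by (intro sum.cong) (simp_all add: powr_minus divide_inverse)
    also have "\<dots> = f 0 + (\<Sum>n\<in>Suc ` ?F. f n)" unfolding set using finF by (subst sum.insert) auto
    also have "(\<Sum>n\<in>Suc ` ?F. f n) = (\<Sum>n\<in>?F. f (Suc n))" by (subst sum.reindex) auto
    finally show ?thesis by (simp add: f_def)
  qed
  have "(\<lambda>n. f (Suc n)) sums prime_zeta_log z"
    unfolding prime_zeta_log_def f_def
    by (rule dirichlet_sums[of "\<lambda>n. of_real (mangoldt n / ln (real n))", OF norm_mangoldt_div_ln]) (use z in simp)
  from sums_diff[OF this sums_If_finite_set[OF finF]]
  have "(\<lambda>n. f (Suc n) - (if n \<in> ?F then f (Suc n) else 0)) sums (prime_zeta_log z - (\<Sum>n\<in>?F. f (Suc n)))" .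
  then have eq: "prime_zeta_log z - (\<Sum>n\<in>?F. f (Suc n)) = (\<Sum>n. f (Suc n) - (if n \<in> ?F then f (Suc n) else 0))"
    by (rule sums_unique)
  have "norm (\<Sum>n. f (Suc n) - (if n \<in> ?F then f (Suc n) else 0)) \<le> (\<Sum>n. X powr (-1/2) * (1 / real (Suc n) powr (3/2)))"
  proof (rule norm_suminf_le)
    show "summable (\<lambda>n. X powr (-1/2) * (1 / real (Suc n) powr (3/2)))"
      by (intro summable_mult summable_Suc_powr) simp
    fix n
    show "norm (f (Suc n) - (if n \<in> ?F then f (Suc n) else 0)) \<le> X powr (-1/2) * (1 / real (Suc n) powr (3/2))"
    proof (cases "n \<in> ?F")
      case False
      then have le: "X \<le> real (Suc n)" by simp
      have "norm (f (Suc n)) \<le> 1 / real (Suc n) powr Re z"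
        unfolding f_def by (rule norm_dirichlet_term[of "\<lambda>n. of_real (mangoldt n / ln (real n))", OF norm_mangoldt_div_ln])
      also have "\<dots> = real (Suc n) powr (-1/2) * (1 / real (Suc n) powr (3/2))"
        unfolding z by (simp add: powr_minus powr_add[symmetric] field_simps del: of_nat_Suc)
      also have "\<dots> \<le> X powr (-1/2) * (1 / real (Suc n) powr (3/2))"
        using le X by (intro mult_right_mono powr_mono2') auto
      finally show ?thesis using False by simp
    qed simp
  qed
  also have "\<dots> = X powr (-1/2) * (\<Sum>n. 1 / real (Suc n) powr (3/2))"
    by (rule suminf_mult[OF summable_Suc_powr]) simp
  also have "\<dots> \<le> 2 / ln X * (\<Sum>n. 1 / real (Suc n) powr (3/2))"
  proof (intro mult_right_mono suminf_nonneg summable_Suc_powr)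
    have "X powr (-1/2) = 1 / X powr (1/2)" using X by (simp add: powr_minus_divide)
    also have "\<dots> \<le> 2 / ln X" using ln_le_two_sqrt[of X] X by (simp add: field_simps)
    finally show "X powr (-1/2) \<le> 2 / ln X" .
  qed auto
  finally show ?thesis unfolding fin eq by simp
qed

text \<open>The trivial bound is enough, because it is multiplied by X^-2 at the point 2 +
  iT.\<close>

lemma psi_error_bound:
  assumes X: "X \<ge> 2" shows "\<bar>psi_error X\<bar> \<le> 2 * X\<^sup>2"
proof -
  have "chebyshev_psi X \<le> (\<Sum>n | real n < X. X)" unfolding chebyshev_psi_def
  proof (rule sum_mono)
    fix n assume n: "n \<in> {n. real n < X}"
    show "mangoldt n \<le> X"
    proof (cases "n = 0")
      case False
      then have "mangoldt n \<le> ln (real n)" by (intro mangoldt_le) simp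
      also have "\<dots> \<le> real n" using False by (intro ln_bound) simp
      finally show ?thesis using n by simp
    qed (use X in simp)
  qed
  also have "\<dots> = real (card {n. real n < X}) * X" by simp
  also have "real (card {n. real n < X}) \<le> X + 1"
  proof -
    have "card {n. real n < X} \<le> card {..<nat \<lceil>X\<rceil>}"
      by (intro card_mono) (auto simp: less_ceiling_iff zless_nat_eq_int_zless)
    then have "real (card {n. real n < X}) \<le> real (nat \<lceil>X\<rceil>)" by simp
    also have "\<dots> \<le> X + 1"
    proof -
      have "0 \<le> \<lceil>X\<rceil>" using X by simp
      then show ?thesis using of_int_ceiling_le_add_one[of X] by simp
    qed
    finally show ?thesis .
  qed
  finally have "chebyshev_psi X \<le> (X + 1) * X" using X by (simp add: mult_right_mono)
  then have "chebyshev_psi X - X \<le> X * X" by (simp add: algebra_simps)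
  moreover have "chebyshev_psi X \<ge> 0" unfolding chebyshev_psi_def by (intro sum_nonneg mangoldt_nonneg)
  moreover have "X * 1 \<le> X * X" using X by (intro mult_left_mono) auto
  ultimately have "\<bar>chebyshev_psi X - X\<bar> \<le> X * X" unfolding mult_1_right by linarith
  then show ?thesis unfolding psi_error_def power2_eq_square by (smt (verit) zero_le_square)
qed

lemma Im_of_real_mult: "Im (of_real r * w) = r * Im w"
  by simp

lemma Im_powr_half_line:
  assumes "x > 0" shows "Im (of_real x powr (- Complex (1/2) T)) = - (sin (T * ln x) / sqrt x)"
proof -
  have "exp (ln (sqrt x)) = sqrt x" using assms by (intro exp_ln) simp
  then have sq: "sqrt x = exp (ln x / 2)" unfolding ln_sqrt[OF less_imp_le[OF assms]] by (rule sym)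
  have "exp (- (ln x / 2)) = 1 / sqrt x" unfolding sq exp_minus by (rule inverse_eq_divide)
  moreover have "of_real x powr (- Complex (1/2) T) = exp (- Complex (1/2) T * of_real (ln x))"
    using assms by (simp add: powr_def Ln_of_real)
  ultimately show ?thesis by (simp add: Im_exp)
qed

lemma has_field_derivative_real_powr_minus:
  fixes z :: complex
  assumes "x > 0"
  shows "((\<lambda>z. of_real x powr (- z)) has_field_derivative (- of_real (ln x) * of_real x powr (- z))) (at z within S)"
proof -
  have "((\<lambda>z. exp (- z * of_real (ln x))) has_field_derivative (- of_real (ln x) * exp (- z * of_real (ln x)))) (at z within S)"
    by (auto intro!: derivative_eq_intros)
  then show ?thesis using assms by (simp add: powr_def Ln_of_real)
qed

text \<open>The vertical part of the path contributes no more than T / X, so it can be counted as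
  error.\<close>

lemma vertical_pole_bound:
  assumes T: "T > 0" and X: "X \<ge> 2"
  shows "norm (contour_integral (linepath 2 (Complex 2 T)) (\<lambda>s. of_real X powr (1 - s) / (1 - s))) \<le> T / X"
proof -
  have re: "Re z = 2" if "z \<in> closed_segment 2 (Complex 2 T)" for z
    using that closed_segment_same_Re[of 2 "Complex 2 T"] by auto
  have "norm (contour_integral (linepath 2 (Complex 2 T)) (\<lambda>s. of_real X powr (1 - s) / (1 - s))) \<le> 1 / X * norm (Complex 2 T - 2)"
  proof (rule contour_integral_bound_linepath)
    show "(\<lambda>s. of_real X powr (1 - s) / (1 - s)) contour_integrable_on linepath 2 (Complex 2 T)"
    proof (rule contour_integrable_continuous_linepath)
      show "continuous_on (closed_segment 2 (Complex 2 T)) (\<lambda>s. of_real X powr (1 - s) / (1 - s))"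
        using X re[of 1] by (intro continuous_intros continuous_on_powr_complex) auto
    qed
    show "0 \<le> 1 / X" using X by simp
    fix z assume z: "z \<in> closed_segment 2 (Complex 2 T)"
    have "norm (of_real X powr (1 - z)) = X powr Re (1 - z)" by (rule norm_powr_of_real) (use X in simp)
    also have "\<dots> = 1 / X" using re[OF z] X by (simp add: powr_minus_divide)
    finally have 1: "norm (of_real X powr (1 - z)) = 1 / X" .
    have "1 \<le> norm (1 - z)" using abs_Re_le_cmod[of "1 - z"] re[OF z] by simp
    moreover from this have "z \<noteq> 1" by auto
    ultimately show "norm (of_real X powr (1 - z) / (1 - z)) \<le> 1 / X"
      unfolding norm_divide 1 using divide_left_mono[of 1 "norm (1 - z)" "1 / X"] X by simp
  qed
  also have "norm (Complex 2 T - 2) = T" using T by (simp add: cmod_def)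
  finally show ?thesis by simp
qed

context rh_zeros
begin

text \<open>For a zero \<rho>, |\<rho>| \<le> |\<rho> - z| + |z| with |z| \<le> T + 2 and |\<rho> -
  z| \<ge> \<open>gap T\<close>; this gives the distance ratio 1 + (T + 2) / \<open>gap T\<close>,
  and the factor z in front of \<open>Tz\<close> gives the other T + 2.\<close>

lemma horizontal_error_bound:
  assumes T: "T > 0" "T \<notin> zeta_ordinates" and X: "X \<ge> 2" and z: "Im z = T" "1/2 \<le> Re z" "Re z \<le> 2"
  shows "norm (deriv zeta z / zeta z + dir_poly X z - of_real (psi_error X) * of_real X powr (- z) - of_real X powr (1 - z) / (1 - z))
     \<le> (norm (1 + b0) + (T + 2) * (1 + (T + 2) / gap T) * zsum) * X powr (1/2 - Re z)"
proof -
  have g: "gap T > 0" using gap_pos T by blast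
  have nzero: "z \<notin> Zeros" using gap_le_Im[OF T, of z] g z(1) by auto
  have z1: "z \<noteq> 1" using z(1) T(1) by auto
  have nz: "norm z \<le> T + 2" using cmod_le[of z] z T(1) by simp
  define K where "K = 1 + (T + 2) / gap T"
  have K0: "K \<ge> 0" using g T by (simp add: K_def)
  have K: "norm \<rho> \<le> K * norm (\<rho> - z)" if "\<rho> \<in> Zeros" for \<rho>
  proof -
    have "gap T \<le> \<bar>Im \<rho> - T\<bar>" by (rule gap_le_Im[OF T that])
    also have "\<dots> \<le> norm (\<rho> - z)" using abs_Im_le_cmod[of "\<rho> - z"] z by simp
    finally have "1 \<le> norm (\<rho> - z) / gap T" using g by simp
    then have "(T + 2) * 1 \<le> (T + 2) * (norm (\<rho> - z) / gap T)" using T by (intro mult_left_mono) auto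
    moreover have "norm \<rho> \<le> norm (\<rho> - z) + norm z" using norm_triangle_ineq[of "\<rho> - z" z] by simp
    ultimately show ?thesis using nz by (simp add: K_def algebra_simps)
  qed
  have X1: "X \<ge> 1" using X by simp
  have "deriv zeta z / zeta z + dir_poly X z - of_real (psi_error X) * of_real X powr (- z) - of_real X powr (1 - z) / (1 - z)
      = (1 + b0) * of_real X powr (- z) - z * Tz X z"
    using truncated_explicit_formula[OF X1 nzero z1 z(2)] by (simp add: algebra_simps)
  also have "norm \<dots> \<le> norm (1 + b0) * norm (of_real X powr (- z)) + norm z * norm (Tz X z)"
    using norm_triangle_ineq4[of "(1 + b0) * of_real X powr (- z)" "z * Tz X z"] by (simp add: norm_mult)
  also have "\<dots> \<le> norm (1 + b0) * X powr (1/2 - Re z) + (T + 2) * (K * zsum * X powr (1/2 - Re z))"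
  proof (intro add_mono mult_mono)
    have "norm (of_real X powr (- z)) = X powr Re (- z)" by (rule norm_powr_of_real) (use X in simp)
    also have "\<dots> \<le> X powr (1/2 - Re z)" using X by (intro powr_mono) auto
    finally show "norm (of_real X powr (- z)) \<le> X powr (1/2 - Re z)" .
    show "norm (Tz X z) \<le> K * zsum * X powr (1/2 - Re z)" by (rule Tz_has_sum_and_bound(2)[OF X1 z(2) K])
  qed (use nz T in auto)
  also have "\<dots> = (norm (1 + b0) + (T + 2) * K * zsum) * X powr (1/2 - Re z)" by (simp add: algebra_simps)
  finally show ?thesis by (simp add: K_def)
qed

text \<open>Besides the horizontal integral there are two corrections: the values at 2 + iT, where
  log zeta is approximated by its truncated series, and the vertical part of the pole integral. Each
  is O(1 / ln X) for elementary reasons.\<close>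

lemma main_estimate:
  assumes T: "T > 0" "T \<notin> zeta_ordinates" and X: "X \<ge> 2"
  defines "D \<equiv> norm (1 + b0) + (T + 2) * (1 + (T + 2) / gap T) * zsum"
  shows "\<bar>pi * zeta_S T - (- weighted_sum T X + smoothing_term T X + pole_term T X)\<bar>
     \<le> (2 * (\<Sum>n. 1 / real (Suc n) powr (3/2)) + 2 + T + D) / ln X"
proof -
  let ?s1 = "Complex 2 T" and ?s0 = "Complex (1/2) T" and ?x = "complex_of_real X"
  let ?pole = "\<lambda>s. ?x powr (1 - s) / (1 - s)"
  have X0: "X > 0" and lnX: "ln X > 0" using X by auto
  have seg: "Im z = T" "1/2 \<le> Re z" "Re z \<le> 2" if "z \<in> closed_segment ?s1 ?s0" for z
    using that by (auto simp: closed_segment_same_Im closed_segment_eq_real_ivl)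
  obtain L where L: "\<And>z. z \<in> closed_segment ?s1 ?s0 \<Longrightarrow> (L has_field_derivative deriv zeta z / zeta z) (at z)"
    "Im (L ?s1) = Im (prime_zeta_log ?s1)" "pi * zeta_S T = Im (L ?s0)"
    using zeta_log_branch[OF T] by blast
  \<comment> \<open>Primitives in z, up to sign, of \<open>dir_poly X\<close> and of the term with
    \<open>psi_error\<close>. Their imaginary parts at 1/2 + iT are minus
    \<open>weighted_sum\<close> and minus \<open>smoothing_term\<close>; the divisions by ln n and
    ln X arise here.\<close>
  define A where "A = (\<lambda>z. \<Sum>n | real n < X. complex_of_real (mangoldt n / ln (real n)) * of_nat n powr (- z))"
  define B where "B = (\<lambda>z. of_real (psi_error X / ln X) * ?x powr (- z))"
  \<comment> \<open>The derivative of \<open>\<Phi>\<close> is \<open>?pole\<close> up to the error controlled by \<open>horizontal_error_bound\<close>.\<close>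
  define \<Phi> where "\<Phi> = (\<lambda>z. L z - A z + B z)"
  define \<phi> where "\<phi> = (\<lambda>z. deriv zeta z / zeta z + dir_poly X z - of_real (psi_error X) * ?x powr (- z))"
  have d\<Phi>: "(\<Phi> has_field_derivative \<phi> z) (at z within closed_segment ?s1 ?s0)" if z: "z \<in> closed_segment ?s1 ?s0" for z
  proof -
    have dA: "(A has_field_derivative - dir_poly X z) (at z within closed_segment ?s1 ?s0)"
      unfolding A_def dir_poly_def sum_negf[symmetric]
    proof (rule DERIV_sum)
      fix n
      show "((\<lambda>z. complex_of_real (mangoldt n / ln (real n)) * of_nat n powr (- z)) has_field_derivative
          - (mangoldt n * of_nat n powr (- z))) (at z within closed_segment ?s1 ?s0)"
      proof (cases "n \<le> 1")
        case True
        then have "n = 0 \<or> n = Suc 0" by auto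
        then have "mangoldt n = (0::real)" "mangoldt n = (0::complex)" by auto
        then show ?thesis by simp
      next
        case False
        then have "real n > 0" "ln (real n) \<noteq> 0" by auto
        from DERIV_cmult[OF has_field_derivative_real_powr_minus[OF this(1)], of "complex_of_real (mangoldt n / ln (real n))"] this(2)
        show ?thesis by simp
      qed
    qed
    have dB: "(B has_field_derivative - (of_real (psi_error X) * ?x powr (- z))) (at z within closed_segment ?s1 ?s0)"
      unfolding B_def using DERIV_cmult[OF has_field_derivative_real_powr_minus[OF X0], of "complex_of_real (psi_error X / ln X)"] lnX
      by simp
    have "(\<Phi> has_field_derivative deriv zeta z / zeta z - (- dir_poly X z) + - (of_real (psi_error X) * ?x powr (- z))) (at z within closed_segment ?s1 ?s0)"
      unfolding \<Phi>_def by (rule DERIV_add[OF DERIV_diff[OF has_field_derivative_at_within[OF L(1)[OF z]] dA] dB])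
    then show ?thesis by (simp add: \<phi>_def)
  qed
  have cont_pole: "continuous_on (closed_segment ?s1 ?s0) ?pole"
    using X seg(1)[of 1] T(1) by (intro continuous_intros continuous_on_powr_complex) auto
  define H where "H = contour_integral (linepath ?s1 ?s0) ?pole"
  have H: "(?pole has_contour_integral H) (linepath ?s1 ?s0)" unfolding H_def
    by (rule has_contour_integral_integral[OF contour_integrable_continuous_linepath[OF cont_pole]])
  have "(\<phi> has_contour_integral (\<Phi> (pathfinish (linepath ?s1 ?s0)) - \<Phi> (pathstart (linepath ?s1 ?s0)))) (linepath ?s1 ?s0)"
    by (rule contour_integral_primitive[where S = "closed_segment ?s1 ?s0"]) (auto intro: d\<Phi>)
  then have "(\<phi> has_contour_integral (\<Phi> ?s0 - \<Phi> ?s1)) (linepath ?s1 ?s0)" by simp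
  from has_contour_integral_diff[OF this H]
  have E: "((\<lambda>z. \<phi> z - ?pole z) has_contour_integral (\<Phi> ?s0 - \<Phi> ?s1 - H)) (linepath ?s1 ?s0)" .
  have D0: "D \<ge> 0" using T gap_pos[OF T] zsum_nonneg unfolding D_def
    by (intro add_nonneg_nonneg mult_nonneg_nonneg) auto
  have hor: "norm (\<Phi> ?s0 - \<Phi> ?s1 - H) \<le> D / ln X"
  proof -
    let ?h = "\<lambda>t. (\<phi> (linepath ?s1 ?s0 t) - ?pole (linepath ?s1 ?s0 t)) * (?s0 - ?s1)"
    \<comment> \<open>On the segment Re z = 2 - 3/2 * t, so the exponential is X^(1/2 - Re z) and
      3/2 is the length of the segment. The exponent reaches 0 only at t = 1, so the integral is at
      most D / ln X.\<close>
    let ?k = "\<lambda>t. 3/2 * D * exp (ln X * (3/2 * t - 3/2))"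
    let ?G = "\<lambda>t. D * exp (ln X * (3/2 * t - 3/2)) / ln X"
    have hi: "(?h has_integral (\<Phi> ?s0 - \<Phi> ?s1 - H)) {0..1}"
      using E unfolding has_contour_integral_linepath .
    have ki: "(?k has_integral (?G 1 - ?G 0)) {0..1}"
    proof (rule fundamental_theorem_of_calculus)
      fix t :: real
      have "(?G has_real_derivative ?k t) (at t within {0..1})"
        using lnX by (auto intro!: derivative_eq_intros)
      then show "(?G has_vector_derivative ?k t) (at t within {0..1})"
        by (simp add: has_real_derivative_iff_has_vector_derivative)
    qed simp
    have "norm (integral {0..1} ?h) \<le> integral {0..1} ?k"
    proof (rule integral_norm_bound_integral)
      show "?h integrable_on {0..1}" using hi by (auto simp: integrable_on_def)
      show "?k integrable_on {0..1}" using ki by (auto simp: integrable_on_def)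
      fix t :: real assume t: "t \<in> {0..1}"
      let ?z = "linepath ?s1 ?s0 t"
      have zs: "?z \<in> closed_segment ?s1 ?s0" using linepath_in_path[OF t] .
      have re: "Re ?z = 2 - 3/2 * t" by (simp add: linepath_def algebra_simps)
      have n: "norm (?s0 - ?s1) = 3/2" by (simp add: cmod_def)
      have "norm (\<phi> ?z - ?pole ?z) \<le> D * X powr (1/2 - Re ?z)"
        unfolding \<phi>_def D_def by (rule horizontal_error_bound[OF T X seg[OF zs]])
      also have "X powr (1/2 - Re ?z) = exp (ln X * (3/2 * t - 3/2))"
        using X0 unfolding re by (simp add: powr_def algebra_simps)
      finally show "norm (?h t) \<le> ?k t" unfolding norm_mult n by simp
    qed
    also have "integral {0..1} ?k = ?G 1 - ?G 0" by (rule integral_unique[OF ki])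
    also have "\<dots> \<le> D / ln X" using D0 lnX by simp
    finally show ?thesis unfolding integral_unique[OF hi] .
  qed
  have ImA: "Im (A ?s0) = - weighted_sum T X"
  proof -
    have "Im (A ?s0) = (\<Sum>n | real n < X. - (mangoldt n * sin (T * ln (real n)) / (sqrt (real n) * ln (real n))))"
      unfolding A_def Im_sum
    proof (rule sum.cong)
      fix n
      show "Im (complex_of_real (mangoldt n / ln (real n)) * of_nat n powr (- ?s0)) = - (mangoldt n * sin (T * ln (real n)) / (sqrt (real n) * ln (real n)))"
      proof (cases "n = 0")
        case False
        then have "Im (of_nat n powr (- ?s0)) = - (sin (T * ln (real n)) / sqrt (real n))"
          using Im_powr_half_line[of "real n" T] by simp
        then show ?thesis unfolding Im_of_real_mult by simp
      qed simp
    qed simp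
    then show ?thesis by (simp add: weighted_sum_def sum_negf)
  qed
  have ImB: "Im (B ?s0) = - smoothing_term T X"
    unfolding B_def Im_of_real_mult Im_powr_half_line[OF X0] smoothing_term_def by simp
  have main: "Im (\<Phi> ?s0) = pi * zeta_S T + weighted_sum T X - smoothing_term T X"
    unfolding \<Phi>_def using L(3) ImA ImB by simp
  define V where "V = contour_integral (linepath 2 ?s1) ?pole"
  have pt: "pole_term T X = Im V + Im H"
  proof -
    have re: "Re z = 2" if "z \<in> closed_segment 2 ?s1" for z
      using that closed_segment_same_Re[of 2 "Complex 2 T"] by auto
    have "continuous_on (closed_segment 2 ?s1) ?pole"
      using X re[of 1] by (intro continuous_intros continuous_on_powr_complex) auto
    then have "?pole contour_integrable_on linepath 2 ?s1" by (rule contour_integrable_continuous_linepath)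
    moreover have "?pole contour_integrable_on linepath ?s1 ?s0" by (rule contour_integrable_continuous_linepath[OF cont_pole])
    ultimately have "contour_integral (L_path T) ?pole = V + H"
      unfolding L_path_def V_def H_def by (intro contour_integral_join) auto
    then show ?thesis by (simp add: pole_term_def)
  qed
  have start: "\<bar>Im (\<Phi> ?s1)\<bar> \<le> 2 * (\<Sum>n. 1 / real (Suc n) powr (3/2)) / ln X + 2 / ln X"
  proof -
    have "Im (\<Phi> ?s1) = Im (prime_zeta_log ?s1 - A ?s1) + Im (B ?s1)" unfolding \<Phi>_def using L(2) by simp
    moreover have "\<bar>Im (prime_zeta_log ?s1 - A ?s1)\<bar> \<le> 2 * (\<Sum>n. 1 / real (Suc n) powr (3/2)) / ln X"
      using order_trans[OF abs_Im_le_cmod prime_zeta_log_tail[OF X, of ?s1]] by (simp add: A_def)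
    moreover have "\<bar>Im (B ?s1)\<bar> \<le> 2 / ln X"
    proof -
      have "norm (?x powr (- ?s1)) = 1 / X\<^sup>2"
        using norm_powr_of_real[OF X0, of "- ?s1"] X0 by (simp add: powr_minus_divide powr_numeral)
      then have "norm (B ?s1) = \<bar>psi_error X\<bar> / ln X * (1 / X\<^sup>2)" unfolding B_def norm_mult norm_of_real using lnX by simp
      also have "\<dots> \<le> 2 * X\<^sup>2 / ln X * (1 / X\<^sup>2)"
        using psi_error_bound[OF X] lnX X0 by (intro mult_right_mono divide_right_mono) auto
      also have "\<dots> = 2 / ln X" using X0 by simp
      finally show ?thesis using abs_Im_le_cmod[of "B ?s1"] by linarith
    qed
    ultimately show ?thesis by linarith
  qed
  have vert: "\<bar>Im V\<bar> \<le> T / ln X"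
  proof -
    have "\<bar>Im V\<bar> \<le> T / X" using order_trans[OF abs_Im_le_cmod vertical_pole_bound[OF T(1) X]] by (simp add: V_def)
    also have "\<dots> \<le> T / ln X" using T lnX X0 ln_bound[OF X0] by (intro divide_left_mono mult_pos_pos) auto
    finally show ?thesis .
  qed
  have "pi * zeta_S T - (- weighted_sum T X + smoothing_term T X + pole_term T X) =
      Im (\<Phi> ?s0 - \<Phi> ?s1 - H) + Im (\<Phi> ?s1) - Im V"
    using main pt by simp
  moreover have "\<bar>Im (\<Phi> ?s0 - \<Phi> ?s1 - H)\<bar> \<le> D / ln X" using order_trans[OF abs_Im_le_cmod hor] .
  ultimately have "\<bar>pi * zeta_S T - (- weighted_sum T X + smoothing_term T X + pole_term T X)\<bar> \<le>
     D / ln X + (2 * (\<Sum>n. 1 / real (Suc n) powr (3/2)) / ln X + 2 / ln X) + T / ln X"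
    using start vert by linarith
  also have "\<dots> = (2 * (\<Sum>n. 1 / real (Suc n) powr (3/2)) + 2 + T + D) / ln X"
    by (simp add: add_divide_distrib)
  finally show ?thesis .
qed

text \<open>Comparing \<open>T\<close> with one fixed zero shows that the gap around \<open>T\<close> is at most a multiple of \<open>T\<close>;
  this absorbs every error term into \<open>T ^ 3 / \<delta>\<^sup>2\<close>.\<close>

lemma uniform_estimate:
  assumes T0: "T\<^sub>0 > 0"
  obtains c where "\<And>T X. T \<ge> T\<^sub>0 \<Longrightarrow> X \<ge> 2 \<Longrightarrow> T \<notin> zeta_ordinates \<Longrightarrow>
    \<bar>pi * zeta_S T - (- weighted_sum T X + smoothing_term T X + pole_term T X)\<bar>
      \<le> c * (T ^ 3 / ((infdist T zeta_ordinates)\<^sup>2 * ln X))"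
proof -
  obtain \<rho> where \<rho>: "\<rho> \<in> nontrivial_zeta_zeros" using ordinates_nonempty by blast
  \<comment> \<open>For T \<ge> \<open>T\<^sub>0\<close>, \<open>M\<close> and \<open>N\<close> are
    such that \<delta> \<le> M T and T + 2 \<le> N T; this is how the final constant comes to depend
    on \<open>T\<^sub>0\<close>.\<close>
  define M where "M = 1 + \<bar>Im \<rho>\<bar> / T\<^sub>0"
  define N where "N = 1 + 2 / T\<^sub>0"
  define S where "S = (\<Sum>n. 1 / real (Suc n) powr (3/2))"
  define C1 where "C1 = (2 * S + 2 + norm (1 + b0)) / T\<^sub>0 + 1"
  define C2 where "C2 = N * (M * (1 + N)) * zsum"
  have S0: "S \<ge> 0" unfolding S_def by (intro suminf_nonneg summable_Suc_powr) auto
  have M1: "M \<ge> 1" and N1: "N \<ge> 1" using T0 by (auto simp: M_def N_def)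
  have C10: "C1 \<ge> 0" using S0 T0 unfolding C1_def by (intro add_nonneg_nonneg divide_nonneg_pos) auto
  have C20: "C2 \<ge> 0" using M1 N1 zsum_nonneg unfolding C2_def by (intro mult_nonneg_nonneg) auto
  have "\<bar>pi * zeta_S T - (- weighted_sum T X + smoothing_term T X + pole_term T X)\<bar>
      \<le> (C1 * M\<^sup>2 + C2 * M) * (T ^ 3 / ((infdist T zeta_ordinates)\<^sup>2 * ln X))"
    if TX: "T \<ge> T\<^sub>0" "X \<ge> 2" "T \<notin> zeta_ordinates" for T X
  proof -
    have T: "T > 0" using TX(1) T0 by simp
    have lnX: "ln X > 0" using TX by simp
    define \<delta> where "\<delta> = infdist T zeta_ordinates"
    have \<delta>: "\<delta> > 0" unfolding \<delta>_def by (rule ordinate_gap(1)[OF TX(3)])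
    \<comment> \<open>The target T^3 / \<delta>^2 is T q^2. Since M q \<ge> 1, a bound with a lower
      power of q can be raised to the square at the price of powers of M.\<close>
    define q where "q = T / \<delta>"
    have q: "q > 0" using T \<delta> by (simp add: q_def)
    have "\<delta> \<le> \<bar>Im \<rho> - T\<bar>" unfolding \<delta>_def by (rule ordinate_gap(2)[OF TX(3) \<rho>])
    also have "\<dots> \<le> T + \<bar>Im \<rho>\<bar>" using T by linarith
    also have "\<bar>Im \<rho>\<bar> = \<bar>Im \<rho>\<bar> / T\<^sub>0 * T\<^sub>0" using T0 by simp
    also have "\<dots> \<le> \<bar>Im \<rho>\<bar> / T\<^sub>0 * T" using TX(1) T0 by (intro mult_left_mono) auto
    finally have dM: "\<delta> \<le> M * T" by (simp add: M_def algebra_simps)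
    have Mq: "M * q \<ge> 1" using dM \<delta> by (simp add: q_def field_simps)
    have gapM: "T / gap T \<le> M * q"
    proof (cases "\<delta> \<le> T")
      case True
      then have "T / gap T = q" by (simp add: gap_def \<delta>_def q_def min_def)
      also have "q \<le> M * q" using mult_right_mono[OF M1, of q] q by simp
      finally show ?thesis .
    next
      case False
      then have "gap T = T" by (simp add: gap_def \<delta>_def)
      then show ?thesis using Mq T by simp
    qed
    have "2 = 2 / T\<^sub>0 * T\<^sub>0" using T0 by simp
    also have "\<dots> \<le> 2 / T\<^sub>0 * T" using TX(1) T0 by (intro mult_left_mono) auto
    finally have TN: "T + 2 \<le> N * T" by (simp add: N_def algebra_simps)
    have gp: "gap T > 0" by (rule gap_pos[OF T TX(3)])
    have "(T + 2) / gap T \<le> N * T / gap T" using TN gp by (intro divide_right_mono) auto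
    also have "\<dots> = N * (T / gap T)" by simp
    also have "\<dots> \<le> N * (M * q)" using gapM N1 by (intro mult_left_mono) auto
    finally have "1 + (T + 2) / gap T \<le> M * (1 + N) * q" using Mq by (simp add: algebra_simps)
    then have "(T + 2) * (1 + (T + 2) / gap T) * zsum \<le> (N * T) * (M * (1 + N) * q) * zsum"
      using TN T gp N1 M1 zsum_nonneg q by (intro mult_right_mono mult_mono) auto
    also have "\<dots> = C2 * (T * q) * 1" by (simp add: C2_def)
    also have "\<dots> \<le> C2 * (T * q) * (M * q)" using Mq C20 T q by (intro mult_left_mono) auto
    finally have 2: "(T + 2) * (1 + (T + 2) / gap T) * zsum \<le> C2 * M * (T * q\<^sup>2)"
      by (simp add: power2_eq_square mult_ac)
    have "2 * S + 2 + norm (1 + b0) = (2 * S + 2 + norm (1 + b0)) / T\<^sub>0 * T\<^sub>0" using T0 by simp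
    also have "\<dots> \<le> (2 * S + 2 + norm (1 + b0)) / T\<^sub>0 * T" using TX(1) T0 S0 by (intro mult_left_mono) auto
    finally have "2 * S + 2 + T + norm (1 + b0) \<le> C1 * T * 1" by (simp add: C1_def algebra_simps)
    also have "\<dots> \<le> C1 * T * (M * q)\<^sup>2" using Mq C10 T by (intro mult_left_mono one_le_power) auto
    also have "\<dots> = C1 * M\<^sup>2 * (T * q\<^sup>2)" by (simp add: power_mult_distrib)
    finally have 1: "2 * S + 2 + T + norm (1 + b0) \<le> C1 * M\<^sup>2 * (T * q\<^sup>2)" .
    have "\<bar>pi * zeta_S T - (- weighted_sum T X + smoothing_term T X + pole_term T X)\<bar>
       \<le> (2 * S + 2 + T + (norm (1 + b0) + (T + 2) * (1 + (T + 2) / gap T) * zsum)) / ln X"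
      unfolding S_def by (rule main_estimate[OF T TX(3,2)])
    also have "\<dots> \<le> ((C1 * M\<^sup>2 + C2 * M) * (T * q\<^sup>2)) / ln X"
      using 1 2 lnX by (intro divide_right_mono) (auto simp: algebra_simps)
    also have "T * q\<^sup>2 = T ^ 3 / \<delta>\<^sup>2" by (simp add: q_def power_divide eval_nat_numeral)
    finally show ?thesis by (simp add: \<delta>_def)
  qed
  then show ?thesis by (rule that)
qed

end

text \<open>The implied constant is uniform in X and in all T \<ge> \<open>T\<^sub>0\<close>, for
  each \<open>T\<^sub>0 > 0\<close>; the limit follows by taking \<open>T\<^sub>0\<close> equal to
  T.\<close>

theorem theorem5:
  assumes "riemann_hypothesis"
  shows "(\<forall>T\<^sub>0>0. \<exists>C. \<forall>T\<ge>T\<^sub>0. \<forall>X\<ge>2. T \<notin> zeta_ordinates \<longrightarrow>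
            \<bar>pi * zeta_S T - (- weighted_sum T X + smoothing_term T X + pole_term T X)\<bar>
              \<le> C * (T ^ 3 / ((infdist T zeta_ordinates)\<^sup>2 * ln X)))
       \<and> (\<forall>T>0. T \<notin> zeta_ordinates \<longrightarrow>
            ((\<lambda>X. weighted_sum T X - smoothing_term T X - pole_term T X)
               \<longlongrightarrow> - (pi * zeta_S T)) at_top)"
proof (intro conjI allI impI)
  obtain K where "rh_zeros K" using rh_zeros_exists[OF assms] by blast
  then interpret rh_zeros K .
  show "\<exists>C. \<forall>T\<ge>T\<^sub>0. \<forall>X\<ge>2. T \<notin> zeta_ordinates \<longrightarrow>
            \<bar>pi * zeta_S T - (- weighted_sum T X + smoothing_term T X + pole_term T X)\<bar>
              \<le> C * (T ^ 3 / ((infdist T zeta_ordinates)\<^sup>2 * ln X))" if "T\<^sub>0 > 0" for T\<^sub>0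
    using uniform_estimate[OF that] by metis
  fix T :: real assume T: "0 < T" "T \<notin> zeta_ordinates"
  obtain c where c: "\<And>X. X \<ge> 2 \<Longrightarrow>
    \<bar>pi * zeta_S T - (- weighted_sum T X + smoothing_term T X + pole_term T X)\<bar>
      \<le> c * (T ^ 3 / ((infdist T zeta_ordinates)\<^sup>2 * ln X))"
    using uniform_estimate[OF T(1)] T(2) by (metis order.refl)
  have "((\<lambda>X. (weighted_sum T X - smoothing_term T X - pole_term T X) - (- (pi * zeta_S T))) \<longlongrightarrow> 0) at_top"
  proof (rule Lim_null_comparison)
    show "\<forall>\<^sub>F X in at_top. norm ((weighted_sum T X - smoothing_term T X - pole_term T X) - (- (pi * zeta_S T)))
        \<le> c * T ^ 3 / (infdist T zeta_ordinates)\<^sup>2 * inverse (ln X)"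
      using eventually_ge_at_top[of 2]
    proof eventually_elim
      case (elim X)
      then show ?case using c[OF elim] by (simp add: divide_inverse algebra_simps)
    qed
    have "((\<lambda>X::real. inverse (ln X)) \<longlongrightarrow> 0) at_top"
      by (rule tendsto_inverse_0_at_top[OF ln_at_top])
    then show "((\<lambda>X. c * T ^ 3 / (infdist T zeta_ordinates)\<^sup>2 * inverse (ln X)) \<longlongrightarrow> 0) at_top"
      by (rule tendsto_mult_right_zero)
  qed
  then show "((\<lambda>X. weighted_sum T X - smoothing_term T X - pole_term T X) \<longlongrightarrow> - (pi * zeta_S T)) at_top"
    by (rule LIM_zero_cancel)
qed

end
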